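(* Let $\theta\in\mathbb R$ and let $\phi:\mathbb{C}_\theta\to\mathbb{C}_{\frac12}$ be a function which is analytic on some half-plane $\mathbb{C}_\mu$ ($\mu\ge\theta$) and has there the form $\phi(s)=c_0s+\varphi(s)$ with $c_0\in\mathbb{N}\cup\{0\}$ and $\varphi\in\mathcal{D}$. Then $\phi$ defines a continuous composition operator $C_\phi:\mathcal{H}_+\to\mathcal{H}_+$ if and only if $\phi$ has an analytic extension to $\mathbb{C}_+$ such that 1. $\phi(\mathbb{C}_+)\subseteq\mathbb{C}_+$ if $c_0\in\mathbb{N}$ (i.e. $c_0\ge1$); 2. $\phi(\mathbb{C}_+)\subseteq\mathbb{C}_{\frac12}$ if $c_0=0$.
   Context: For $\sigma\in\mathbb{R}$, $\mathbb{C}_\sigma=\{s\in\mathbb{C}:\operatorname{Re}s>\sigma\}$ and $\mathbb{C}_+=\mathbb{C}_0$. $\mathcal{D}$ is the space of Dirichlet series that converge at some point of $\mathbb{C}$. $\mathcal{H}_{+}$ is the space of Dirichlet series $D=\sum a_nn^{-s}$ such that $\|D\|_{2,k}:=\big(\sum_n|a_n|^2n^{-2/k}\big)^{1/2}<\infty$ for every $k\in\mathbb{N}$, with the Fréchet topology given by these seminorms; each such series converges absolutely on $\mathbb{C}_{\frac12}$. For $\phi$ as in the claim and $D\in\mathcal{H}_+$, the function $C_\phi(D)=D\circ\phi$ is represented on some half-plane by a Dirichlet series in $\mathcal{D}$; "$\phi$ defines a continuous composition operator $C_\phi:\mathcal{H}_+\to\mathcal{H}_+$" means that this Dirichlet series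 belongs to $\mathcal{H}_+$ for every $D\in\mathcal{H}_+$ and that the linear map $C_\phi$ is continuous. "Analytic extension to $\mathbb{C}_+$" means a holomorphic function on $\mathbb{C}_+$ (again denoted $\phi$) that agrees with the given $\phi$ on a half-plane where the latter is analytic. *)

theory Defs
  imports "HOL-Analysis.Analysis"
begin

definition half_plane :: "real \<Rightarrow> complex set" where
  "half_plane \<sigma> = {s. Re s > \<sigma>}"

text \<open>
  A Dirichlet series is its coefficient sequence \<open>a\<close>, indexed from \<open>1\<close>. The index \<open>0\<close> carries no
  information: \<open>0 powr z = 0\<close>, so its term vanishes in every sum below, and the spaces of series
  require \<open>a 0 = 0\<close> so that distinct elements are distinct series. Sums are taken in the order
  of \<open>n\<close>, because convergence may be conditional.
\<close>

definition dirichlet_term :: "(nat \<Rightarrow> complex) \<Rightarrow> complex \<Rightarrow> nat \<Rightarrow> complex" where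
  "dirichlet_term a s n = a n * of_nat n powr (- s)"

definition dirichlet_sum :: "(nat \<Rightarrow> complex) \<Rightarrow> complex \<Rightarrow> complex" where
  "dirichlet_sum a s = (\<Sum>n. dirichlet_term a s n)"

definition dirichlet_space :: "(nat \<Rightarrow> complex) set" where
  "dirichlet_space = {a. a 0 = 0 \<and> (\<exists>s. summable (dirichlet_term a s))}"

definition H_term :: "nat \<Rightarrow> (nat \<Rightarrow> complex) \<Rightarrow> nat \<Rightarrow> real" where
  "H_term k a n = (cmod (a n))\<^sup>2 * real n powr (- 2 / real k)"

text \<open>The seminorm \<open>H_norm k\<close> is meaningful for \<open>k \<ge> 1\<close> and where the sum is finite.\<close>

definition H_norm :: "nat \<Rightarrow> (nat \<Rightarrow> complex) \<Rightarrow> real" where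
  "H_norm k a = sqrt (\<Sum>n. H_term k a n)"

definition H_plus :: "(nat \<Rightarrow> complex) set" where
  "H_plus = {a. a 0 = 0 \<and> (\<forall>k\<ge>1. summable (H_term k a))}"

text \<open>The topology defined by the seminorms: their open balls form a subbase.\<close>

definition H_plus_topology :: "(nat \<Rightarrow> complex) topology" where
  "H_plus_topology = topology_generated_by
     {{b \<in> H_plus. H_norm k (\<lambda>n. b n - a n) < r} | k a r. k \<ge> 1 \<and> a \<in> H_plus \<and> r > 0}"

text \<open>
  The condition passes to smaller half-planes, so \<open>\<nu>\<close> may be taken as large as desired and \<open>f\<close> need
  only be meaningful on some half-plane.
\<close>

definition represented_by :: "(complex \<Rightarrow> complex) \<Rightarrow> (nat \<Rightarrow> complex) \<Rightarrow> bool" where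
  "represented_by f b \<longleftrightarrow> b \<in> dirichlet_space \<and>
     (\<exists>\<nu>. \<forall>s\<in>half_plane \<nu>. summable (dirichlet_term b s) \<and> f s = dirichlet_sum b s)"

text \<open>
  The map \<open>T\<close> is the composition operator of \<open>\<phi>\<close> on \<open>H_plus\<close>. Since the coefficients of a
  Dirichlet series are determined by its sum on any half-plane, \<open>T\<close> is unique on \<open>H_plus\<close>, and linear.
\<close>

definition continuous_composition_operator :: "(complex \<Rightarrow> complex) \<Rightarrow> bool" where
  "continuous_composition_operator \<phi> \<longleftrightarrow>
     (\<exists>T. (\<forall>a\<in>H_plus. T a \<in> H_plus \<and> represented_by (\<lambda>s. dirichlet_sum a (\<phi> s)) (T a)) \<and>
          continuous_map H_plus_topology H_plus_topology T)"

text \<open>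
  The bound on \<open>\<nu>\<close> keeps the half-plane of agreement inside both domains, \<open>half_plane \<theta>\<close> for
  \<open>\<phi>\<close> and \<open>half_plane 0\<close> for \<open>\<Phi>\<close>; the values of the total functions elsewhere are junk.
\<close>

definition analytic_extension :: "real \<Rightarrow> (complex \<Rightarrow> complex) \<Rightarrow> (complex \<Rightarrow> complex) \<Rightarrow> bool" where
  "analytic_extension \<theta> \<phi> \<Phi> \<longleftrightarrow> \<Phi> holomorphic_on half_plane 0 \<and>
     (\<exists>\<nu>\<ge>max \<theta> 0. \<phi> analytic_on half_plane \<nu> \<and> (\<forall>s\<in>half_plane \<nu>. \<Phi> s = \<phi> s))"

end

theory Submission
  imports Defs "HOL-Complex_Analysis.Complex_Analysis"
begin

text \<open>
  Sufficiency. Harnack's inequality shows that \<open>\<Phi>\<close> maps each half-plane \<open>Re s \<ge> \<epsilon>\<close> into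
  \<open>Re s \<ge> \<kappa> + \<delta>\<close> for some \<open>\<delta> > 0\<close>, where \<open>\<kappa> = 1/2\<close> if \<open>c0 = 0\<close> and \<open>\<kappa> = 0\<close> otherwise. By a
  Bessel inequality the norm of the coefficients of \<open>P \<circ> \<Phi>\<close>, for a Dirichlet polynomial \<open>P\<close>, is at
  most its quadratic mean on \<open>Re s = \<epsilon>\<close>. If \<open>c0 = 0\<close>, then \<open>P \<circ> \<Phi>\<close> is bounded there by Cauchy-Schwarz.
  If \<open>c0 \<ge> 1\<close>, then \<open>\<bar>P\<bar>\<^sup>2 \<le> Re G\<close> on \<open>Re s \<ge> \<delta>\<close> with \<open>G\<close> holomorphic and bounded, tending to the
  squared norm of \<open>P\<close> as \<open>Re s \<rightarrow> \<infinity>\<close>; by Cauchy's theorem the mean of \<open>G \<circ> \<Phi>\<close> does not depend on the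
  vertical line, so it equals that squared norm. General series follow by truncation.

  Necessity. Restricting a series in \<open>H_plus\<close> to the \<open>p\<close>-smooth integers is multiplicative and yields
  a series converging absolutely on the right half-plane. The restrictions of \<open>2 powr -\<phi>\<close> and
  \<open>3 powr -\<phi>\<close> are therefore holomorphic there, and they have no zeros, since the orders \<open>m\<close>, \<open>l\<close> of a
  common zero would satisfy \<open>3 ^ m = 2 ^ l\<close>. So \<open>\<phi>\<close> has a \<open>p\<close>-smooth version \<open>\<Phi>\<^sub>p\<close> on the right
  half-plane. Continuity of the operator bounds the evaluation of polynomials at \<open>\<Phi>\<^sub>p s\<close>, and testing
  with a truncated reproducing kernel gives \<open>Re (\<Phi>\<^sub>p s) > \<kappa>\<close>. The resulting uniform bounds let
  \<open>p \<rightarrow> \<infinity>\<close> by Montel's theorem.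
\<close>

section \<open>Dirichlet series as functionals of multiplicative characters\<close>

text \<open>A series in \<open>H_plus\<close> is only known to converge for real parts above 1/2,
  whereas the symbol has to reach \<open>half_plane 0\<close>. Smooth integers remove this obstacle:
  only finitely many primes occur in them, so the sum of \<open>n powr -\<alpha>\<close> over them
  is finite for every positive \<alpha>, and Cauchy-Schwarz against a seminorm works at any positive
  abscissa. Their indicator is completely multiplicative, so the product structure of the
  \<open>n powr -\<phi>\<close> survives the restriction.

  The two values of \<kappa> come from the supply of test functions. At a point of real part
  \<open>x\<close> the truncated kernel has as squared norm the sum of
  \<open>n powr (2 / k - 2 * x)\<close> over the admissible \<open>n\<close>. If
  \<open>c0 = 0\<close>, all \<open>n\<close> are admissible and boundedness forces
  \<open>x > 1 / 2\<close>. If \<open>c0 \<ge> 1\<close>, the factor \<open>n powr (-c0 * s)\<close>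
  restricts to 0 unless \<open>n\<close> is smooth, and the powers of 2 force \<open>x > 0\<close>.

  In the sufficiency part a series cannot be evaluated where \<Phi> is close to the imaginary axis.
  All estimates are therefore made for polynomials, with constants independent of the degree, and
  passed to the limit coefficient by coefficient.\<close>

lemma double_series:
  fixes f :: "nat \<Rightarrow> nat \<Rightarrow> 'a::banach"
  assumes sm: "\<And>j. summable (\<lambda>n. norm (f j n))" and le: "\<And>j. (\<Sum>n. norm (f j n)) \<le> B j"
    and B: "summable B"
  shows "\<And>n. summable (\<lambda>j. norm (f j n))"
    and "summable (\<lambda>n. \<Sum>j. norm (f j n))"
    and "(\<Sum>n. \<Sum>j. norm (f j n)) \<le> suminf B"
    and "summable (\<lambda>j. \<Sum>n. f j n)"
    and "(\<lambda>n. \<Sum>j. f j n) sums (\<Sum>j. \<Sum>n. f j n)"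
proof -
  \<comment> \<open>On absolutely summable sequences \<open>infsum\<close> and \<open>suminf\<close>
    agree, so the interchange of sums can be carried out with \<open>infsum\<close>.\<close>
  have inf_eq: "infsum g UNIV = suminf g" if "summable (\<lambda>n. norm (g n))" for g :: "nat \<Rightarrow> 'b::banach"
    using norm_summable_imp_has_sum[OF that] summable_norm_cancel[OF that]
    by (metis infsumI summable_sums)
  have nn: "0 \<le> (\<Sum>n. norm (f j n))" for j by (simp add: suminf_nonneg sm)
  have sB: "summable (\<lambda>j. \<Sum>n. norm (f j n))"
    by (rule summable_comparison_test'[OF B, of 0]) (use nn le in auto)
  have P: "(\<lambda>x. norm ((\<lambda>(j,n). f j n) x)) summable_on (UNIV \<times> UNIV)"
    unfolding Infinite_Sum.abs_summable_on_Sigma_iff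
    using sm sB nn by (auto simp: inf_eq intro!: norm_summable_imp_summable_on)
  have "(\<lambda>x. norm (((\<lambda>(n,j). f j n) \<circ> prod.swap) x)) summable_on (UNIV \<times> UNIV)"
    using P by (simp add: o_def case_prod_unfold)
  then have Q: "(\<lambda>x. norm ((\<lambda>(n,j). f j n) x)) summable_on (UNIV \<times> UNIV)"
    using summable_on_reindex[of prod.swap "UNIV \<times> UNIV" "\<lambda>(n,j). norm (f j n)"]
    by (simp add: o_def case_prod_unfold)
  have s1: "(\<lambda>j. norm (f j n)) summable_on UNIV" for n
    using Q unfolding Infinite_Sum.abs_summable_on_Sigma_iff by auto
  then show s1': "summable (\<lambda>j. norm (f j n))" for n
    by (simp add: summable_on_UNIV_nonneg_real_iff)
  have nn2: "0 \<le> (\<Sum>j. norm (f j n))" for n by (simp add: suminf_nonneg s1')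
  have e1: "(\<Sum>\<^sub>\<infinity>j. norm (f j n)) = (\<Sum>j. norm (f j n))" for n
    using inf_eq[of "\<lambda>j. norm (f j n)"] s1' by simp
  have e2: "(\<Sum>\<^sub>\<infinity>n. norm (f j n)) = (\<Sum>n. norm (f j n))" for j
    using inf_eq[of "\<lambda>n. norm (f j n)"] sm by simp
  have "(\<lambda>n. norm (\<Sum>\<^sub>\<infinity>j. norm (f j n))) summable_on UNIV"
    using Q unfolding Infinite_Sum.abs_summable_on_Sigma_iff by simp
  then show s2: "summable (\<lambda>n. \<Sum>j. norm (f j n))"
    using nn2 by (simp add: e1 summable_on_UNIV_nonneg_real_iff)
  have "(\<Sum>\<^sub>\<infinity>j. \<Sum>\<^sub>\<infinity>n. norm (f j n)) = (\<Sum>\<^sub>\<infinity>n. \<Sum>\<^sub>\<infinity>j. norm (f j n))"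
    by (rule infsum_swap_banach) (use P in \<open>simp add: case_prod_unfold\<close>)
  then have eq: "(\<Sum>j. \<Sum>n. norm (f j n)) = (\<Sum>n. \<Sum>j. norm (f j n))"
    unfolding e1 e2 using s2 sB nn nn2 by (simp add: inf_eq)
  show "(\<Sum>n. \<Sum>j. norm (f j n)) \<le> suminf B"
    unfolding eq[symmetric] by (rule suminf_le[OF le sB B])
  have i1: "infsum (f j) UNIV = suminf (f j)" for j using inf_eq[OF sm] .
  have i2: "infsum (\<lambda>j. f j n) UNIV = (\<Sum>j. f j n)" for n using inf_eq[OF s1'] .
  have n1: "summable (\<lambda>j. norm (\<Sum>n. f j n))"
    by (rule summable_comparison_test'[OF sB, of 0]) (use summable_norm[OF sm] in auto)
  have n2: "summable (\<lambda>n. norm (\<Sum>j. f j n))"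
    by (rule summable_comparison_test'[OF s2, of 0]) (use summable_norm[OF s1'] in auto)
  have "(\<Sum>\<^sub>\<infinity>j. infsum (f j) UNIV) = (\<Sum>\<^sub>\<infinity>n. infsum (\<lambda>j. f j n) UNIV)"
    by (rule infsum_swap_banach) (use abs_summable_summable[OF P] in \<open>simp add: case_prod_unfold\<close>)
  then have "(\<Sum>j. \<Sum>n. f j n) = (\<Sum>n. \<Sum>j. f j n)"
    unfolding i1 i2 using n1 n2 by (simp add: inf_eq)
  then show "(\<lambda>n. \<Sum>j. f j n) sums (\<Sum>j. \<Sum>n. f j n)"
    using summable_sums[OF summable_norm_cancel[OF n2]] by simp
  show "summable (\<lambda>j. \<Sum>n. f j n)" using summable_norm_cancel[OF n1] .
qed

text \<open>
  The value of a series with coefficients \<open>c\<close> at \<open>s\<close>, and that of its restriction to smooth integers, are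
  both \<open>deval c h\<close> for a completely multiplicative \<open>h\<close>; an identity of coefficients that holds for
  all such \<open>h\<close> covers the two cases at once.
\<close>

definition mulchar :: "real \<Rightarrow> (nat \<Rightarrow> complex) \<Rightarrow> bool" where
  "mulchar \<sigma> h \<longleftrightarrow> h 1 = 1 \<and> (\<forall>m n. h (m * n) = h m * h n) \<and> (\<forall>n. cmod (h n) \<le> real n powr (-\<sigma>))"

definition deval :: "(nat \<Rightarrow> complex) \<Rightarrow> (nat \<Rightarrow> complex) \<Rightarrow> complex" where
  "deval c h = (\<Sum>n. c n * h n)"

text \<open>A bound for the weighted l1 norm at abscissa \<sigma>. These series form a Banach
  algebra, and \<open>B\<close> is carried along because products multiply it and exponentials
  exponentiate it.\<close>

definition abs_bound :: "real \<Rightarrow> (nat \<Rightarrow> complex) \<Rightarrow> real \<Rightarrow> bool" where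
  "abs_bound \<sigma> c B \<longleftrightarrow> summable (\<lambda>n. cmod (c n) * real n powr (-\<sigma>)) \<and>
     (\<Sum>n. cmod (c n) * real n powr (-\<sigma>)) \<le> B"

lemma mulchar_0: "mulchar \<sigma> h \<Longrightarrow> h 0 = 0"
  unfolding mulchar_def by (metis norm_le_zero_iff of_nat_0 powr_0)

lemma mulchar_power: "mulchar \<sigma> h \<Longrightarrow> h (n ^ k) = h n ^ k"
  by (induction k) (auto simp: mulchar_def)

lemma abs_bound_nonneg: "abs_bound \<sigma> c B \<Longrightarrow> 0 \<le> B"
  unfolding abs_bound_def by (meson mult_nonneg_nonneg norm_ge_zero order_trans powr_ge_zero suminf_nonneg)

lemma abs_bound_summable_norm:
  assumes "abs_bound \<sigma> c B" "mulchar \<sigma> h"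
  shows "summable (\<lambda>n. norm (c n * h n))"
  by (rule summable_comparison_test'[of "\<lambda>n. cmod (c n) * real n powr (-\<sigma>)" 0])
     (use assms in \<open>auto simp: abs_bound_def mulchar_def norm_mult intro!: mult_left_mono\<close>)

lemma abs_bound_norm_suminf_le:
  assumes "abs_bound \<sigma> c B" "mulchar \<sigma> h"
  shows "(\<Sum>n. norm (c n * h n)) \<le> B"
proof -
  have "(\<Sum>n. norm (c n * h n)) \<le> (\<Sum>n. cmod (c n) * real n powr (-\<sigma>))"
    by (rule suminf_le[OF _ abs_bound_summable_norm[OF assms]])
       (use assms in \<open>auto simp: abs_bound_def mulchar_def norm_mult intro!: mult_left_mono\<close>)
  then show ?thesis using assms by (auto simp: abs_bound_def)
qed

lemma abs_bound_sums:
  assumes "abs_bound \<sigma> c B" "mulchar \<sigma> h"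
  shows "(\<lambda>n. c n * h n) sums deval c h"
  unfolding deval_def using summable_norm_cancel[OF abs_bound_summable_norm[OF assms]] by (rule summable_sums)

lemma norm_deval_le:
  assumes "abs_bound \<sigma> c B" "mulchar \<sigma> h"
  shows "norm (deval c h) \<le> B"
  unfolding deval_def
  using summable_norm[OF abs_bound_summable_norm[OF assms]] abs_bound_norm_suminf_le[OF assms] by linarith

lemma abs_bound_cong:
  assumes "\<And>n. n \<ge> 1 \<Longrightarrow> c n = d n"
  shows "abs_bound \<sigma> c B = abs_bound \<sigma> d B"
proof -
  have "(\<lambda>n. cmod (c n) * real n powr (-\<sigma>)) = (\<lambda>n. cmod (d n) * real n powr (-\<sigma>))"
  proof
    fix n show "cmod (c n) * real n powr (-\<sigma>) = cmod (d n) * real n powr (-\<sigma>)"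
      using assms[of n] by (cases n) auto
  qed
  then show ?thesis unfolding abs_bound_def by simp
qed

lemma deval_cong:
  assumes "\<And>n. n \<ge> 1 \<Longrightarrow> c n = d n" "mulchar \<sigma> h"
  shows "deval c h = deval d h"
proof -
  have "(\<lambda>n. c n * h n) = (\<lambda>n. d n * h n)"
  proof
    fix n show "c n * h n = d n * h n"
      using assms(1)[of n] mulchar_0[OF assms(2)] by (cases n) auto
  qed
  then show ?thesis unfolding deval_def by simp
qed

lemma abs_bound_scale:
  assumes "abs_bound \<sigma> c B"
  shows "abs_bound \<sigma> (\<lambda>n. z * c n) (cmod z * B)"
  using assms unfolding abs_bound_def
  by (auto simp: norm_mult mult.assoc suminf_mult intro!: mult_left_mono summable_mult)

lemma deval_scale:
  assumes "abs_bound \<sigma> c B" "mulchar \<sigma> h"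
  shows "deval (\<lambda>n. z * c n) h = z * deval c h"
  using sums_mult[OF abs_bound_sums[OF assms], of z]
  by (simp add: deval_def mult.assoc sums_iff)

text \<open>Absolute convergence allows the sums over \<open>j\<close> and \<open>n\<close> to be
  interchanged. This one fact yields products (a sum of shifts), exponentials (a power series) and
  compositions (a sum over the terms of the outer series).\<close>

lemma abs_bound_suminf:
  assumes c: "\<And>j. abs_bound \<sigma> (c j) (B j)" and B: "summable B"
  shows "abs_bound \<sigma> (\<lambda>n. \<Sum>j. c j n) (suminf B)"
    and "mulchar \<sigma> h \<Longrightarrow> (\<lambda>j. deval (c j) h) sums deval (\<lambda>n. \<Sum>j. c j n) h"
    and "n \<ge> 1 \<Longrightarrow> summable (\<lambda>j. norm (c j n))"
proof -
  define f where "f j n = c j n * of_real (real n powr (-\<sigma>))" for j n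
  have nf: "norm (f j n) = cmod (c j n) * real n powr (-\<sigma>)" for j n
    by (simp add: f_def norm_mult)
  have sm: "summable (\<lambda>n. norm (f j n))" and le: "(\<Sum>n. norm (f j n)) \<le> B j" for j
    using c[of j] unfolding nf abs_bound_def by auto
  note D = double_series[OF sm le B]
  show sj: "summable (\<lambda>j. norm (c j n))" if "n \<ge> 1" for n
    using summable_mult2[OF D(1)[of n], of "real n powr \<sigma>"] that
    by (simp add: nf mult.assoc powr_add[symmetric])
  have le': "cmod (\<Sum>j. c j n) * real n powr (-\<sigma>) \<le> (\<Sum>j. norm (f j n))" for n
  proof (cases "n = 0")
    case False
    then have "cmod (\<Sum>j. c j n) * real n powr (-\<sigma>) \<le> (\<Sum>j. cmod (c j n)) * real n powr (-\<sigma>)"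
      by (intro mult_right_mono summable_norm sj) auto
    also have "\<dots> = (\<Sum>j. norm (f j n))"
      unfolding nf using False sj[of n] by (simp add: suminf_mult2)
    finally show ?thesis .
  qed (simp add: nf)
  have s: "summable (\<lambda>n. cmod (\<Sum>j. c j n) * real n powr (-\<sigma>))"
    by (rule summable_comparison_test'[OF D(2), of 0]) (use le' in auto)
  have "(\<Sum>n. cmod (\<Sum>j. c j n) * real n powr (-\<sigma>)) \<le> suminf B"
    using suminf_le[OF le' s D(2)] D(3) by linarith
  then show "abs_bound \<sigma> (\<lambda>n. \<Sum>j. c j n) (suminf B)"
    using s by (simp add: abs_bound_def)
  show "(\<lambda>j. deval (c j) h) sums deval (\<lambda>n. \<Sum>j. c j n) h" if h: "mulchar \<sigma> h"
  proof -
    note E = double_series[OF abs_bound_summable_norm[OF c h] abs_bound_norm_suminf_le[OF c h] B]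
    have "(\<Sum>j. c j n * h n) = (\<Sum>j. c j n) * h n" for n
    proof (cases "n = 0")
      case False
      then show ?thesis using suminf_mult2[OF summable_norm_cancel[OF sj[of n]], of "h n"] by simp
    qed (simp add: mulchar_0[OF h])
    then have "deval (\<lambda>n. \<Sum>j. c j n) h = (\<Sum>j. deval (c j) h)"
      using E(5) by (simp add: deval_def sums_iff)
    then show ?thesis using E(4) by (simp add: deval_def summable_sums)
  qed
qed

text \<open>The coefficients of \<open>m powr -s\<close> times the series \<open>d\<close>. For
  \<open>m = 0\<close> this is the zero series, in accordance with \<open>h 0 = 0\<close>.\<close>

definition shift_coeff :: "nat \<Rightarrow> (nat \<Rightarrow> complex) \<Rightarrow> nat \<Rightarrow> complex" where
  "shift_coeff m d k = (if m \<ge> 1 \<and> m dvd k then d (k div m) else 0)"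

lemma shift_sums:
  fixes F G :: "nat \<Rightarrow> 'a::{t2_space,comm_monoid_add}"
  assumes "m \<ge> 1" "\<And>n. G (m * n) = F n" "\<And>k. \<not> m dvd k \<Longrightarrow> G k = 0" "F sums S"
  shows "G sums S"
proof -
  have "strict_mono (\<lambda>n. m * n)" using assms(1) by (auto simp: strict_mono_def)
  moreover have "G k = 0" if "k \<notin> range (\<lambda>n. m * n)" for k
    using assms(3) that by (auto simp: dvd_def)
  ultimately show ?thesis
    using sums_mono_reindex[of "\<lambda>n. m * n" G S] assms(2,4) by simp
qed

lemma abs_bound_shift:
  assumes "abs_bound \<sigma> d B"
  shows "abs_bound \<sigma> (shift_coeff m d) (real m powr (-\<sigma>) * B)"
proof (cases "m = 0")
  case True
  then have "shift_coeff m d = (\<lambda>_. 0)" by (auto simp: shift_coeff_def)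
  then show ?thesis using True by (simp add: abs_bound_def)
next
  case False
  have "(\<lambda>n. cmod (d n) * real n powr (-\<sigma>)) sums (\<Sum>n. cmod (d n) * real n powr (-\<sigma>))"
    using assms by (auto simp: abs_bound_def)
  from sums_mult[OF this, of "real m powr (-\<sigma>)"]
  have "(\<lambda>k. cmod (shift_coeff m d k) * real k powr (-\<sigma>)) sums
     (real m powr (-\<sigma>) * (\<Sum>n. cmod (d n) * real n powr (-\<sigma>)))"
    by (rule shift_sums[of m, rotated -1]) (use False in \<open>auto simp: shift_coeff_def powr_mult\<close>)
  then show ?thesis using assms
    unfolding abs_bound_def by (auto simp: sums_iff intro!: mult_left_mono)
qed

lemma deval_shift:
  assumes d: "abs_bound \<sigma> d B" and h: "mulchar \<sigma> h"
  shows "deval (shift_coeff m d) h = h m * deval d h"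
proof (cases "m = 0")
  case True
  then have "shift_coeff m d = (\<lambda>_. 0)" by (auto simp: shift_coeff_def)
  then show ?thesis using True mulchar_0[OF h] by (simp add: deval_def)
next
  case False
  have "(\<lambda>k. shift_coeff m d k * h k) sums (h m * deval d h)"
    by (rule shift_sums[of m, rotated -1, OF sums_mult[OF abs_bound_sums[OF d h], of "h m"]])
       (use False h in \<open>auto simp: shift_coeff_def mulchar_def\<close>)
  then show ?thesis by (simp add: deval_def sums_iff)
qed

text \<open>Dirichlet convolution, built as the sum over \<open>m\<close> of \<open>c m\<close>
  times the shift of \<open>d\<close> by \<open>m\<close>; the norm is submultiplicative because the
  weight \<open>n powr -\<sigma>\<close> is multiplicative.\<close>

lemma deval_mult_ex:
  assumes c: "abs_bound \<sigma> c B" and d: "abs_bound \<sigma> d B'"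
  shows "\<exists>e. abs_bound \<sigma> e (B * B') \<and> (\<forall>h. mulchar \<sigma> h \<longrightarrow> deval e h = deval c h * deval d h)"
proof -
  define C where "C m n = c m * shift_coeff m d n" for m n
  have C: "abs_bound \<sigma> (C m) (cmod (c m) * (real m powr (-\<sigma>) * B'))" for m
    unfolding C_def by (rule abs_bound_scale[OF abs_bound_shift[OF d]])
  have s: "summable (\<lambda>m. cmod (c m) * (real m powr (-\<sigma>) * B'))"
    using c by (auto simp: abs_bound_def mult.assoc[symmetric] intro: summable_mult2)
  have "(\<Sum>m. cmod (c m) * (real m powr (-\<sigma>) * B')) \<le> B * B'"
    using c abs_bound_nonneg[OF d] unfolding mult.assoc[symmetric] abs_bound_def
    by (subst suminf_mult2[symmetric]) (auto intro: mult_right_mono)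
  then have 1: "abs_bound \<sigma> (\<lambda>n. \<Sum>m. C m n) (B * B')"
    using abs_bound_suminf(1)[OF C s] by (auto simp: abs_bound_def)
  have "deval (\<lambda>n. \<Sum>m. C m n) h = deval c h * deval d h" if h: "mulchar \<sigma> h" for h
  proof -
    have "deval (C m) h = c m * h m * deval d h" for m
      unfolding C_def using deval_scale[OF abs_bound_shift[OF d] h] deval_shift[OF d h] by simp
    then have "(\<lambda>m. c m * h m * deval d h) sums deval (\<lambda>n. \<Sum>m. C m n) h"
      using abs_bound_suminf(2)[OF C s h] by simp
    moreover have "(\<lambda>m. c m * h m * deval d h) sums (deval c h * deval d h)"
      by (rule sums_mult2[OF abs_bound_sums[OF c h]])
    ultimately show ?thesis by (rule sums_unique2)
  qed
  with 1 show ?thesis by blast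
qed

lemma deval_power_ex:
  assumes c: "abs_bound \<sigma> c B"
  shows "\<exists>e. abs_bound \<sigma> e (B ^ j) \<and> (\<forall>h. mulchar \<sigma> h \<longrightarrow> deval e h = deval c h ^ j)"
proof (induction j)
  case 0
  have "(\<lambda>n. cmod (if n = 1 then 1 else 0) * real n powr (-\<sigma>)) sums 1"
    using sums_single[of 1 "\<lambda>_. 1::real"] by (rule back_subst[of "\<lambda>f. f sums 1"]) auto
  moreover have "deval (\<lambda>n. if n = 1 then 1 else 0) h = 1" if "mulchar \<sigma> h" for h
  proof -
    have "(\<lambda>n. (if n = 1 then 1 else 0) * h n) sums 1"
      using sums_single[of 1 "\<lambda>_. 1::complex"]
      by (rule back_subst[of "\<lambda>f. f sums 1"]) (use that in \<open>auto simp: mulchar_def\<close>)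
    then show ?thesis by (simp add: deval_def sums_iff)
  qed
  ultimately show ?case
    by (intro exI[of _ "\<lambda>n. if n = 1 then 1 else 0"]) (auto simp: abs_bound_def sums_iff)
next
  case (Suc j)
  then obtain e where e: "abs_bound \<sigma> e (B ^ j)" "\<forall>h. mulchar \<sigma> h \<longrightarrow> deval e h = deval c h ^ j"
    by blast
  then show ?case using deval_mult_ex[OF c e(1)] by auto
qed

text \<open>The exponential series in the Banach algebra, with \<open>B ^ j\<close> as bound for the
  \<open>j\<close>-th power.\<close>

lemma deval_exp_ex:
  assumes c: "abs_bound \<sigma> c B"
  shows "\<exists>e. abs_bound \<sigma> e (exp (cmod z * B)) \<and> (\<forall>h. mulchar \<sigma> h \<longrightarrow> deval e h = exp (z * deval c h))"
proof -
  obtain e where e: "\<And>j. abs_bound \<sigma> (e j) (B ^ j)"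
    and eh: "\<And>j h. mulchar \<sigma> h \<Longrightarrow> deval (e j) h = deval c h ^ j"
    using deval_power_ex[OF c] by metis
  define C where "C j n = (z ^ j / fact j) * e j n" for j n
  have C: "abs_bound \<sigma> (C j) (cmod (z ^ j / fact j) * B ^ j)" for j
    unfolding C_def by (rule abs_bound_scale[OF e])
  have "(\<lambda>j. cmod (z ^ j / fact j) * B ^ j) sums exp (cmod z * B)"
    using exp_converges[of "cmod z * B"]
    by (simp add: norm_divide norm_power power_mult_distrib field_simps)
  then have s: "summable (\<lambda>j. cmod (z ^ j / fact j) * B ^ j)"
    and S: "(\<Sum>j. cmod (z ^ j / fact j) * B ^ j) = exp (cmod z * B)" by (auto simp: sums_iff)
  have "deval (\<lambda>n. \<Sum>j. C j n) h = exp (z * deval c h)" if h: "mulchar \<sigma> h" for h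
  proof -
    have "deval (C j) h = (z * deval c h) ^ j /\<^sub>R fact j" for j
      unfolding C_def deval_scale[OF e h] eh[OF h]
      by (simp add: power_mult_distrib scaleR_conv_of_real field_simps)
    then show ?thesis using abs_bound_suminf(2)[OF C s h] exp_converges[of "z * deval c h"]
      by (simp add: sums_unique2)
  qed
  then show ?thesis using abs_bound_suminf(1)[OF C s] unfolding S by blast
qed

text \<open>For \<open>n powr -\<phi>\<close> with \<phi> the sum of \<open>c0 * s\<close>,
  \<open>b1\<close> and a tail: the first part is a shift by \<open>n ^ c0\<close>, the second a
  scalar, the third the exponential of a small series. The three contributions add up in the
  exponent of the bound.\<close>

lemma deval_symbol_power_ex:
  assumes b: "abs_bound \<sigma> b \<eta>" and n: "n \<ge> 1"
  shows "\<exists>d. d 0 = 0 \<and> abs_bound \<sigma> d (real n powr (\<eta> - Re b1 - real c0 * \<sigma>)) \<and>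
    (\<forall>h. mulchar \<sigma> h \<longrightarrow> deval d h = h n ^ c0 * exp (- of_real (ln (real n)) * (b1 + deval b h)))"
proof -
  obtain e where e: "abs_bound \<sigma> e (exp (cmod (- of_real (ln (real n))) * \<eta>))"
    and eh: "\<And>h. mulchar \<sigma> h \<Longrightarrow> deval e h = exp (- of_real (ln (real n)) * deval b h)"
    using deval_exp_ex[OF b] by blast
  define w where "w = exp (- of_real (ln (real n)) * b1)"
  define d where "d k = w * shift_coeff (n ^ c0) e k" for k
  have cw: "cmod w = real n powr (- Re b1)" using n by (simp add: w_def powr_def)
  have p: "real (n ^ c0) powr (-\<sigma>) = real n powr (- real c0 * \<sigma>)"
    using n by (simp add: powr_realpow[symmetric] powr_powr)
  have en: "exp (cmod (- of_real (ln (real n))) * \<eta>) = real n powr \<eta>"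
    using n by (simp add: powr_def)
  have "abs_bound \<sigma> d (cmod w * (real (n ^ c0) powr (-\<sigma>) * exp (cmod (- of_real (ln (real n))) * \<eta>)))"
    unfolding d_def by (rule abs_bound_scale[OF abs_bound_shift[OF e]])
  then have d: "abs_bound \<sigma> d (real n powr (\<eta> - Re b1 - real c0 * \<sigma>))"
    unfolding cw p en by (simp add: powr_add[symmetric] algebra_simps)
  have dh: "deval d h = h n ^ c0 * exp (- of_real (ln (real n)) * (b1 + deval b h))" if h: "mulchar \<sigma> h" for h
    unfolding d_def deval_scale[OF abs_bound_shift[OF e] h] deval_shift[OF e h] eh[OF h]
    by (simp add: mulchar_power[OF h] w_def exp_add exp_diff exp_minus divide_inverse algebra_simps)
  \<comment> \<open>No value \<open>deval d h\<close> sees the index 0, but the spaces of series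
    require the coefficient there to vanish.\<close>
  define d' where "d' = d(0 := 0)"
  have d'_0: "d' 0 = 0" by (simp add: d'_def)
  have c: "d' k = d k" if "k \<ge> 1" for k using that by (simp add: d'_def)
  show ?thesis
    using d dh abs_bound_cong[of d' d \<sigma>, OF c] deval_cong[of d' d \<sigma>, OF c]
    by (intro exI[of _ d']) (auto simp: d'_def[symmetric] d'_0)
qed

section \<open>Means on vertical lines\<close>

lemma of_nat_powr_exp: "n \<ge> 1 \<Longrightarrow> (of_nat n :: complex) powr s = exp (s * of_real (ln (real n)))"
  by (simp add: powr_def Ln_of_nat)

lemma norm_of_nat_powr: "cmod (of_nat n powr s) = real n powr Re s"
  using norm_powr_real_powr[of "of_nat n" s] by (cases "n = 0") auto

lemma open_half_plane: "open (half_plane \<sigma>)"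
  unfolding half_plane_def by (rule open_halfspace_Re_gt)

lemma convex_half_plane: "convex (half_plane \<sigma>)"
  unfolding half_plane_def by (rule convex_halfspace_Re_gt)

lemma mem_half_plane [simp]: "s \<in> half_plane \<sigma> \<longleftrightarrow> Re s > \<sigma>"
  by (simp add: half_plane_def)

lemma continuous_on_vertical:
  assumes "F holomorphic_on half_plane \<rho>" "\<rho> < \<epsilon>"
  shows "continuous_on UNIV (\<lambda>t. F (Complex \<epsilon> t))"
proof (rule continuous_on_compose2[OF holomorphic_on_imp_continuous_on[OF assms(1)]])
  show "continuous_on UNIV (Complex \<epsilon>)"
    by (subst Complex_eq[abs_def]) (intro continuous_intros)
qed (use assms(2) in auto)

text \<open>The mean value of almost periodic functions. Continuity is built in so that the
  integrals exist and may be added.\<close>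

definition has_mean :: "(real \<Rightarrow> complex) \<Rightarrow> complex \<Rightarrow> bool" where
  "has_mean f L \<longleftrightarrow> continuous_on UNIV f \<and>
     ((\<lambda>T. integral {-T..T} f / of_real (2 * T)) \<longlongrightarrow> L) at_top"

lemma has_mean_integrable: "has_mean f L \<Longrightarrow> f integrable_on {a..b}"
  unfolding has_mean_def by (meson continuous_on_subset integrable_continuous_real subset_UNIV)

lemma has_mean_add:
  assumes "has_mean f L" "has_mean g M"
  shows "has_mean (\<lambda>t. f t + g t) (L + M)"
proof -
  have "integral {-T..T} (\<lambda>t. f t + g t) = integral {-T..T} f + integral {-T..T} g" for T
    by (intro integral_add has_mean_integrable) (use assms in auto)
  then show ?thesis using assms
    by (auto simp: has_mean_def add_divide_distrib intro!: tendsto_add continuous_on_add)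
qed

lemma has_mean_cmult: "has_mean f L \<Longrightarrow> has_mean (\<lambda>t. c * f t) (c * L)"
  unfolding has_mean_def
  by (auto intro!: continuous_intros tendsto_mult simp: times_divide_eq_right[symmetric]
           simp del: times_divide_eq_right)

lemma has_mean_0: "has_mean (\<lambda>t. 0) 0"
  by (simp add: has_mean_def)

lemma has_mean_sum:
  assumes "\<And>i. i \<in> A \<Longrightarrow> has_mean (f i) (L i)"
  shows "has_mean (\<lambda>t. \<Sum>i\<in>A. f i t) (\<Sum>i\<in>A. L i)"
  using assms by (induction A rule: infinite_finite_induct) (auto intro: has_mean_0 has_mean_add)

lemma has_mean_cis: "has_mean (\<lambda>t. cis (a * t)) (if a = 0 then 1 else 0)"
proof (cases "a = 0")
  case True
  have "eventually (\<lambda>T. integral {-T..T} (\<lambda>t. 1) / of_real (2 * T) = (1::complex)) at_top"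
    using eventually_gt_at_top[of "0::real"] by eventually_elim (auto simp: field_simps scaleR_conv_of_real)
  then show ?thesis using True unfolding has_mean_def
    by (auto intro: tendsto_eventually)
next
  case False
  have I: "integral {-T..T} (\<lambda>t. cis (a * t)) = (cis (a * T) - cis (a * (-T))) / (\<i> * a)" if "T \<ge> 0" for T
  proof (rule integral_unique)
    have "((\<lambda>t. cis (a * t)) has_integral cis (a * T) / (\<i> * a) - cis (a * (-T)) / (\<i> * a)) {-T..T}"
    proof (rule fundamental_theorem_of_calculus)
      show "((\<lambda>t. cis (a * t) / (\<i> * a)) has_vector_derivative cis (a * t)) (at t within {-T..T})" for t
        using False unfolding cis_conv_exp
        by (auto intro!: derivative_eq_intros has_vector_derivative_real_field simp: field_simps)
    qed (use that in auto)
    then show "((\<lambda>t. cis (a * t)) has_integral (cis (a * T) - cis (a * (-T))) / (\<i> * a)) {-T..T}"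
      by (simp add: diff_divide_distrib)
  qed
  have "((\<lambda>T. integral {-T..T} (\<lambda>t. cis (a * t)) / of_real (2 * T)) \<longlongrightarrow> 0) at_top"
  proof (rule Lim_null_comparison)
    show "\<forall>\<^sub>F T in at_top. norm (integral {-T..T} (\<lambda>t. cis (a * t)) / of_real (2 * T)) \<le> 1 / (\<bar>a\<bar> * T)"
      using eventually_gt_at_top[of "0::real"]
    proof eventually_elim
      case (elim T)
      have "norm (cis (a * T) - cis (a * (-T))) \<le> 2"
        using norm_triangle_ineq4[of "cis (a * T)" "cis (a * (-T))"] by simp
      then show ?case unfolding I[OF less_imp_le[OF elim]] using elim False
        by (simp add: norm_divide norm_mult divide_simps mult.commute)
    qed
    show "((\<lambda>T. 1 / (\<bar>a\<bar> * T)) \<longlongrightarrow> 0) at_top"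
      using False by (auto intro!: tendsto_divide_0[OF tendsto_const] filterlim_at_top_imp_at_infinity
        filterlim_tendsto_pos_mult_at_top[OF tendsto_const] filterlim_ident)
  qed
  then show ?thesis using False unfolding has_mean_def by (auto intro!: continuous_intros simp: cis_conv_exp)
qed

text \<open>By Cauchy's theorem on the rectangle between the two abscissae: a primitive replaces the
  contour integral, and the horizontal sides contribute \<open>O(1)\<close> because \<open>F\<close> is bounded.\<close>

lemma has_mean_vertical:
  assumes F: "F holomorphic_on half_plane \<rho>" and \<rho>: "\<rho> < \<epsilon>"
    and bd: "\<And>s. Re s \<ge> \<epsilon> \<Longrightarrow> cmod (F s) \<le> B"
    and lim: "\<And>e. e > 0 \<Longrightarrow> \<exists>\<sigma>\<ge>\<epsilon>. \<forall>t. cmod (F (Complex \<sigma> t) - L) \<le> e"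
  shows "has_mean (\<lambda>t. F (Complex \<epsilon> t)) L"
proof -
  have C: "Complex \<sigma> t = of_real \<sigma> + \<i> * of_real t" for \<sigma> t by (simp add: complex_eq_iff)
  note cont = continuous_on_vertical[OF F]
  obtain G where G: "\<And>s. s \<in> half_plane \<rho> \<Longrightarrow> (G has_field_derivative F s) (at s)"
    using holomorphic_convex_primitive'[OF convex_half_plane open_half_plane F]
    by (metis at_within_open open_half_plane)
  have I: "integral {-T..T} (\<lambda>t. F (Complex \<sigma> t)) = (G (Complex \<sigma> T) - G (Complex \<sigma> (-T))) / \<i>"
    if "\<sigma> > \<rho>" "T \<ge> 0" for \<sigma> T
  proof (rule integral_unique)
    have "((\<lambda>t. F (Complex \<sigma> t)) has_integral (G (Complex \<sigma> T) / \<i> - G (Complex \<sigma> (-T)) / \<i>)) {-T..T}"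
    proof (rule fundamental_theorem_of_calculus)
      fix t
      have "((\<lambda>z. G (of_real \<sigma> + \<i> * z) / \<i>) has_field_derivative F (Complex \<sigma> t)) (at (of_real t))"
        by (rule derivative_eq_intros DERIV_chain2[OF G] | (use that in \<open>simp add: C\<close>; fail))+
           (simp_all add: C mult.assoc)
      then show "((\<lambda>t. G (Complex \<sigma> t) / \<i>) has_vector_derivative F (Complex \<sigma> t)) (at t within {-T..T})"
        unfolding C by (intro has_vector_derivative_real_field) (auto intro: has_field_derivative_at_within)
    qed (use that in auto)
    then show "((\<lambda>t. F (Complex \<sigma> t)) has_integral (G (Complex \<sigma> T) - G (Complex \<sigma> (-T))) / \<i>) {-T..T}"
      by (subst diff_divide_distrib)
  qed
  have horiz: "cmod (G (Complex \<sigma> t) - G (Complex \<epsilon> t)) \<le> B * (\<sigma> - \<epsilon>)" if "\<sigma> \<ge> \<epsilon>" for \<sigma> t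
  proof -
    have "cmod (G (Complex \<sigma> t) - G (Complex \<epsilon> t)) \<le> B * cmod (Complex \<sigma> t - Complex \<epsilon> t)"
    proof (rule field_differentiable_bound)
      show "convex {s. Re s \<ge> \<epsilon>}" by (rule convex_halfspace_Re_ge)
    qed (use that \<rho> G bd in \<open>auto intro: has_field_derivative_at_within\<close>)
    also have "cmod (Complex \<sigma> t - Complex \<epsilon> t) = \<sigma> - \<epsilon>"
      using that by (simp add: cmod_def)
    finally show ?thesis .
  qed
  have "((\<lambda>T. integral {-T..T} (\<lambda>t. F (Complex \<epsilon> t)) / of_real (2 * T)) \<longlongrightarrow> L) at_top"
  proof (rule tendstoI)
    fix e :: real assume e: "e > 0"
    then obtain \<sigma> where \<sigma>: "\<sigma> \<ge> \<epsilon>" and s: "\<And>t. cmod (F (Complex \<sigma> t) - L) \<le> e / 2"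
      using lim[of "e / 2"] by auto
    have "\<forall>\<^sub>F T in at_top. T > max 0 (2 * (B * (\<sigma> - \<epsilon>)) / e)" by (rule eventually_gt_at_top)
    then show "\<forall>\<^sub>F T in at_top. dist (integral {-T..T} (\<lambda>t. F (Complex \<epsilon> t)) / of_real (2 * T)) L < e"
    proof eventually_elim
      case (elim T)
      then have T: "T > 0" and T2: "2 * (B * (\<sigma> - \<epsilon>)) / e < T" by auto
      let ?I = "\<lambda>\<sigma>. integral {-T..T} (\<lambda>t. F (Complex \<sigma> t))"
      have "?I \<sigma> - ?I \<epsilon> = ((G (Complex \<sigma> T) - G (Complex \<epsilon> T)) - (G (Complex \<sigma> (-T)) - G (Complex \<epsilon> (-T)))) / \<i>"
        by (subst (1 2) I) (use T \<sigma> \<rho> in \<open>auto simp: algebra_simps\<close>)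
      also have "cmod \<dots> \<le> B * (\<sigma> - \<epsilon>) + B * (\<sigma> - \<epsilon>)"
        unfolding norm_divide using norm_triangle_ineq4 horiz[OF \<sigma>] add_mono
        by (smt (verit) div_by_1 norm_ii)
      finally have d1: "cmod (?I \<sigma> - ?I \<epsilon>) \<le> 2 * (B * (\<sigma> - \<epsilon>))" by simp
      have int: "(\<lambda>t. F (Complex \<sigma> t)) integrable_on {-T..T}"
        using cont[of \<sigma>] \<sigma> \<rho> by (meson continuous_on_subset integrable_continuous_real less_le_trans subset_UNIV)
      have "((\<lambda>t. F (Complex \<sigma> t) - L) has_integral (?I \<sigma> - of_real (2 * T) * L)) {-T..T}"
        using has_integral_diff[OF integrable_integral[OF int] has_integral_const_real[of L "-T" T]] T
        by (simp add: scaleR_conv_of_real)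
      from has_integral_bound_real[OF _ finite.emptyI this, of "e / 2"] s e T
      have d2: "cmod (?I \<sigma> - of_real (2 * T) * L) \<le> e / 2 * (2 * T)" by simp
      have "dist (?I \<epsilon> / of_real (2 * T)) L = cmod ((?I \<sigma> - of_real (2 * T) * L) - (?I \<sigma> - ?I \<epsilon>)) / (2 * T)"
      proof -
        have "?I \<epsilon> / of_real (2 * T) - L = (?I \<epsilon> - of_real (2 * T) * L) / of_real (2 * T)"
          using T by (simp add: diff_divide_distrib)
        then have "dist (?I \<epsilon> / of_real (2 * T)) L = cmod (?I \<epsilon> - of_real (2 * T) * L) / cmod (of_real (2 * T))"
          by (simp only: dist_norm norm_divide)
        then show ?thesis using T by (simp add: norm_of_real)
      qed
      also have "\<dots> \<le> (e / 2 * (2 * T) + 2 * (B * (\<sigma> - \<epsilon>))) / (2 * T)"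
        using d1 d2 norm_triangle_ineq4[of "?I \<sigma> - of_real (2 * T) * L" "?I \<sigma> - ?I \<epsilon>"] T
        by (intro divide_right_mono) auto
      also have "\<dots> < e"
        using T T2 e by (simp add: field_simps)
      finally show ?case .
    qed
  qed
  then show ?thesis using cont[OF \<rho>] by (simp add: has_mean_def)
qed

section \<open>Dirichlet polynomials and Bessel's inequality\<close>

definition dpoly :: "(nat \<Rightarrow> complex) \<Rightarrow> nat \<Rightarrow> complex \<Rightarrow> complex" where
  "dpoly c N s = (\<Sum>n\<le>N. dirichlet_term c s n)"

lemma dirichlet_term_0 [simp]: "dirichlet_term c s 0 = 0"
  by (simp add: dirichlet_term_def)

lemma norm_dirichlet_term: "cmod (dirichlet_term c s n) = cmod (c n) * real n powr (- Re s)"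
  by (simp add: dirichlet_term_def norm_mult norm_of_nat_powr)

lemma holomorphic_dirichlet_term: "(\<lambda>s. dirichlet_term c s n) holomorphic_on A"
proof (cases "n = 0")
  case False
  then have "(\<lambda>s. c n * exp (- s * of_real (ln (real n)))) holomorphic_on A"
    by (intro holomorphic_intros)
  then show ?thesis using False by (simp add: dirichlet_term_def of_nat_powr_exp)
qed simp

lemma holomorphic_dpoly: "dpoly c N holomorphic_on A"
  unfolding dpoly_def by (intro holomorphic_on_sum holomorphic_dirichlet_term)

text \<open>Parseval's identity: distinct \<open>n\<close> have distinct frequencies
  \<open>ln n\<close>, so every off-diagonal product has mean zero.\<close>

lemma has_mean_dpoly_square:
  "has_mean (\<lambda>t. dpoly c N (Complex \<epsilon> t) * cnj (dpoly c N (Complex \<epsilon> t)))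
     (of_real (\<Sum>n\<le>N. (cmod (c n))\<^sup>2 * real n powr (-2 * \<epsilon>)))"
proof -
  let ?A = "\<lambda>m n. if m = n then of_real ((cmod (c n))\<^sup>2 * real n powr (-2 * \<epsilon>)) else 0"
  have "has_mean (\<lambda>t. dirichlet_term c (Complex \<epsilon> t) m * cnj (dirichlet_term c (Complex \<epsilon> t) n)) (?A m n)"
    for m n
  proof (cases "m = 0 \<or> n = 0")
    case False
    then have mn: "m \<ge> 1" "n \<ge> 1" by auto
    have e: "dirichlet_term c (Complex \<epsilon> t) m * cnj (dirichlet_term c (Complex \<epsilon> t) n) =
       (c m * cnj (c n) * of_real (real m powr (-\<epsilon>) * real n powr (-\<epsilon>))) * cis ((ln (real n) - ln (real m)) * t)" for t
    proof -
      have 1: "of_nat k powr - Complex \<epsilon> t = of_real (real k powr (-\<epsilon>)) * cis (- ln (real k) * t)" if "k \<ge> 1" for k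
        unfolding of_nat_powr_exp[OF that] exp_eq_polar using that by (simp add: powr_def mult.commute)
      show ?thesis unfolding dirichlet_term_def 1[OF mn(1)] 1[OF mn(2)]
        by (simp add: cis_cnj cis_mult algebra_simps)
    qed
    have "(if m = n then 1 else 0) * (c m * cnj (c n) * of_real (real m powr (-\<epsilon>) * real n powr (-\<epsilon>))) = ?A m n"
      by (auto simp: complex_norm_square[symmetric] powr_add[symmetric] simp flip: of_real_mult of_real_power)
    then show ?thesis
      using has_mean_cmult[OF has_mean_cis[of "ln (real n) - ln (real m)"],
        of "c m * cnj (c n) * of_real (real m powr (-\<epsilon>) * real n powr (-\<epsilon>))"] mn
      unfolding e by (auto simp: mult.commute split: if_splits)
  qed (use has_mean_0 in auto)
  then have "has_mean (\<lambda>t. \<Sum>m\<le>N. \<Sum>n\<le>N. dirichlet_term c (Complex \<epsilon> t) m * cnj (dirichlet_term c (Complex \<epsilon> t) n))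
      (\<Sum>m\<le>N. \<Sum>n\<le>N. ?A m n)"
    by (intro has_mean_sum)
  moreover have "(\<Sum>m\<le>N. \<Sum>n\<le>N. ?A m n) = of_real (\<Sum>n\<le>N. (cmod (c n))\<^sup>2 * real n powr (-2 * \<epsilon>))"
    by (simp add: sum.delta)
  ultimately show ?thesis
    by (simp add: dpoly_def sum_product)
qed

text \<open>The remainder \<open>F - dpoly c N\<close> decays like \<open>(N + 1) powr -\<sigma>\<close>, so that its product with
  \<open>n powr s\<close>, \<open>n \<le> N\<close>, has mean zero on every vertical line: it is orthogonal to \<open>dpoly c N\<close>.\<close>

lemma has_mean_remainder:
  assumes F: "F holomorphic_on half_plane \<rho>" and \<rho>: "\<rho> < \<epsilon>"
    and bd: "\<And>s. Re s \<ge> \<epsilon> \<Longrightarrow> cmod (F s) \<le> B"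
    and c: "summable (\<lambda>n. cmod (c n) * real n powr (-\<sigma>))"
    and rep: "\<And>s. Re s > \<sigma> \<Longrightarrow> F s = dirichlet_sum c s"
    and n: "1 \<le> n" "n \<le> N"
  shows "has_mean (\<lambda>t. (F (Complex \<epsilon> t) - dpoly c N (Complex \<epsilon> t)) * of_nat n powr Complex \<epsilon> t) 0"
proof -
  define R where "R s = (F s - dpoly c N s) * of_nat n powr s" for s
  define K where "K = (\<Sum>m. cmod (c m) * real m powr (-\<sigma>))"
  \<comment> \<open>The remainder is of size \<open>(N + 1) powr -Re s\<close> and the factor of
    size \<open>n powr Re s\<close>; their product decays because \<open>n \<le> N\<close>.\<close>
  define q where "q = real n / real (Suc N)"
  have q: "0 < q" "q < 1" using n by (auto simp: q_def)
  have K0: "K \<ge> 0" unfolding K_def by (intro suminf_nonneg c) auto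
  have far: "cmod (R s) \<le> K * real n powr \<sigma> * q powr (Re s - \<sigma>)" if s: "Re s > \<sigma>" for s
  proof -
    define u where "u = Re s - \<sigma>"
    have u: "u \<ge> 0" using s by (simp add: u_def)
    have le: "cmod (dirichlet_term c s m) \<le> real (Suc N) powr (-u) * (cmod (c m) * real m powr (-\<sigma>))"
      if "m > N" for m
    proof -
      have "real m powr (- Re s) = real m powr (-u) * real m powr (-\<sigma>)"
        by (simp add: u_def powr_add[symmetric])
      also have "\<dots> \<le> real (Suc N) powr (-u) * real m powr (-\<sigma>)"
        using that u by (intro mult_right_mono powr_mono2') auto
      finally have "cmod (c m) * real m powr (- Re s) \<le> cmod (c m) * (real (Suc N) powr (-u) * real m powr (-\<sigma>))"
        by (rule mult_left_mono) simp
      then show ?thesis by (simp add: norm_dirichlet_term mult.left_commute)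
    qed
    have s1: "summable (\<lambda>m. cmod (dirichlet_term c s m))"
    proof (rule summable_comparison_test'[of _ "Suc N"])
      show "summable (\<lambda>m. real (Suc N) powr (-u) * (cmod (c m) * real m powr (-\<sigma>)))"
        by (rule summable_mult[OF c])
    qed (use le in auto)
    have "F s - dpoly c N s = (\<Sum>m. dirichlet_term c s (m + Suc N))"
      unfolding rep[OF s] dirichlet_sum_def dpoly_def
      using suminf_split_initial_segment[OF summable_norm_cancel[OF s1], of "Suc N"]
      by (simp add: lessThan_Suc_atMost)
    also have "cmod \<dots> \<le> (\<Sum>m. cmod (dirichlet_term c s (m + Suc N)))"
      by (rule summable_norm) (use s1 in \<open>subst summable_iff_shift\<close>)
    also have "\<dots> \<le> (\<Sum>m. real (Suc N) powr (-u) * (cmod (c (m + Suc N)) * real (m + Suc N) powr (-\<sigma>)))"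
    proof (rule suminf_le)
      show "summable (\<lambda>m. cmod (dirichlet_term c s (m + Suc N)))"
        using s1 by (subst summable_iff_shift)
      show "summable (\<lambda>m. real (Suc N) powr (-u) * (cmod (c (m + Suc N)) * real (m + Suc N) powr (-\<sigma>)))"
        by (rule summable_mult) (use summable_iff_shift[of "\<lambda>m. cmod (c m) * real m powr (-\<sigma>)"] c in blast)
      show "cmod (dirichlet_term c s (m + Suc N)) \<le> real (Suc N) powr (-u) * (cmod (c (m + Suc N)) * real (m + Suc N) powr (-\<sigma>))" for m
        by (rule le) simp
    qed
    also have "\<dots> = real (Suc N) powr (-u) * (\<Sum>m. cmod (c (m + Suc N)) * real (m + Suc N) powr (-\<sigma>))"
      by (rule suminf_mult) (use summable_iff_shift[of "\<lambda>m. cmod (c m) * real m powr (-\<sigma>)"] c in blast)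
    also have "\<dots> \<le> real (Suc N) powr (-u) * K"
    proof (rule mult_left_mono)
      show "(\<Sum>m. cmod (c (m + Suc N)) * real (m + Suc N) powr (-\<sigma>)) \<le> K"
        unfolding K_def using suminf_split_initial_segment[OF c, of "Suc N"]
        by (simp add: sum_nonneg)
    qed simp
    finally have "cmod (R s) \<le> real (Suc N) powr (-u) * K * real n powr Re s"
      unfolding R_def norm_mult norm_of_nat_powr by (rule mult_right_mono) simp
    also have "\<dots> = K * real n powr \<sigma> * q powr (Re s - \<sigma>)"
    proof -
      have "real n powr Re s = real n powr \<sigma> * real n powr u" by (simp add: u_def powr_add[symmetric])
      moreover have "q powr u = real n powr u * real (Suc N) powr (-u)"
        unfolding q_def by (subst powr_divide) (auto simp: powr_minus divide_inverse)
      ultimately show ?thesis by (simp add: u_def)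
    qed
    finally show ?thesis .
  qed
  \<comment> \<open>Here the series need not represent \<open>F\<close>, so boundedness of
    \<open>F\<close> has to do.\<close>
  have near: "cmod (R s) \<le> (B + (\<Sum>m\<le>N. cmod (c m) * real m powr (-\<epsilon>))) * real n powr \<bar>\<sigma>\<bar>"
    if s: "Re s \<ge> \<epsilon>" "Re s \<le> \<sigma>" for s
    unfolding R_def norm_mult norm_of_nat_powr
  proof (rule mult_mono)
    have "cmod (dpoly c N s) \<le> (\<Sum>m\<le>N. cmod (c m) * real m powr (-\<epsilon>))"
      unfolding dpoly_def
    proof (rule sum_norm_le)
      fix m show "cmod (dirichlet_term c s m) \<le> cmod (c m) * real m powr (-\<epsilon>)"
        unfolding norm_dirichlet_term using s by (cases "m = 0") (auto intro!: mult_left_mono powr_mono)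
    qed
    then show "cmod (F s - dpoly c N s) \<le> B + (\<Sum>m\<le>N. cmod (c m) * real m powr (-\<epsilon>))"
      using norm_triangle_ineq4[of "F s" "dpoly c N s"] bd[OF s(1)] by linarith
    show "real n powr Re s \<le> real n powr \<bar>\<sigma>\<bar>" using n s by (intro powr_mono) auto
    show "0 \<le> B + (\<Sum>m\<le>N. cmod (c m) * real m powr (-\<epsilon>))"
      using order_trans[OF norm_ge_zero bd[OF s(1)]] by (simp add: sum_nonneg)
  qed simp
  have "has_mean (\<lambda>t. R (Complex \<epsilon> t)) 0"
  proof (rule has_mean_vertical[OF _ \<rho>])
    have "(\<lambda>s. of_nat n powr s :: complex) holomorphic_on half_plane \<rho>"
      using n by (auto simp: of_nat_powr_exp intro!: holomorphic_intros)
    then show "R holomorphic_on half_plane \<rho>"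
      unfolding R_def by (intro holomorphic_intros F holomorphic_dpoly)
    let ?B = "max ((B + (\<Sum>m\<le>N. cmod (c m) * real m powr (-\<epsilon>))) * real n powr \<bar>\<sigma>\<bar>) (K * real n powr \<sigma>)"
    show "cmod (R s) \<le> ?B" if "Re s \<ge> \<epsilon>" for s
    proof (cases "Re s > \<sigma>")
      case True
      have "q powr (Re s - \<sigma>) \<le> 1" using q True by (intro powr_le1) auto
      then have "K * real n powr \<sigma> * q powr (Re s - \<sigma>) \<le> K * real n powr \<sigma> * 1"
        using K0 by (intro mult_left_mono) auto
      then show ?thesis using far[OF True] by simp
    qed (use near[OF that] in auto)
    fix e :: real assume e: "e > 0"
    have "((\<lambda>x. K * real n powr \<sigma> * q powr (x - \<sigma>)) \<longlongrightarrow> K * real n powr \<sigma> * 0) at_top"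
    proof (intro tendsto_intros)
      have "ln q < 0" using q by simp
      have "filterlim (\<lambda>x. (x - \<sigma>) * (- ln q)) at_top at_top"
        using \<open>ln q < 0\<close> filterlim_tendsto_add_at_top[OF tendsto_const[of "-\<sigma>"] filterlim_ident]
        by (intro filterlim_at_top_mult_tendsto_pos[OF tendsto_const]) (auto simp: add.commute)
      then have "((\<lambda>x. exp (- ((x - \<sigma>) * (- ln q)))) \<longlongrightarrow> 0) at_top"
        by (intro filterlim_compose[OF exp_at_bot] filterlim_compose[OF filterlim_uminus_at_bot_at_top])
      then show "((\<lambda>x. q powr (x - \<sigma>)) \<longlongrightarrow> 0) at_top"
        using q by (simp add: powr_def)
    qed
    then have "\<forall>\<^sub>F x in at_top. K * real n powr \<sigma> * q powr (x - \<sigma>) < e"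
      using e by (intro order_tendstoD(2)) auto
    then have "\<forall>\<^sub>F x in at_top. K * real n powr \<sigma> * q powr (x - \<sigma>) < e \<and> x > max \<epsilon> \<sigma>"
      using eventually_gt_at_top by (rule eventually_conj)
    then obtain x where x: "K * real n powr \<sigma> * q powr (x - \<sigma>) < e" "x > max \<epsilon> \<sigma>"
      by (auto dest: eventually_happens)
    then show "\<exists>x\<ge>\<epsilon>. \<forall>t. cmod (R (Complex x t) - 0) \<le> e"
      using far[of "Complex x t" for t] by (intro exI[of _ x]) (auto intro: order_trans less_imp_le)
  qed
  then show ?thesis by (simp add: R_def)
qed

text \<open>Write \<open>F = R + P\<close> with \<open>P = dpoly c N\<close>. Since
  \<open>R * cnj P\<close> has mean zero, the mean of the squared modulus of \<open>F\<close> is at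
  least that of \<open>P\<close>. The series is needed only far to the right, while the bound is
  obtained on \<open>Re s = \<epsilon>\<close>.\<close>

lemma dirichlet_bessel:
  assumes F: "F holomorphic_on half_plane \<rho>" and \<rho>: "\<rho> < \<epsilon>"
    and bd: "\<And>s. Re s \<ge> \<epsilon> \<Longrightarrow> cmod (F s) \<le> B"
    and c: "summable (\<lambda>n. cmod (c n) * real n powr (-\<sigma>))"
    and rep: "\<And>s. Re s > \<sigma> \<Longrightarrow> F s = dirichlet_sum c s"
    and mean: "\<And>e. e > 0 \<Longrightarrow> \<forall>\<^sub>F T in at_top.
       integral {-T..T} (\<lambda>t. (cmod (F (Complex \<epsilon> t)))\<^sup>2) \<le> 2 * T * (M + e)"
  shows "(\<Sum>n\<le>N. (cmod (c n))\<^sup>2 * real n powr (-2 * \<epsilon>)) \<le> M"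
proof -
  define A where "A = (\<Sum>n\<le>N. (cmod (c n))\<^sup>2 * real n powr (-2 * \<epsilon>))"
  define P where "P t = dpoly c N (Complex \<epsilon> t)" for t
  define R where "R t = F (Complex \<epsilon> t) - P t" for t
  have RP: "R t * cnj (P t) = (\<Sum>n\<le>N. (cnj (c n) * of_real (real n powr (-2 * \<epsilon>))) * (R t * of_nat n powr Complex \<epsilon> t))" for t
  proof -
    \<comment> \<open>On the line \<open>Re s = \<epsilon>\<close> the conjugate of
      \<open>n powr -s\<close> equals \<open>n powr (-2 * \<epsilon>) * n powr s\<close>, which is
      holomorphic in \<open>s\<close>; this is what makes \<open>has_mean_remainder\<close>
      applicable.\<close>
    have "cnj (dirichlet_term c (Complex \<epsilon> t) n) = cnj (c n) * of_real (real n powr (-2 * \<epsilon>)) * of_nat n powr Complex \<epsilon> t" for n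
    proof (cases "n = 0")
      case False
      then have "cnj (of_nat n powr - Complex \<epsilon> t) = of_real (real n powr (-2 * \<epsilon>)) * of_nat n powr Complex \<epsilon> t"
        by (simp add: of_nat_powr_exp powr_def exp_of_real[symmetric] exp_add[symmetric] exp_cnj complex_eq_iff
          flip: of_real_mult) (simp add: Re_exp Im_exp algebra_simps exp_add[symmetric])
      then show ?thesis by (simp add: dirichlet_term_def)
    qed simp
    then show ?thesis by (simp add: P_def dpoly_def sum_distrib_left algebra_simps)
  qed
  have "has_mean (\<lambda>t. R t * cnj (P t)) (\<Sum>n\<le>N. 0)"
    unfolding RP
  proof (rule has_mean_sum)
    fix n assume n: "n \<in> {..N}"
    show "has_mean (\<lambda>t. (cnj (c n) * of_real (real n powr (-2 * \<epsilon>))) * (R t * of_nat n powr Complex \<epsilon> t)) 0"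
    proof (cases "n = 0")
      case False
      then have "has_mean (\<lambda>t. R t * of_nat n powr Complex \<epsilon> t) 0"
        unfolding R_def P_def using n by (intro has_mean_remainder[OF F \<rho> bd c rep]) auto
      from has_mean_cmult[OF this] show ?thesis by simp
    qed (simp add: has_mean_0)
  qed
  from has_mean_add[OF has_mean_dpoly_square[of c N \<epsilon>] has_mean_cmult[OF this, of 2]]
  have m: "has_mean (\<lambda>t. P t * cnj (P t) + 2 * (R t * cnj (P t))) (of_real A)"
    by (simp add: P_def A_def)
  have le: "Re (P t * cnj (P t) + 2 * (R t * cnj (P t))) \<le> (cmod (F (Complex \<epsilon> t)))\<^sup>2" for t
  proof -
    have "F (Complex \<epsilon> t) = R t + P t" by (simp add: R_def)
    then have "(cmod (F (Complex \<epsilon> t)))\<^sup>2 = (cmod (R t))\<^sup>2 + Re (P t * cnj (P t) + 2 * (R t * cnj (P t)))"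
      unfolding cmod_power2 by (simp add: power2_eq_square algebra_simps)
    then show ?thesis by simp
  qed
  note contF = continuous_on_vertical[OF F \<rho>]
  show ?thesis
  proof (rule field_le_epsilon)
    fix e :: real assume e: "e > 0"
    let ?J = "\<lambda>T. integral {-T..T} (\<lambda>t. P t * cnj (P t) + 2 * (R t * cnj (P t)))"
    have "((\<lambda>T. Re (?J T / of_real (2 * T))) \<longlongrightarrow> Re (of_real A)) at_top"
      using m unfolding has_mean_def by (intro tendsto_Re) auto
    moreover have "\<forall>\<^sub>F T in at_top. Re (?J T / of_real (2 * T)) \<le> M + e"
      using mean[OF e] eventually_gt_at_top[of "0::real"]
    proof eventually_elim
      case (elim T)
      have i: "(\<lambda>t. P t * cnj (P t) + 2 * (R t * cnj (P t))) integrable_on {-T..T}"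
        by (rule has_mean_integrable[OF m])
      have "Re (?J T) = integral {-T..T} (\<lambda>t. Re (P t * cnj (P t) + 2 * (R t * cnj (P t))))"
        using integral_linear[OF i bounded_linear_Re] by (simp add: o_def)
      also have "\<dots> \<le> integral {-T..T} (\<lambda>t. (cmod (F (Complex \<epsilon> t)))\<^sup>2)"
      proof (rule integral_le)
        show "(\<lambda>t. Re (P t * cnj (P t) + 2 * (R t * cnj (P t)))) integrable_on {-T..T}"
          using integrable_linear[OF i bounded_linear_Re] by (simp add: o_def)
        show "(\<lambda>t. (cmod (F (Complex \<epsilon> t)))\<^sup>2) integrable_on {-T..T}"
          by (intro integrable_continuous_real continuous_intros continuous_on_subset[OF contF]) auto
      qed (rule le)
      finally have "Re (?J T) \<le> 2 * T * (M + e)" using elim by linarith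
      moreover have "Re (?J T / of_real (2 * T)) = Re (?J T) / (2 * T)" by (rule Re_divide_of_real)
      ultimately show ?case using elim by (simp add: field_simps)
    qed
    ultimately have "Re (of_real A) \<le> M + e"
      by (intro tendsto_upperbound[of "\<lambda>T. Re (?J T / of_real (2 * T))"]) auto
    then show "(\<Sum>n\<le>N. (cmod (c n))\<^sup>2 * real n powr (-2 * \<epsilon>)) \<le> M + e" by (simp add: A_def)
  qed
qed

section \<open>Holomorphic functions on the right half-plane\<close>

text \<open>The squares differ by \<open>4 * Re z * Re w\<close>. Hence the quotient of the two
  sides lies in the unit disc, as the Schwarz lemma requires below.\<close>

lemma norm_diff_less_norm_add_cnj:
  assumes "Re z > 0" "Re w > 0"
  shows "cmod (z - w) < cmod (z + cnj w)"
proof -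
  have "(cmod (z - w))\<^sup>2 < (cmod (z + cnj w))\<^sup>2"
    using assms mult_pos_pos[OF assms] unfolding cmod_power2
    by (simp add: power2_eq_square algebra_simps)
  then show ?thesis by (rule power2_less_imp_less) simp
qed

text \<open>The Schwarz-Pick inequality for two points on a horizontal line, reduced to real
  parts.\<close>

lemma harnack_quotient:
  assumes F: "F holomorphic_on half_plane 0" "\<And>s. Re s > 0 \<Longrightarrow> Re (F s) > 0" and x: "x > 0" and y: "y > 0"
  shows "\<bar>Re (F (Complex x t)) - Re (F (Complex y t))\<bar> * (x + y)
     \<le> \<bar>x - y\<bar> * (Re (F (Complex x t)) + Re (F (Complex y t)))"
proof -
  \<comment> \<open>A Cayley map of the unit disc onto the right half-plane with centre going to
    \<open>Complex y t\<close>. The real point \<xi> defined below goes to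
    \<open>Complex x t\<close>.\<close>
  define w where "w z = \<i> * of_real t + of_real y * ((1 + z) / (1 - z))" for z
  define W where "W = F (Complex y t)"
  define \<psi> where "\<psi> z = (F (w z) - W) / (F (w z) + cnj W)" for z
  have w0: "w 0 = Complex y t" by (simp add: w_def complex_eq_iff)
  have W: "Re W > 0" using F(2)[of "Complex y t"] y by (simp add: W_def)
  have Rw: "Re (w z) > 0" if "cmod z < 1" for z
  proof -
    have nz: "cmod (1 - z) > 0" using that by auto
    have "(1 + z) / (1 - z) = (1 + z) * cnj (1 - z) / of_real ((cmod (1 - z))\<^sup>2)"
      using complex_div_cnj[of "1 + z" "1 - z"] by simp
    then have "Re ((1 + z) / (1 - z)) = Re ((1 + z) * cnj (1 - z)) / (cmod (1 - z))\<^sup>2"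
      by (simp only: Re_divide_of_real)
    also have "Re ((1 + z) * cnj (1 - z)) = 1 - (cmod z)\<^sup>2"
      unfolding cmod_power2 by (simp add: power2_eq_square algebra_simps)
    finally have "Re ((1 + z) / (1 - z)) > 0"
      using that nz by (simp add: power_less_one_iff abs_square_less_1)
    then have "y * Re ((1 + z) / (1 - z)) > 0" using y by (rule mult_pos_pos[rotated])
    moreover have "Re (w z) = y * Re ((1 + z) / (1 - z))"
      unfolding w_def plus_complex.sel times_complex.sel by simp
    ultimately show ?thesis by simp
  qed
  have Wn: "F (w z) + cnj W \<noteq> 0" if "cmod z < 1" for z
  proof -
    have "Re (F (w z) + cnj W) > 0" using F(2)[OF Rw[OF that]] W by simp
    then show ?thesis by (metis less_irrefl zero_complex.sel(1))
  qed
  have hol: "\<psi> holomorphic_on ball 0 1"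
  proof -
    have "w holomorphic_on ball 0 1" unfolding w_def
      by (intro holomorphic_intros) (auto simp: dist_norm)
    then have "(F \<circ> w) holomorphic_on ball 0 1"
      by (rule holomorphic_on_compose_gen[OF _ F(1)]) (use Rw in auto)
    then show ?thesis unfolding \<psi>_def o_def
      by (intro holomorphic_intros) (use Wn in auto)
  qed
  define \<xi> where "\<xi> = (x - y) / (x + y)"
  have xi: "\<bar>\<xi>\<bar> < 1" using x y by (auto simp: \<xi>_def abs_less_iff field_simps)
  have wxi: "w (of_real \<xi>) = Complex x t"
  proof -
    have "1 + \<xi> = 2 * x / (x + y)" "1 - \<xi> = 2 * y / (x + y)" using x y by (auto simp: \<xi>_def field_simps)
    then have "(1 + \<xi>) / (1 - \<xi>) = x / y" using x y by simp
    then have "(1 + complex_of_real \<xi>) / (1 - complex_of_real \<xi>) = of_real (x / y)"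
      by (metis of_real_1 of_real_add of_real_diff of_real_divide)
    show ?thesis unfolding w_def \<open>(1 + complex_of_real \<xi>) / (1 - complex_of_real \<xi>) = of_real (x / y)\<close> using y by (simp add: complex_eq_iff)
  qed
  have "cmod (\<psi> (of_real \<xi>)) \<le> cmod (of_real \<xi>)"
  proof (rule Schwarz_Lemma(1)[OF hol])
    show "\<psi> 0 = 0" by (simp add: \<psi>_def w0 W_def)
    show "cmod (\<psi> z) < 1" if "cmod z < 1" for z
      using norm_diff_less_norm_add_cnj[OF F(2)[OF Rw[OF that]] W] Wn[OF that]
      by (simp add: \<psi>_def norm_divide divide_simps)
  qed (use xi in auto)
  then have "cmod (F (Complex x t) - W) \<le> \<bar>\<xi>\<bar> * cmod (F (Complex x t) + cnj W)"
    using Wn[of "of_real \<xi>"] xi by (simp add: \<psi>_def wxi norm_divide divide_simps)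
  then have sq: "(cmod (F (Complex x t) - W))\<^sup>2 \<le> \<xi>\<^sup>2 * (cmod (F (Complex x t) + cnj W))\<^sup>2"
    using power_mono[of "cmod (F (Complex x t) - W)" _ 2] by (fastforce simp: power_mult_distrib)
  define a b d where "a = Re (F (Complex x t))" and "b = Re W" and "d = (Im (F (Complex x t)) - Im W)\<^sup>2"
  have "(a - b)\<^sup>2 + d \<le> \<xi>\<^sup>2 * ((a + b)\<^sup>2 + d)"
    using sq unfolding cmod_power2 a_def b_def d_def by simp
  moreover have "\<xi>\<^sup>2 * d \<le> 1 * d"
    using xi by (intro mult_right_mono) (auto simp: d_def abs_square_le_1 less_imp_le)
  ultimately have "(a - b)\<^sup>2 \<le> (\<xi> * (a + b))\<^sup>2"
    by (subst power_mult_distrib) (simp add: distrib_left)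
  then have "\<bar>a - b\<bar> \<le> \<bar>\<xi> * (a + b)\<bar>" by (simp add: abs_le_square_iff)
  moreover have "a + b > 0" using F(2)[of "Complex x t"] x W by (simp add: a_def b_def)
  ultimately have "\<bar>a - b\<bar> \<le> \<bar>x - y\<bar> / (x + y) * (a + b)"
    using x y by (simp add: abs_mult \<xi>_def)
  then show ?thesis using x y by (simp add: a_def b_def W_def field_simps)
qed

text \<open>The first form carries a lower bound towards the imaginary axis
  (\<open>Re_ge_on_half_plane\<close>); the second limits the decay to the right
  (\<open>Re_leading_coeff_gt\<close>).\<close>

lemma harnack:
  assumes "F holomorphic_on half_plane 0" "\<And>s. Re s > 0 \<Longrightarrow> Re (F s) > 0" "0 < x" "x \<le> y"
  shows "Re (F (Complex x t)) * y \<ge> Re (F (Complex y t)) * x"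
    and "Re (F (Complex y t)) * y \<ge> Re (F (Complex x t)) * x"
proof -
  have y: "0 < y" using assms by simp
  have Q: "\<bar>Re (F (Complex x t)) - Re (F (Complex y t))\<bar> * (x + y)
     \<le> (y - x) * (Re (F (Complex x t)) + Re (F (Complex y t)))"
    using harnack_quotient[OF assms(1,2,3) y, of t] assms by simp
  have "(Re (F (Complex y t)) - Re (F (Complex x t))) * (x + y)
     \<le> \<bar>Re (F (Complex x t)) - Re (F (Complex y t))\<bar> * (x + y)"
    "(Re (F (Complex x t)) - Re (F (Complex y t))) * (x + y)
     \<le> \<bar>Re (F (Complex x t)) - Re (F (Complex y t))\<bar> * (x + y)"
    using assms y by (auto intro!: mult_right_mono)
  with Q show "Re (F (Complex x t)) * y \<ge> Re (F (Complex y t)) * x"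
     "Re (F (Complex y t)) * y \<ge> Re (F (Complex x t)) * x"
    by (auto simp: algebra_simps)
qed

text \<open>Montel's theorem gives a subsequence converging on the whole half-plane; the limit is
  identified only far to the right, where the pointwise limit is known.\<close>

lemma bounded_pointwise_limit_extends:
  assumes f: "\<And>j. f j holomorphic_on half_plane 0"
    and bd: "\<And>j s. Re s > 0 \<Longrightarrow> cmod (f j s) \<le> B"
    and lim: "\<And>s. Re s > \<nu> \<Longrightarrow> (\<lambda>j. f j s) \<longlonglongrightarrow> g s"
  obtains G where "G holomorphic_on half_plane 0" "\<And>s. Re s > 0 \<Longrightarrow> cmod (G s) \<le> B"
    "\<And>s. Re s > max 0 \<nu> \<Longrightarrow> G s = g s"
proof -
  obtain G r where G: "G holomorphic_on half_plane 0" "strict_mono (r :: nat \<Rightarrow> nat)"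
    "\<And>s. s \<in> half_plane 0 \<Longrightarrow> (\<lambda>j. f (r j) s) \<longlonglongrightarrow> G s"
  proof (rule Montel[OF open_half_plane, of "range f" 0 f])
    show "h holomorphic_on half_plane 0" if "h \<in> range f" for h using that f by auto
    show "\<exists>B. \<forall>h\<in>range f. \<forall>z\<in>K. cmod (h z) \<le> B" if "K \<subseteq> half_plane 0" for K
      using that bd by (intro exI[of _ B]) (auto simp: subset_iff)
  qed auto
  show ?thesis
  proof (rule that[OF G(1)])
    fix s :: complex
    show "cmod (G s) \<le> B" if "Re s > 0"
      using Lim_norm_ubound[OF _ G(3)[of s]] bd that by simp
    show "G s = g s" if "Re s > max 0 \<nu>"
      using LIMSEQ_unique[OF G(3)[of s] LIMSEQ_subseq_LIMSEQ[OF lim[of s] G(2), unfolded o_def]] that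
      by simp
  qed
qed

lemma holomorphic_eq_half_plane:
  assumes "f holomorphic_on half_plane \<rho>" "g holomorphic_on half_plane \<rho>"
    and "\<And>s. Re s > \<nu> \<Longrightarrow> f s = g s" and "Re s > \<rho>"
  shows "f s = g s"
proof (rule analytic_continuation_open[of "half_plane (max \<rho> \<nu>)" "half_plane \<rho>" f g])
  show "half_plane (max \<rho> \<nu>) \<noteq> {}"
    using mem_half_plane[of "of_real (max \<rho> \<nu> + 1)" "max \<rho> \<nu>"] by (metis Re_complex_of_real empty_iff less_add_one)
  show "connected (half_plane \<rho>)" by (rule convex_connected[OF convex_half_plane])
qed (use assms open_half_plane in auto)

section \<open>Extending a logarithm from two of its exponentials\<close>

lemma three_power_neq_two_power: "m > 0 \<Longrightarrow> (3::nat) ^ m \<noteq> 2 ^ l"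
proof
  assume m: "m > 0" and e: "(3::nat) ^ m = 2 ^ l"
  have "odd ((3::nat) ^ m)" by simp
  then have "l = 0" using e by (cases l) auto
  then show False using e m by simp
qed

text \<open>A zero of \<open>g\<close> of order \<open>m\<close> would be a zero of \<open>h\<close> of order \<open>l\<close> with
  \<open>m * ln 3 = l * ln 2\<close>.\<close>

lemma log_extends:
  assumes g: "g holomorphic_on half_plane 0" and h: "h holomorphic_on half_plane 0"
    and \<nu>: "\<nu> \<ge> 0" and \<phi>: "\<phi> holomorphic_on half_plane \<nu>"
    and g\<phi>: "\<And>s. Re s > \<nu> \<Longrightarrow> g s = exp (- of_real (ln 2) * \<phi> s)"
    and h\<phi>: "\<And>s. Re s > \<nu> \<Longrightarrow> h s = exp (- of_real (ln 3) * \<phi> s)"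
  obtains \<Phi> where "\<Phi> holomorphic_on half_plane 0" "\<And>s. Re s > \<nu> \<Longrightarrow> \<Phi> s = \<phi> s"
    "\<And>s. Re s > 0 \<Longrightarrow> g s = exp (- of_real (ln 2) * \<Phi> s)"
proof -
  have conn: "connected (half_plane \<sigma>)" for \<sigma> by (rule convex_connected[OF convex_half_plane])
  have far: "\<exists>s. Re s > \<nu>" by (rule exI[of _ "of_real (\<nu> + 1)"]) simp
  have diffg: "g field_differentiable at s" and diffh: "h field_differentiable at s" if "Re s > 0" for s
    using that g h by (auto intro!: holomorphic_on_imp_differentiable_at[OF _ open_half_plane])
  have dg: "deriv g s = - of_real (ln 2) * deriv \<phi> s * g s"
    and dh: "deriv h s = - of_real (ln 3) * deriv \<phi> s * h s" if s: "Re s > \<nu>" for s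
  proof -
    have \<phi>': "(\<phi> has_field_derivative deriv \<phi> s) (at s)"
      using \<phi> open_half_plane s by (intro holomorphic_derivI[of _ "half_plane \<nu>"]) auto
    have ev: "\<forall>\<^sub>F z in nhds s. z \<in> half_plane \<nu>"
      using s open_half_plane by (intro eventually_nhds_in_open) auto
    have "deriv g s = deriv (\<lambda>s. exp (- of_real (ln 2) * \<phi> s)) s"
      by (rule deriv_cong_ev[OF eventually_mono[OF ev]]) (use g\<phi> in auto)
    also have "\<dots> = - of_real (ln 2) * deriv \<phi> s * g s"
      unfolding g\<phi>[OF s] by (rule DERIV_imp_deriv) (auto intro!: derivative_eq_intros \<phi>')
    finally show "deriv g s = - of_real (ln 2) * deriv \<phi> s * g s" .
    have "deriv h s = deriv (\<lambda>s. exp (- of_real (ln 3) * \<phi> s)) s"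
      by (rule deriv_cong_ev[OF eventually_mono[OF ev]]) (use h\<phi> in auto)
    also have "\<dots> = - of_real (ln 3) * deriv \<phi> s * h s"
      unfolding h\<phi>[OF s] by (rule DERIV_imp_deriv) (auto intro!: derivative_eq_intros \<phi>')
    finally show "deriv h s = - of_real (ln 3) * deriv \<phi> s * h s" .
  qed
  \<comment> \<open>The logarithmic derivatives of \<open>g\<close> and \<open>h\<close> are in the
    ratio \<open>ln 2 : ln 3\<close> where \<phi> is defined. Cleared of denominators, the relation
    continues to possible zeros.\<close>
  have ode: "of_real (ln 3) * deriv g s * h s = of_real (ln 2) * deriv h s * g s" if "Re s > 0" for s
  proof (rule holomorphic_eq_half_plane[where \<rho> = 0 and \<nu> = \<nu> and s = s and
      f = "\<lambda>s. of_real (ln 3) * deriv g s * h s" and g = "\<lambda>s. of_real (ln 2) * deriv h s * g s"])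
    show "(\<lambda>s. of_real (ln 3) * deriv g s * h s) holomorphic_on half_plane 0"
      "(\<lambda>s. of_real (ln 2) * deriv h s * g s) holomorphic_on half_plane 0"
      by (intro holomorphic_intros holomorphic_deriv g h open_half_plane)+
  qed (use dg dh that in \<open>auto simp: mult_ac\<close>)
  have order: "\<exists>G r m. r > 0 \<and> ball z r \<subseteq> half_plane 0 \<and> G holomorphic_on ball z r \<and>
      (\<forall>w\<in>ball z r. f w = (w - z) ^ m * G w) \<and> (\<forall>w\<in>ball z r. G w \<noteq> 0) \<and> (m = 0 \<longrightarrow> f z \<noteq> 0)"
    if f: "f holomorphic_on half_plane 0" and z: "Re z > 0" and nz: "\<exists>s. Re s > 0 \<and> f s \<noteq> 0" for f z
  proof (cases "f z = 0")
    case True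
    then have "\<not> f constant_on half_plane 0" using z nz unfolding constant_on_def by (metis mem_half_plane)
    from holomorphic_factor_zero_nonconstant[OF f open_half_plane conn _ True this] z
    show ?thesis by (metis mem_half_plane neq0_conv)
  next
    case False
    have "continuous (at z) f"
      using f z open_half_plane by (metis mem_half_plane continuous_on_eq_continuous_at holomorphic_on_imp_continuous_on)
    then obtain e where e: "e > 0" "\<And>w. dist w z < e \<Longrightarrow> f w \<noteq> 0"
      using continuous_at_avoid[of z f 0] False by (auto simp: dist_commute)
    obtain e' where e': "e' > 0" "ball z e' \<subseteq> half_plane 0"
      using open_half_plane z by (metis openE mem_half_plane)
    have "f holomorphic_on ball z (min e e')" by (rule holomorphic_on_subset[OF f]) (use e' in auto)
    then show ?thesis using e e' False
      by (intro exI[of _ f] exI[of _ "min e e'"] exI[of _ 0]) (auto simp: dist_commute)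
  qed
  have g_nz: "g z \<noteq> 0" if z: "Re z > 0" for z
  proof
    assume gz: "g z = 0"
    have "\<exists>s. Re s > 0 \<and> g s \<noteq> 0" "\<exists>s. Re s > 0 \<and> h s \<noteq> 0"
      using far \<nu> g\<phi> h\<phi> by (metis exp_not_eq_zero le_less_trans)+
    from order[OF g z this(1)] order[OF h z this(2)] gz obtain G H r r' m l where
      r: "r > 0" "ball z r \<subseteq> half_plane 0" "G holomorphic_on ball z r" "\<And>w. w \<in> ball z r \<Longrightarrow> g w = (w - z) ^ m * G w"
        "\<And>w. w \<in> ball z r \<Longrightarrow> G w \<noteq> 0" "m > 0"
      and r': "r' > 0" "H holomorphic_on ball z r'" "\<And>w. w \<in> ball z r' \<Longrightarrow> h w = (w - z) ^ l * H w"
        "\<And>w. w \<in> ball z r' \<Longrightarrow> H w \<noteq> 0"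
      by (metis neq0_conv)
    define \<rho> where "\<rho> = min r r'"
    have sub: "ball z \<rho> \<subseteq> ball z r" "ball z \<rho> \<subseteq> ball z r'" by (auto simp: \<rho>_def)
    \<comment> \<open>Multiplying the derivative by \<open>w - z\<close> gives one formula for all
      orders, including 0 with its truncated \<open>k - 1\<close>.\<close>
    have dz: "(w - z) * deriv f w = of_nat k * f w + (w - z) * ((w - z) ^ k * deriv K w)"
      if "\<And>w. w \<in> ball z \<rho> \<Longrightarrow> f w = (w - z) ^ k * K w" "K holomorphic_on ball z \<rho>" "w \<in> ball z \<rho>"
      for f K k w
    proof -
      have K': "(K has_field_derivative deriv K w) (at w)"
        using that by (intro holomorphic_derivI[of _ "ball z \<rho>"]) auto
      have ev: "\<forall>\<^sub>F u in nhds w. u \<in> ball z \<rho>"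
        using that by (intro eventually_nhds_in_open) auto
      have "deriv f w = deriv (\<lambda>w. (w - z) ^ k * K w) w"
        by (rule deriv_cong_ev[OF eventually_mono[OF ev]]) (use that in auto)
      also have "\<dots> = of_nat k * (w - z) ^ (k - 1) * K w + (w - z) ^ k * deriv K w"
        by (rule DERIV_imp_deriv) (auto intro!: derivative_eq_intros K')
      finally show ?thesis using that(1)[OF that(3)]
        by (cases k) (simp_all add: distrib_left mult_ac)
    qed
    \<comment> \<open>The relation \<open>ode\<close> times \<open>w - z\<close>, divided by
      \<open>(w - z) ^ (m + l)\<close>. At \<open>w = z\<close> only
      \<open>(m * ln 3 - l * ln 2) * G z * H z\<close> remains.\<close>
    define q where "q w = of_real (ln 3) * (of_nat m * G w * H w + (w - z) * deriv G w * H w)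
        - of_real (ln 2) * (of_nat l * G w * H w + (w - z) * deriv H w * G w)" for w
    have q0: "q w = 0" if w: "w \<in> ball z \<rho>" "w \<noteq> z" for w
    proof -
      have wr: "w \<in> ball z r" "w \<in> ball z r'" "Re w > 0" using w sub r(2) by (auto simp: subset_iff)
      have "of_real (ln 3) * ((w - z) * deriv g w) * h w = of_real (ln 2) * ((w - z) * deriv h w) * g w"
        using ode[OF wr(3)] by (simp add: mult_ac)
      also have "(w - z) * deriv g w = of_nat m * g w + (w - z) * ((w - z) ^ m * deriv G w)"
        by (rule dz) (use r(4) sub w holomorphic_on_subset[OF r(3) sub(1)] in auto)
      also have "(w - z) * deriv h w = of_nat l * h w + (w - z) * ((w - z) ^ l * deriv H w)"
        by (rule dz) (use r'(3) sub w holomorphic_on_subset[OF r'(2) sub(2)] in auto)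
      finally have "(w - z) ^ m * (w - z) ^ l * q w = 0"
        unfolding r(4)[OF wr(1)] r'(3)[OF wr(2)] q_def by (simp add: algebra_simps)
      then show ?thesis using w by simp
    qed
    have "isCont q z"
    proof -
      have "deriv G holomorphic_on ball z r" "deriv H holomorphic_on ball z r'"
        by (intro holomorphic_deriv r(3) r'(2) open_ball)+
      then have "continuous_on (ball z \<rho>) G" "continuous_on (ball z \<rho>) H"
        "continuous_on (ball z \<rho>) (deriv G)" "continuous_on (ball z \<rho>) (deriv H)"
        using r(3) r'(2) sub by (meson continuous_on_subset holomorphic_on_imp_continuous_on)+
      then have "continuous_on (ball z \<rho>) q" unfolding q_def
        by (intro continuous_intros)
      then show ?thesis using r(1) r'(1)
        by (simp add: continuous_on_eq_continuous_at \<rho>_def)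
    qed
    then have "q \<midarrow>z\<rightarrow> q z" by (simp add: isCont_def)
    moreover have "\<forall>\<^sub>F w in at z. q w = 0"
      unfolding eventually_at using q0 r(1) r'(1)
      by (intro exI[of _ \<rho>]) (auto simp: \<rho>_def dist_commute)
    ultimately have "q z = 0"
      using tendsto_unique[of "at z" q "q z" 0] tendsto_eventually by auto
    then have "(of_real (ln 3) * of_nat m - of_real (ln 2) * of_nat l) * (G z * H z) = 0"
      by (simp add: q_def algebra_simps)
    then have "complex_of_real (ln 3 * real m - ln 2 * real l) = 0"
      using r(1,5) r'(1,4) by simp
    then have "real m * ln 3 = real l * ln 2"
      unfolding of_real_eq_0_iff by (simp add: mult.commute)
    then have "ln ((3::real) ^ m) = ln (2 ^ l)" by (simp add: ln_realpow)
    then have "(3::real) ^ m = 2 ^ l" by simp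
    then have "real (3 ^ m) = real (2 ^ l)" by simp
    then show False using three_power_neq_two_power[OF r(6)] of_nat_eq_iff by blast
  qed
  obtain L where L0: "L holomorphic_on half_plane 0" "\<And>s. s \<in> half_plane 0 \<Longrightarrow> exp (L s) = g s"
    by (rule holomorphic_logarithm_exists[OF convex_half_plane open_half_plane g, of 1]) (use g_nz in auto)
  have L: "L holomorphic_on half_plane 0" "\<And>s. s \<in> half_plane 0 \<Longrightarrow> g s = exp (L s)"
    using L0 by auto
  \<comment> \<open>On \<open>half_plane \<nu>\<close> both \<open>L\<close> and
    \<open>-ln 2 * \<phi>\<close> are logarithms of \<open>g\<close>, so they differ by a constant
    \<open>K\<close> with \<open>exp K = 1\<close>. This is why \<open>(K - L) / ln 2\<close> is the
    extension of \<phi>.\<close>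
  have "\<exists>K. \<forall>s\<in>half_plane \<nu>. L s + of_real (ln 2) * \<phi> s = K"
  proof (rule has_field_derivative_zero_constant[OF convex_half_plane])
    fix s assume s: "s \<in> half_plane \<nu>"
    then have s0: "Re s > 0" using \<nu> by simp
    have L': "(L has_field_derivative deriv L s) (at s)"
      using L(1) open_half_plane s0 by (intro holomorphic_derivI[of _ "half_plane 0"]) auto
    have \<phi>': "(\<phi> has_field_derivative deriv \<phi> s) (at s)"
      using \<phi> open_half_plane s by (intro holomorphic_derivI[of _ "half_plane \<nu>"]) auto
    have ev: "\<forall>\<^sub>F z in nhds s. z \<in> half_plane 0"
      using s0 open_half_plane by (intro eventually_nhds_in_open) auto
    have "deriv g s = deriv (\<lambda>s. exp (L s)) s"
      by (rule deriv_cong_ev[OF eventually_mono[OF ev]]) (use L in auto)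
    also have "\<dots> = exp (L s) * deriv L s"
      by (rule DERIV_imp_deriv) (auto intro!: derivative_eq_intros L')
    finally have deq: "deriv g s = exp (L s) * deriv L s" .
    have "deriv L s + of_real (ln 2) * deriv \<phi> s = 0"
    proof -
      have "exp (L s) * (deriv L s + of_real (ln 2) * deriv \<phi> s) = 0"
        using deq dg[of s] L(2)[of s] s s0 by (simp add: algebra_simps)
      then show ?thesis by simp
    qed
    moreover have "((\<lambda>s. L s + of_real (ln 2) * \<phi> s) has_field_derivative (deriv L s + of_real (ln 2) * deriv \<phi> s)) (at s within half_plane \<nu>)"
      by (auto intro!: derivative_eq_intros has_field_derivative_at_within[OF L'] has_field_derivative_at_within[OF \<phi>'])
    ultimately show "((\<lambda>s. L s + of_real (ln 2) * \<phi> s) has_field_derivative 0) (at s within half_plane \<nu>)" by simp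
  qed
  then obtain K where K: "\<And>s. Re s > \<nu> \<Longrightarrow> L s + of_real (ln 2) * \<phi> s = K" by auto
  have "exp K = 1"
  proof -
    obtain s where s: "Re s > \<nu>" using far by blast
    have "exp (L s) = exp (- of_real (ln 2) * \<phi> s)" using L(2)[of s] g\<phi>[OF s] s \<nu> by simp
    then show ?thesis unfolding K[OF s, symmetric] by (simp add: exp_add exp_minus)
  qed
  have ln2: "complex_of_real (ln 2) \<noteq> 0" by simp
  show ?thesis
  proof (rule that[of "\<lambda>s. (K - L s) / of_real (ln 2)"])
    show "(\<lambda>s. (K - L s) / of_real (ln 2)) holomorphic_on half_plane 0"
      using ln2 by (intro holomorphic_intros L) auto
    show "(K - L s) / of_real (ln 2) = \<phi> s" if "Re s > \<nu>" for s
      using K[OF that] ln2 by (auto simp: field_simps)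
    show "g s = exp (- of_real (ln 2) * ((K - L s) / of_real (ln 2)))" if "Re s > 0" for s
      using L(2)[of s] that ln2 \<open>exp K = 1\<close> by (simp add: exp_diff)
  qed
qed

text \<open>
  The real part of the majorant on \<open>Re s = \<delta>\<close> is the square of the modulus of the polynomial. To the
  right, with \<open>y n\<close> the terms of the polynomial and \<open>w n = n powr (2 * (Re s - \<delta>))\<close>, it is the quadratic
  form in \<open>y\<close> with matrix \<open>w (min m n)\<close>, which dominates \<open>\<bar>\<Sum>n. y n\<bar>\<^sup>2\<close> because \<open>w\<close> increases from \<open>w 1 = 1\<close>.
\<close>

definition majorant :: "(nat \<Rightarrow> complex) \<Rightarrow> real \<Rightarrow> nat \<Rightarrow> complex \<Rightarrow> complex" where
  "majorant a \<delta> N s = (\<Sum>n=1..N. cnj (a n) * of_nat n powr (s - of_real (2 * \<delta>)) *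
     (dirichlet_term a s n + 2 * (\<Sum>m=Suc n..N. dirichlet_term a s m)))"

lemma holomorphic_majorant: "majorant a \<delta> N holomorphic_on A"
proof -
  have "(\<lambda>s. of_nat n powr (s - of_real (2 * \<delta>)) :: complex) holomorphic_on A" if "n \<in> {1..N}" for n
    using that by (auto simp: of_nat_powr_exp intro!: holomorphic_intros)
  then show ?thesis unfolding majorant_def
    by (intro holomorphic_intros holomorphic_dirichlet_term) auto
qed

text \<open>Summation by parts leaves, besides the two boundary terms, the sum of
  \<open>(w (n + 1) - w n) * q (n + 1)\<close>, which is nonnegative.\<close>

lemma abel_sum_ge:
  fixes w q :: "nat \<Rightarrow> real"
  assumes "w 1 = 1" "\<And>n. n \<ge> 1 \<Longrightarrow> w n \<le> w (Suc n)" "\<And>n. q n \<ge> 0" "M \<ge> 1"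
  shows "q 1 - w M * q (Suc M) \<le> (\<Sum>n=1..M. w n * (q n - q (Suc n)))"
  using assms(4)
proof (induction M rule: nat_induct_at_least)
  case base
  then show ?case using assms(1) by simp
next
  case (Suc M)
  have "w M * q (Suc M) \<le> w (Suc M) * q (Suc M)"
    using assms Suc by (intro mult_right_mono) auto
  then show ?case using Suc by (simp add: algebra_simps)
qed

text \<open>With \<open>S n\<close> the tail sum of the polynomial from index \<open>n\<close>, the
  \<open>n\<close>-th term of the majorant has real part \<open>w n\<close> times the drop of the
  squared modulus from \<open>S n\<close> to \<open>S (n + 1)\<close>, so summation by parts
  applies.\<close>

lemma dpoly_square_le_majorant:
  assumes s: "Re s \<ge> \<delta>"
  shows "(cmod (dpoly a N s))\<^sup>2 \<le> Re (majorant a \<delta> N s)"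
proof (cases "N = 0")
  case False
  define S where "S j = (\<Sum>m=j..N. dirichlet_term a s m)" for j
  define w where "w n = real n powr (2 * (Re s - \<delta>))" for n
  define q where "q n = (cmod (S n))\<^sup>2" for n
  have summand: "Re (cnj (a n) * of_nat n powr (s - of_real (2 * \<delta>)) *
     (dirichlet_term a s n + 2 * (\<Sum>m=Suc n..N. dirichlet_term a s m))) = w n * (q n - q (Suc n))"
    if n: "n \<in> {1..N}" for n
  proof -
    have 1: "cnj (a n) * of_nat n powr (s - of_real (2 * \<delta>)) = of_real (w n) * cnj (dirichlet_term a s n)"
    proof -
      have "of_real (w n) = exp (complex_of_real (2 * (Re s - \<delta>) * ln (real n)))"
        using n unfolding exp_of_real by (simp add: w_def powr_def)
      then have "of_real (w n) * cnj (of_nat n powr (- s)) = exp (of_real (2 * (Re s - \<delta>) * ln (real n)) + cnj (- s * of_real (ln (real n))))"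
        using n by (simp only: exp_add) (simp add: of_nat_powr_exp exp_cnj)
      also have "of_real (2 * (Re s - \<delta>) * ln (real n)) + cnj (- s * of_real (ln (real n))) = (s - of_real (2 * \<delta>)) * of_real (ln (real n))"
        by (simp add: complex_eq_iff algebra_simps)
      finally show ?thesis using n by (simp add: dirichlet_term_def of_nat_powr_exp)
    qed
    have S: "S n = dirichlet_term a s n + S (Suc n)"
      using n by (simp add: S_def sum.atLeast_Suc_atMost)
    have "Re (cnj u * (u + 2 * v)) = (cmod (u + v))\<^sup>2 - (cmod v)\<^sup>2" for u v
      unfolding cmod_power2 by (simp add: power2_eq_square algebra_simps)
    then have "Re (cnj (dirichlet_term a s n) * (dirichlet_term a s n + 2 * S (Suc n))) = q n - q (Suc n)"
      unfolding q_def S .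
    then show ?thesis unfolding 1 S_def[symmetric] mult.assoc by simp
  qed
  have "q 1 - w N * q (Suc N) \<le> (\<Sum>n=1..N. w n * (q n - q (Suc n)))"
    using s False by (intro abel_sum_ge) (auto simp: w_def q_def intro!: powr_mono2)
  moreover have "q (Suc N) = 0" by (simp add: q_def S_def)
  moreover have "Re (majorant a \<delta> N s) = (\<Sum>n=1..N. w n * (q n - q (Suc n)))"
    unfolding majorant_def Re_sum by (rule sum.cong) (use summand in auto)
  moreover have "dpoly a N s = S 1"
  proof -
    have "{..N} = insert 0 {1..N}" by auto
    then show ?thesis by (simp add: dpoly_def S_def)
  qed
  ultimately show ?thesis by (simp add: q_def)
qed (simp add: dpoly_def majorant_def)

text \<open>The diagonal terms of the majorant do not depend on \<open>s\<close>; an off-diagonal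
  one has modulus proportional to \<open>(n / m) powr Re s\<close> with
  \<open>n < m\<close>.\<close>

lemma majorant_limit:
  assumes \<delta>: "\<delta> \<ge> 0"
  obtains K where "K \<ge> 0" "\<And>s. Re s \<ge> 0 \<Longrightarrow>
    cmod (majorant a \<delta> N s - of_real (\<Sum>n\<le>N. (cmod (a n))\<^sup>2 * real n powr (-2 * \<delta>)))
      \<le> K * (real N / real (Suc N)) powr Re s"
proof -
  define q where "q = real N / real (Suc N)"
  define K where "K = (\<Sum>n=1..N. 2 * (\<Sum>m=Suc n..N. cmod (a n) * cmod (a m)))"
  have K: "K \<ge> 0" unfolding K_def by (intro sum_nonneg mult_nonneg_nonneg) auto
  show ?thesis
  proof (rule that[OF K])
    fix s :: complex assume s: "Re s \<ge> 0"
    let ?c = "\<lambda>n. cnj (a n) * of_nat n powr (s - of_real (2 * \<delta>))"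
    have diag: "?c n * dirichlet_term a s n = of_real ((cmod (a n))\<^sup>2 * real n powr (-2 * \<delta>))" if n: "n \<in> {1..N}" for n
    proof -
      have "of_nat n powr (s - of_real (2 * \<delta>)) * of_nat n powr (- s) = complex_of_real (real n powr (-2 * \<delta>))"
        using n by (simp add: powr_add[symmetric] powr_of_real[symmetric])
      then have "?c n * dirichlet_term a s n = (a n * cnj (a n)) * of_real (real n powr (-2 * \<delta>))"
        by (simp add: dirichlet_term_def mult_ac)
      then show ?thesis by (simp add: complex_norm_square[symmetric])
    qed
    have "{..N} = insert 0 {1..N}" by auto
    then have M: "of_real (\<Sum>n\<le>N. (cmod (a n))\<^sup>2 * real n powr (-2 * \<delta>)) = (\<Sum>n=1..N. ?c n * dirichlet_term a s n)"
      using diag by simp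
    have "majorant a \<delta> N s - of_real (\<Sum>n\<le>N. (cmod (a n))\<^sup>2 * real n powr (-2 * \<delta>))
      = (\<Sum>n=1..N. ?c n * (2 * (\<Sum>m=Suc n..N. dirichlet_term a s m)))"
      unfolding M majorant_def by (simp add: distrib_left sum.distrib del: of_real_mult of_real_sum)
    also have "cmod \<dots> \<le> (\<Sum>n=1..N. 2 * (\<Sum>m=Suc n..N. cmod (a n) * cmod (a m)) * q powr Re s)"
    proof (rule sum_norm_le)
      fix n assume n: "n \<in> {1..N}"
      have "cmod (?c n * (2 * (\<Sum>m=Suc n..N. dirichlet_term a s m)))
         = 2 * cmod (\<Sum>m=Suc n..N. ?c n * dirichlet_term a s m)"
        by (simp add: norm_mult sum_distrib_left[symmetric])
      also have "cmod (\<Sum>m=Suc n..N. ?c n * dirichlet_term a s m) \<le> (\<Sum>m=Suc n..N. cmod (a n) * cmod (a m) * q powr Re s)"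
      proof (rule sum_norm_le)
        fix m assume m: "m \<in> {Suc n..N}"
        have "real n powr (Re s - 2 * \<delta>) * real m powr (- Re s) = real n powr (-2 * \<delta>) * (real n / real m) powr Re s"
          using n m powr_divide[of "real n" "real m" "Re s"] by (simp add: powr_diff powr_minus divide_inverse)
        also have "\<dots> \<le> 1 * q powr Re s"
        proof (rule mult_mono)
          show "real n powr (-2 * \<delta>) \<le> 1" using n \<delta> powr_mono[of "-2 * \<delta>" 0 "real n"] by simp
          \<comment> \<open>Among \<open>n < m \<le> N\<close> the ratio \<open>n / m\<close> is at
            most \<open>(N - 1) / N\<close>, which is below \<open>N / (N + 1)\<close>.\<close>
          have "n * Suc N \<le> N * m" 
          proof -
            have "n * Suc N = n * N + n" by simp
            also have "\<dots> \<le> n * N + N" using n by simp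
            also have "\<dots> = N * Suc n" by simp
            also have "\<dots> \<le> N * m" using m by (intro mult_le_mono) auto
            finally show ?thesis .
          qed
          then have "real n * real (Suc N) \<le> real N * real m" by (metis of_nat_le_iff of_nat_mult)
          then have "real n / real m \<le> q" using n m by (simp add: q_def divide_simps)
          then show "(real n / real m) powr Re s \<le> q powr Re s" using s by (intro powr_mono2) auto
        qed auto
        finally have "cmod (a n) * cmod (a m) * (real n powr (Re s - 2 * \<delta>) * real m powr (- Re s)) \<le> cmod (a n) * cmod (a m) * q powr Re s"
          by (intro mult_left_mono) auto
        then show "cmod (?c n * dirichlet_term a s m) \<le> cmod (a n) * cmod (a m) * q powr Re s"
          by (simp add: norm_mult norm_dirichlet_term norm_of_nat_powr mult_ac)
      qed
      finally have "cmod (?c n * (2 * (\<Sum>m=Suc n..N. dirichlet_term a s m)))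
         \<le> 2 * (\<Sum>m=Suc n..N. cmod (a n) * cmod (a m) * q powr Re s)" by simp
      then show "cmod (?c n * (2 * (\<Sum>m=Suc n..N. dirichlet_term a s m))) \<le> 2 * (\<Sum>m=Suc n..N. cmod (a n) * cmod (a m)) * q powr Re s"
        by (simp add: sum_distrib_right mult.assoc)
    qed
    also have "\<dots> = K * q powr Re s" by (simp add: K_def sum_distrib_right)
    finally show "cmod (majorant a \<delta> N s - of_real (\<Sum>n\<le>N. (cmod (a n))\<^sup>2 * real n powr (-2 * \<delta>)))
      \<le> K * (real N / real (Suc N)) powr Re s" by (simp add: q_def)
  qed
qed

text \<open>By \<open>far\<close>, the majorant composed with \<Phi> tends to the squared norm
  uniformly along suitable vertical lines. \<open>has_mean_vertical\<close> carries this value back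
  to \<open>Re s = \<epsilon>\<close>.\<close>

lemma mean_square_dpoly_compose:
  assumes \<Phi>: "\<Phi> holomorphic_on half_plane 0" and \<epsilon>: "\<epsilon> > 0" and \<delta>: "\<delta> \<ge> 0"
    and near: "\<And>s. Re s \<ge> \<epsilon> \<Longrightarrow> Re (\<Phi> s) \<ge> \<delta>"
    and far: "\<And>K. \<exists>\<sigma>\<ge>\<epsilon>. \<forall>t. Re (\<Phi> (Complex \<sigma> t)) \<ge> K"
    and e: "e > 0"
  shows "\<forall>\<^sub>F T in at_top. integral {-T..T} (\<lambda>t. (cmod (dpoly a N (\<Phi> (Complex \<epsilon> t))))\<^sup>2)
     \<le> 2 * T * ((\<Sum>n\<le>N. (cmod (a n))\<^sup>2 * real n powr (-2 * \<delta>)) + e)"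
proof -
  define M where "M = (\<Sum>n\<le>N. (cmod (a n))\<^sup>2 * real n powr (-2 * \<delta>))"
  define q where "q = real N / real (Suc N)"
  have q: "0 \<le> q" "q < 1" by (auto simp: q_def)
  obtain K where K: "K \<ge> 0" "\<And>s. Re s \<ge> 0 \<Longrightarrow> cmod (majorant a \<delta> N s - of_real M) \<le> K * q powr Re s"
    by (rule majorant_limit[OF \<delta>, of a N]) (auto simp: M_def q_def)
  let ?F = "\<lambda>s. majorant a \<delta> N (\<Phi> s)"
  note sub = continuous_on_vertical[OF \<Phi> \<epsilon>]
  have m: "has_mean (\<lambda>t. ?F (Complex \<epsilon> t)) (of_real M)"
  proof (rule has_mean_vertical[of _ 0 \<epsilon>, OF _ \<epsilon>])
    have "(majorant a \<delta> N \<circ> \<Phi>) holomorphic_on half_plane 0"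
      by (rule holomorphic_on_compose[OF \<Phi> holomorphic_majorant])
    then show "?F holomorphic_on half_plane 0" by (simp add: o_def)
    show "cmod (?F s) \<le> K + \<bar>M\<bar>" if "Re s \<ge> \<epsilon>" for s
    proof -
      have r: "Re (\<Phi> s) \<ge> 0" using near[OF that] \<delta> by simp
      have "q powr Re (\<Phi> s) \<le> 1" using q r by (intro powr_le1) auto
      then have "K * q powr Re (\<Phi> s) \<le> K" using K(1) by (simp add: mult_left_le)
      then show ?thesis
        using K(2)[OF r] norm_triangle_ineq2[of "?F s" "of_real M"] by simp
    qed
    fix e :: real assume e: "e > 0"
    have "((\<lambda>x. K * q powr x) \<longlongrightarrow> K * 0) at_top"
    proof (intro tendsto_intros)
      show "((\<lambda>x. q powr x) \<longlongrightarrow> 0) at_top"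
      proof (cases "q = 0")
        case False
        then have "ln q < 0" using q by simp
        then have "filterlim (\<lambda>x. x * (- ln q)) at_top at_top"
          by (intro filterlim_at_top_mult_tendsto_pos[OF tendsto_const] filterlim_ident) auto
        then have "((\<lambda>x. exp (- (x * (- ln q)))) \<longlongrightarrow> 0) at_top"
          by (intro filterlim_compose[OF exp_at_bot] filterlim_compose[OF filterlim_uminus_at_bot_at_top])
        then show ?thesis using False by (simp add: powr_def)
      qed simp
    qed
    then have "\<forall>\<^sub>F x in at_top. K * q powr x < e"
      using e by (intro order_tendstoD(2)) auto
    then obtain X where X: "\<And>x. x \<ge> X \<Longrightarrow> K * q powr x < e" by (auto simp: eventually_at_top_linorder)
    obtain \<sigma> where \<sigma>: "\<sigma> \<ge> \<epsilon>" "\<And>t. Re (\<Phi> (Complex \<sigma> t)) \<ge> max 0 X" using far by blast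
    have "cmod (?F (Complex \<sigma> t) - of_real M) \<le> e" for t
      using K(2)[of "\<Phi> (Complex \<sigma> t)"] X[of "Re (\<Phi> (Complex \<sigma> t))"] \<sigma>(2)[of t] by auto
    with \<sigma> show "\<exists>\<sigma>\<ge>\<epsilon>. \<forall>t. cmod (?F (Complex \<sigma> t) - of_real M) \<le> e" by blast
  qed
  have "((\<lambda>T. Re (integral {-T..T} (\<lambda>t. ?F (Complex \<epsilon> t)) / of_real (2 * T))) \<longlongrightarrow> Re (of_real M)) at_top"
    using m unfolding has_mean_def by (intro tendsto_Re) auto
  then have "\<forall>\<^sub>F T in at_top. Re (integral {-T..T} (\<lambda>t. ?F (Complex \<epsilon> t)) / of_real (2 * T)) < M + e"
    by (rule order_tendstoD(2)) (use e in auto)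
  then show ?thesis using eventually_gt_at_top[of "0::real"]
  proof eventually_elim
    case (elim T)
    have i: "(\<lambda>t. ?F (Complex \<epsilon> t)) integrable_on {-T..T}" by (rule has_mean_integrable[OF m])
    have "integral {-T..T} (\<lambda>t. (cmod (dpoly a N (\<Phi> (Complex \<epsilon> t))))\<^sup>2) \<le> integral {-T..T} (\<lambda>t. Re (?F (Complex \<epsilon> t)))"
    proof (rule integral_le)
      show "(\<lambda>t. Re (?F (Complex \<epsilon> t))) integrable_on {-T..T}"
        using integrable_linear[OF i bounded_linear_Re] by (simp add: o_def)
      have "continuous_on UNIV (\<lambda>t. dpoly a N (\<Phi> (Complex \<epsilon> t)))"
        by (rule continuous_on_compose2[OF holomorphic_on_imp_continuous_on[OF holomorphic_dpoly] sub]) auto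
      then show "(\<lambda>t. (cmod (dpoly a N (\<Phi> (Complex \<epsilon> t))))\<^sup>2) integrable_on {-T..T}"
        by (intro integrable_continuous_real continuous_intros) (auto intro: continuous_on_subset)
      show "(cmod (dpoly a N (\<Phi> (Complex \<epsilon> t))))\<^sup>2 \<le> Re (?F (Complex \<epsilon> t))" for t
        by (rule dpoly_square_le_majorant[OF near]) simp
    qed
    also have "\<dots> = Re (integral {-T..T} (\<lambda>t. ?F (Complex \<epsilon> t)))"
      using integral_linear[OF i bounded_linear_Re] by (simp add: o_def)
    also have "\<dots> \<le> 2 * T * (M + e)"
      using elim unfolding Re_divide_of_real by (simp add: field_simps)
    finally show ?case by (simp add: M_def)
  qed
qed

section \<open>The space \<open>H_plus\<close>\<close>

lemma cauchy_schwarz_suminf: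
  fixes x y :: "nat \<Rightarrow> real"
  assumes x: "summable (\<lambda>n. (x n)\<^sup>2)" and y: "summable (\<lambda>n. (y n)\<^sup>2)"
  shows "summable (\<lambda>n. \<bar>x n * y n\<bar>)"
    and "(\<Sum>n. \<bar>x n * y n\<bar>) \<le> sqrt (\<Sum>n. (x n)\<^sup>2) * sqrt (\<Sum>n. (y n)\<^sup>2)"
proof -
  have le: "(\<Sum>n<N. \<bar>x n * y n\<bar>) \<le> sqrt (\<Sum>n. (x n)\<^sup>2) * sqrt (\<Sum>n. (y n)\<^sup>2)" for N
  proof -
    have "(\<Sum>n<N. \<bar>x n * y n\<bar>) \<le> L2_set x {..<N} * L2_set y {..<N}"
      unfolding abs_mult by (rule L2_set_mult_ineq)
    also have "\<dots> \<le> sqrt (\<Sum>n. (x n)\<^sup>2) * sqrt (\<Sum>n. (y n)\<^sup>2)"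
      unfolding L2_set_def using x y
      by (intro mult_mono real_sqrt_le_mono sum_le_suminf real_sqrt_ge_zero suminf_nonneg sum_nonneg) auto
    finally show ?thesis .
  qed
  then show s: "summable (\<lambda>n. \<bar>x n * y n\<bar>)" by (intro summableI_nonneg_bounded[OF _ le]) auto
  show "(\<Sum>n. \<bar>x n * y n\<bar>) \<le> sqrt (\<Sum>n. (x n)\<^sup>2) * sqrt (\<Sum>n. (y n)\<^sup>2)"
    by (rule suminf_le_const[OF s le])
qed

lemma minkowski_suminf:
  fixes x y :: "nat \<Rightarrow> real"
  assumes x: "summable (\<lambda>n. (x n)\<^sup>2)" and y: "summable (\<lambda>n. (y n)\<^sup>2)"
  shows "summable (\<lambda>n. (x n + y n)\<^sup>2)"
    and "sqrt (\<Sum>n. (x n + y n)\<^sup>2) \<le> sqrt (\<Sum>n. (x n)\<^sup>2) + sqrt (\<Sum>n. (y n)\<^sup>2)"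
proof -
  let ?R = "sqrt (\<Sum>n. (x n)\<^sup>2) + sqrt (\<Sum>n. (y n)\<^sup>2)"
  have R: "?R \<ge> 0" using x y by (intro add_nonneg_nonneg real_sqrt_ge_zero suminf_nonneg) auto
  have le: "(\<Sum>n<N. (x n + y n)\<^sup>2) \<le> ?R\<^sup>2" for N
  proof -
    have "L2_set (\<lambda>n. x n + y n) {..<N} \<le> L2_set x {..<N} + L2_set y {..<N}"
      by (rule L2_set_triangle_ineq)
    also have "\<dots> \<le> ?R"
      unfolding L2_set_def using x y by (intro add_mono real_sqrt_le_mono sum_le_suminf) auto
    finally have "sqrt (\<Sum>n<N. (x n + y n)\<^sup>2) \<le> ?R" by (simp add: L2_set_def)
    then show ?thesis by (rule sqrt_le_D)
  qed
  then show s: "summable (\<lambda>n. (x n + y n)\<^sup>2)" by (intro summableI_nonneg_bounded[OF _ le]) auto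
  show "sqrt (\<Sum>n. (x n + y n)\<^sup>2) \<le> ?R"
    by (rule real_le_lsqrt[OF R]) (rule suminf_le_const[OF s le])
qed

lemma H_term_eq: "H_term k a n = (cmod (a n) * real n powr (- 1 / real k))\<^sup>2"
proof -
  have "(real n powr (- 1 / real k))\<^sup>2 = real n powr (- 2 / real k)"
    by (simp add: power2_eq_square powr_add[symmetric])
  then show ?thesis by (simp add: H_term_def power_mult_distrib)
qed

lemma H_term_nonneg: "H_term k a n \<ge> 0"
  by (simp add: H_term_def)

lemma H_norm_nonneg: "a \<in> H_plus \<Longrightarrow> k \<ge> 1 \<Longrightarrow> H_norm k a \<ge> 0"
  by (auto simp: H_norm_def H_plus_def intro!: suminf_nonneg H_term_nonneg)

lemma H_norm_le:
  assumes "C \<ge> 0" "\<And>N. (\<Sum>n\<le>N. H_term k a n) \<le> C\<^sup>2"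
  shows "summable (H_term k a)" and "H_norm k a \<le> C"
proof -
  have le: "(\<Sum>n<N. H_term k a n) \<le> C\<^sup>2" for N
    using assms(2)[of N] H_term_nonneg[of k a N] by (simp add: lessThan_Suc_atMost[symmetric])
  then show s: "summable (H_term k a)" by (intro summableI_nonneg_bounded[OF _ le] H_term_nonneg)
  show "H_norm k a \<le> C"
    unfolding H_norm_def by (intro real_le_lsqrt assms(1) suminf_le_const[OF s le])
qed

lemma H_plus_summable: "a \<in> H_plus \<Longrightarrow> k \<ge> 1 \<Longrightarrow> summable (H_term k a)"
  by (auto simp: H_plus_def)

lemma H_term_add_le: "H_term k (\<lambda>n. a n + b n) n
   \<le> (cmod (a n) * real n powr (- 1 / real k) + cmod (b n) * real n powr (- 1 / real k))\<^sup>2"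
  unfolding H_term_eq distrib_right[symmetric]
  by (intro power_mono mult_right_mono norm_triangle_ineq) auto

lemma summable_H_term_add:
  assumes "summable (H_term k a)" "summable (H_term k b)"
  shows "summable (H_term k (\<lambda>n. a n + b n))"
    and "H_norm k (\<lambda>n. a n + b n) \<le> H_norm k a + H_norm k b"
proof -
  note M = minkowski_suminf[OF assms[unfolded H_term_eq[abs_def]]]
  show s: "summable (H_term k (\<lambda>n. a n + b n))"
    by (rule summable_comparison_test'[OF M(1), of 0]) (use H_term_add_le H_term_nonneg in auto)
  have "H_norm k (\<lambda>n. a n + b n) \<le> sqrt (\<Sum>n. (cmod (a n) * real n powr (- 1 / real k) + cmod (b n) * real n powr (- 1 / real k))\<^sup>2)"
    unfolding H_norm_def by (intro real_sqrt_le_mono suminf_le H_term_add_le s M(1))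
  also have "\<dots> \<le> H_norm k a + H_norm k b" using M(2) by (simp add: H_norm_def H_term_eq[abs_def])
  finally show "H_norm k (\<lambda>n. a n + b n) \<le> H_norm k a + H_norm k b" .
qed

lemma H_term_scale: "H_term k (\<lambda>n. z * a n) = (\<lambda>n. (cmod z)\<^sup>2 * H_term k a n)"
  by (auto simp: H_term_def norm_mult power_mult_distrib)

lemma H_norm_scale:
  assumes "summable (H_term k a)"
  shows "H_norm k (\<lambda>n. z * a n) = cmod z * H_norm k a"
  unfolding H_norm_def H_term_scale by (simp add: suminf_mult[OF assms] real_sqrt_mult)

lemma H_plus_add: "a \<in> H_plus \<Longrightarrow> b \<in> H_plus \<Longrightarrow> (\<lambda>n. a n + b n) \<in> H_plus"
  by (auto simp: H_plus_def summable_H_term_add)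

lemma H_plus_scale: "a \<in> H_plus \<Longrightarrow> (\<lambda>n. z * a n) \<in> H_plus"
  by (auto simp: H_plus_def H_term_scale intro: summable_mult)

lemma H_plus_diff:
  assumes "a \<in> H_plus" "b \<in> H_plus"
  shows "(\<lambda>n. a n - b n) \<in> H_plus"
  using H_plus_add[OF assms(1) H_plus_scale[OF assms(2), of "-1"]] by simp

lemma H_norm_zero: "H_norm k (\<lambda>_. 0) = 0"
  by (simp add: H_norm_def H_term_def)

lemma H_plus_finite_support:
  assumes "a 0 = 0" "finite {n. a n \<noteq> 0}"
  shows "a \<in> H_plus"
proof -
  have "summable (H_term k a)" for k
    by (rule summable_finite[OF assms(2)]) (simp add: H_term_def)
  then show ?thesis using assms(1) by (simp add: H_plus_def)
qed

lemma H_plus_zero: "(\<lambda>_. 0) \<in> H_plus"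
  by (rule H_plus_finite_support) auto

lemma H_norm_mono:
  assumes a: "a \<in> H_plus" and k: "1 \<le> k" "k \<le> k'"
  shows "H_norm k a \<le> H_norm k' a"
  unfolding H_norm_def
proof (intro real_sqrt_le_mono suminf_le)
  fix n
  show "H_term k a n \<le> H_term k' a n"
  proof (cases "n = 0")
    case False
    have "- 2 / real k \<le> - 2 / real k'" using k by (simp add: field_simps)
    then show ?thesis unfolding H_term_def using False by (intro mult_left_mono powr_mono) auto
  qed (simp add: H_term_def)
qed (use a k in \<open>auto simp: H_plus_def\<close>)

lemma H_norm_triangle:
  assumes "a \<in> H_plus" "b \<in> H_plus" "c \<in> H_plus" "k \<ge> 1"
  shows "H_norm k (\<lambda>n. a n - c n) \<le> H_norm k (\<lambda>n. a n - b n) + H_norm k (\<lambda>n. b n - c n)"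
  using summable_H_term_add(2)[of k "\<lambda>n. a n - b n" "\<lambda>n. b n - c n"] H_plus_diff assms
  by (simp add: H_plus_summable)

section \<open>Neighbourhoods and continuity in \<open>H_plus\<close>\<close>

lemma topspace_H_plus: "topspace H_plus_topology = H_plus"
proof -
  let ?S = "{{b \<in> H_plus. H_norm k (\<lambda>n. b n - a n) < r} | k a r. k \<ge> 1 \<and> a \<in> H_plus \<and> r > 0}"
  have 1: "a \<in> \<Union>?S" if a: "a \<in> H_plus" for a
  proof (rule UnionI)
    show "{b \<in> H_plus. H_norm 1 (\<lambda>n. b n - a n) < 1} \<in> ?S"
      using a by (intro CollectI exI[of _ 1] exI[of _ a] conjI refl) auto
    show "a \<in> {b \<in> H_plus. H_norm 1 (\<lambda>n. b n - a n) < 1}" using a by (simp add: H_norm_zero)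
  qed
  have 2: "\<Union>?S \<subseteq> H_plus" by (rule Union_least) blast
  show ?thesis
    unfolding H_plus_topology_def topology_generated_by_topspace by (rule equalityI[OF 2 subsetI[OF 1]])
qed

lemma H_plus_ball_open:
  "a \<in> H_plus \<Longrightarrow> k \<ge> 1 \<Longrightarrow> r > 0 \<Longrightarrow> openin H_plus_topology {b \<in> H_plus. H_norm k (\<lambda>n. b n - a n) < r}"
  unfolding H_plus_topology_def by (rule topology_generated_by_Basis) blast

text \<open>The seminorms increase with \<open>k\<close>, so an intersection of two balls around
  \<open>x\<close> contains a ball around \<open>x\<close>, and a single ball suffices as basic
  neighbourhood.\<close>

lemma H_plus_nbhd:
  assumes "openin H_plus_topology U" "x \<in> U"
  shows "\<exists>k\<ge>1. \<exists>r>0. {b \<in> H_plus. H_norm k (\<lambda>n. b n - x n) < r} \<subseteq> U"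
proof -
  let ?B = "\<lambda>k r. {b \<in> H_plus. H_norm k (\<lambda>n. b n - x n) < r}"
  have xH: "x \<in> H_plus" using openin_subset[OF assms(1)] assms(2) by (auto simp: topspace_H_plus)
  have mono: "?B (max k k') (min r r') \<subseteq> ?B k r \<inter> ?B k' r'" if "k \<ge> 1" "k' \<ge> 1" for k k' r r'
  proof
    fix b assume b: "b \<in> ?B (max k k') (min r r')"
    then have "(\<lambda>n. b n - x n) \<in> H_plus" using xH by (auto intro: H_plus_diff)
    from H_norm_mono[OF this that(1), of "max k k'"] H_norm_mono[OF this that(2), of "max k k'"] b
    show "b \<in> ?B k r \<inter> ?B k' r'" by auto
  qed
  have "generate_topology_on {{b \<in> H_plus. H_norm k (\<lambda>n. b n - a n) < r} | k a r. k \<ge> 1 \<and> a \<in> H_plus \<and> r > 0} U"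
    using assms(1) unfolding H_plus_topology_def by (rule openin_topology_generated_by)
  then show ?thesis using assms(2)
  proof (induction U rule: generate_topology_on.induct)
    case (Int a b)
    obtain k r where k: "k \<ge> 1" "r > 0" "?B k r \<subseteq> a" using Int.IH(1) Int.prems by blast
    obtain k' r' where k': "k' \<ge> 1" "r' > 0" "?B k' r' \<subseteq> b" using Int.IH(2) Int.prems by blast
    have "?B (max k k') (min r r') \<subseteq> a \<inter> b" using mono[OF k(1) k'(1), of r r'] k(3) k'(3) by blast
    moreover have "max k k' \<ge> 1" "min r r' > 0" using k k' by auto
    ultimately show ?case by blast
  next
    case (UN K)
    then obtain U where "U \<in> K" "x \<in> U" by blast
    then obtain k r where "k \<ge> 1" "r > 0" "?B k r \<subseteq> U" using UN.IH by blast
    then show ?case using \<open>U \<in> K\<close> by blast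
  next
    case (Basis s)
    then obtain k a r where s: "s = {b \<in> H_plus. H_norm k (\<lambda>n. b n - a n) < r}" "k \<ge> 1" "a \<in> H_plus" "r > 0"
      by auto
    have "?B k (r - H_norm k (\<lambda>n. x n - a n)) \<subseteq> s"
    proof
      fix y assume "y \<in> ?B k (r - H_norm k (\<lambda>n. x n - a n))"
      then have y: "y \<in> H_plus" "H_norm k (\<lambda>n. y n - x n) < r - H_norm k (\<lambda>n. x n - a n)" by auto
      then show "y \<in> s" using H_norm_triangle[OF y(1) xH s(3,2)] s(1) by auto
    qed
    moreover have "r - H_norm k (\<lambda>n. x n - a n) > 0" using Basis(2) s(1) by auto
    ultimately show ?case using s(2) by blast
  qed auto
qed

lemma H_plus_continuousI:
  assumes T: "\<And>a. a \<in> H_plus \<Longrightarrow> T a \<in> H_plus"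
    and bd: "\<And>k. k \<ge> 1 \<Longrightarrow> \<exists>k'\<ge>1. \<exists>C\<ge>0. \<forall>a\<in>H_plus. \<forall>a'\<in>H_plus.
       H_norm k (\<lambda>n. T a n - T a' n) \<le> C * H_norm k' (\<lambda>n. a n - a' n)"
  shows "continuous_map H_plus_topology H_plus_topology T"
proof (subst (2) H_plus_topology_def, rule continuous_on_generated_topo)
  fix U assume "U \<in> {{b \<in> H_plus. H_norm k (\<lambda>n. b n - a n) < r} | k a r. k \<ge> 1 \<and> a \<in> H_plus \<and> r > 0}"
  then obtain k a r where U: "U = {b \<in> H_plus. H_norm k (\<lambda>n. b n - a n) < r}" "k \<ge> 1" "a \<in> H_plus" "r > 0"
    by auto
  obtain k' C where k': "k' \<ge> 1" "C \<ge> 0" and C: "\<And>a a'. a \<in> H_plus \<Longrightarrow> a' \<in> H_plus \<Longrightarrow>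
       H_norm k (\<lambda>n. T a n - T a' n) \<le> C * H_norm k' (\<lambda>n. a n - a' n)"
    using bd[OF U(2)] by blast
  show "openin H_plus_topology (T -` U \<inter> topspace H_plus_topology)"
  proof (subst openin_subopen, intro ballI)
    fix x assume "x \<in> T -` U \<inter> topspace H_plus_topology"
    then have x: "x \<in> H_plus" "H_norm k (\<lambda>n. T x n - a n) < r" by (auto simp: U topspace_H_plus)
    define s where "s = (r - H_norm k (\<lambda>n. T x n - a n)) / (C + 1)"
    have s: "s > 0" using x(2) k'(2) by (auto simp: s_def)
    have "{b \<in> H_plus. H_norm k' (\<lambda>n. b n - x n) < s} \<subseteq> T -` U \<inter> topspace H_plus_topology"
    proof
      fix b assume "b \<in> {b \<in> H_plus. H_norm k' (\<lambda>n. b n - x n) < s}"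
      then have b: "b \<in> H_plus" "H_norm k' (\<lambda>n. b n - x n) < s" by auto
      have "H_norm k (\<lambda>n. T b n - T x n) \<le> C * H_norm k' (\<lambda>n. b n - x n)" by (rule C[OF b(1) x(1)])
      also have "\<dots> \<le> C * s" using b k' by (intro mult_left_mono) auto
      also have "\<dots> < (C + 1) * s" using s by (simp add: distrib_right)
      also have "\<dots> = r - H_norm k (\<lambda>n. T x n - a n)" using k' by (simp add: s_def)
      finally have "H_norm k (\<lambda>n. T b n - a n) < r"
        using H_norm_triangle[OF T[OF b(1)] T[OF x(1)] U(3) U(2)] by linarith
      then show "b \<in> T -` U \<inter> topspace H_plus_topology" using b T by (auto simp: U topspace_H_plus)
    qed
    moreover have "x \<in> {b \<in> H_plus. H_norm k' (\<lambda>n. b n - x n) < s}" using x s by (simp add: H_norm_zero)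
    ultimately show "\<exists>V. openin H_plus_topology V \<and> x \<in> V \<and> V \<subseteq> T -` U \<inter> topspace H_plus_topology"
      using H_plus_ball_open[OF x(1) k'(1) s] by blast
  qed
next
  show "T ` topspace H_plus_topology \<subseteq> \<Union> {{b \<in> H_plus. H_norm k (\<lambda>n. b n - a n) < r} | k a r. k \<ge> 1 \<and> a \<in> H_plus \<and> r > 0}"
    using T topspace_H_plus unfolding H_plus_topology_def topology_generated_by_topspace by auto
qed

lemma H_plus_continuous_bound:
  assumes T: "\<And>a. a \<in> H_plus \<Longrightarrow> T a \<in> H_plus"
    and hom: "\<And>z a. a \<in> H_plus \<Longrightarrow> T (\<lambda>n. z * a n) = (\<lambda>n. z * T a n)"
    and cont: "continuous_map H_plus_topology H_plus_topology T" and k: "k \<ge> 1"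
  shows "\<exists>k'\<ge>1. \<exists>C>0. \<forall>a\<in>H_plus. H_norm k (T a) \<le> C * H_norm k' a"
proof -
  have T0: "T (\<lambda>_. 0) = (\<lambda>_. 0)" using hom[OF H_plus_zero, of 0] by simp
  let ?U = "{b \<in> H_plus. H_norm k (\<lambda>n. b n - 0) < 1}"
  have "openin H_plus_topology {x \<in> topspace H_plus_topology. T x \<in> ?U}"
    by (rule openin_continuous_map_preimage[OF cont H_plus_ball_open[OF H_plus_zero k]]) simp
  moreover have "(\<lambda>_. 0) \<in> {x \<in> topspace H_plus_topology. T x \<in> ?U}"
    by (simp add: topspace_H_plus H_plus_zero T0 H_norm_zero)
  ultimately obtain k' r where k': "k' \<ge> 1" "r > 0"
    "{b \<in> H_plus. H_norm k' (\<lambda>n. b n - 0) < r} \<subseteq> {x \<in> topspace H_plus_topology. T x \<in> ?U}"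
    using H_plus_nbhd by blast
  have small: "H_norm k (T a) < 1" if "a \<in> H_plus" "H_norm k' a < r" for a
    using k'(3) that by auto
  have scaled: "t * H_norm k (T a) < 1" if a: "a \<in> H_plus" and t: "t > 0" "t * H_norm k' a < r" for a t
  proof -
    have "H_norm k (T (\<lambda>n. of_real t * a n)) < 1"
      using a t k' k by (intro small H_plus_scale) (auto simp: H_norm_scale H_plus_summable)
    then show ?thesis using t a T k by (simp add: hom H_norm_scale H_plus_summable)
  qed
  \<comment> \<open>The multiple of \<open>a\<close> with seminorm \<open>r / 2\<close> lies in the
    ball, whence the constant \<open>2 / r\<close>. If the seminorm of \<open>a\<close> is 0, every
    multiple lies in the ball and \<open>T a\<close> must have seminorm 0.\<close>
  have "H_norm k (T a) \<le> (2 / r) * H_norm k' a" if a: "a \<in> H_plus" for a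
  proof (cases "H_norm k' a = 0")
    case True
    have "H_norm k (T a) \<le> 0"
    proof (rule ccontr)
      assume "\<not> ?thesis"
      then show False using scaled[OF a, of "1 / H_norm k (T a)"] True k' by simp
    qed
    then show ?thesis using True by simp
  next
    case False
    then have p: "H_norm k' a > 0" using H_norm_nonneg[OF a k'(1)] by simp
    then have "r / (2 * H_norm k' a) * H_norm k (T a) < 1"
      using k' by (intro scaled[OF a]) auto
    then show ?thesis using p k' by (simp add: field_simps)
  qed
  then show ?thesis using k' by (intro exI[of _ k'] conjI exI[of _ "2 / r"]) auto
qed

text \<open>Cauchy-Schwarz after inserting \<open>n powr (- 1 / k) * n powr (1 / k)\<close>. Summed
  over all \<open>n\<close> it gives convergence beyond 1/2, over smooth \<open>n\<close> beyond
  0.\<close>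

lemma H_plus_weighted:
  assumes a: "a \<in> H_plus" and k: "k \<ge> 1" and y: "summable (\<lambda>n. (y n * real n powr (1 / real k))\<^sup>2)"
  shows "summable (\<lambda>n. cmod (a n) * \<bar>y n\<bar>)"
    and "(\<Sum>n. cmod (a n) * \<bar>y n\<bar>) \<le> H_norm k a * sqrt (\<Sum>n. (y n * real n powr (1 / real k))\<^sup>2)"
proof -
  have x: "summable (\<lambda>n. (cmod (a n) * real n powr (- 1 / real k))\<^sup>2)"
    using H_plus_summable[OF a k] by (simp add: H_term_eq[abs_def])
  have "\<bar>(cmod (a n) * real n powr (- 1 / real k)) * (y n * real n powr (1 / real k))\<bar> = cmod (a n) * \<bar>y n\<bar>" for n
  proof (cases "n = 0")
    case False
    then have "real n powr (- 1 / real k) * real n powr (1 / real k) = 1"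
      by (simp add: powr_add[symmetric])
    then show ?thesis by (simp add: abs_mult mult_ac)
  qed (use a in \<open>simp add: H_plus_def\<close>)
  with cauchy_schwarz_suminf[OF x y] show "summable (\<lambda>n. cmod (a n) * \<bar>y n\<bar>)"
    "(\<Sum>n. cmod (a n) * \<bar>y n\<bar>) \<le> H_norm k a * sqrt (\<Sum>n. (y n * real n powr (1 / real k))\<^sup>2)"
    by (simp_all add: H_norm_def H_term_eq[abs_def])
qed

section \<open>Smooth integers\<close>

definition smooth :: "nat \<Rightarrow> nat set" where
  "smooth d = {n. n \<ge> 1 \<and> (\<forall>p. prime p \<longrightarrow> p dvd n \<longrightarrow> p \<le> d)}"

lemma smooth_mult: "m * n \<in> smooth d \<longleftrightarrow> m \<in> smooth d \<and> n \<in> smooth d"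
  by (auto simp: smooth_def prime_dvd_mult_iff)

lemma smooth_one: "1 \<in> smooth d"
  by (auto simp: smooth_def)

lemma smooth_power: "n \<in> smooth d \<Longrightarrow> n ^ j \<in> smooth d"
  by (induction j) (use smooth_one in \<open>auto simp: smooth_mult\<close>)

lemma smooth_le: "1 \<le> n \<Longrightarrow> n \<le> d \<Longrightarrow> n \<in> smooth d"
  by (auto simp: smooth_def dest: dvd_imp_le)

lemma smooth_Suc:
  assumes "n \<in> smooth (Suc d)"
  shows "\<exists>e m. n = Suc d ^ e * m \<and> m \<in> smooth d \<and> (prime (Suc d) \<or> e = 0)"
proof (cases "prime (Suc d)")
  case True
  have n0: "n \<noteq> 0" using assms by (auto simp: smooth_def)
  obtain m where m: "n = Suc d ^ multiplicity (Suc d) n * m" "\<not> Suc d dvd m"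
    using multiplicity_decompose'[OF n0, of "Suc d"] True not_prime_unit by (metis)
  have "m \<in> smooth (Suc d)" using assms m(1) smooth_mult by metis
  then have "m \<in> smooth d" using m(2) by (auto simp: smooth_def le_Suc_eq)
  then show ?thesis using m(1) True by blast
next
  case False
  then have "n \<in> smooth d" using assms by (auto simp: smooth_def le_Suc_eq)
  then show ?thesis by (intro exI[of _ 0] exI[of _ n]) auto
qed

text \<open>The finite Euler product, one factor at a time: a smooth integer for
  \<open>Suc d\<close> is a power of \<open>Suc d\<close> times a smooth integer for
  \<open>d\<close>.\<close>

lemma smooth_partial_sums_bounded:
  assumes \<alpha>: "\<alpha> > 0"
  shows "\<exists>K. \<forall>F. finite F \<longrightarrow> F \<subseteq> smooth d \<longrightarrow> (\<Sum>n\<in>F. real n powr (-\<alpha>)) \<le> K"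
proof (induction d)
  case 0
  have "n = 1" if "n \<in> smooth 0" for n
    using that prime_factor_nat[of n] by (auto simp: smooth_def)
  then have "F \<subseteq> {1}" if "F \<subseteq> smooth 0" for F using that by blast
  then have "(\<Sum>n\<in>F. real n powr (-\<alpha>)) \<le> (\<Sum>n\<in>{1}. real n powr (-\<alpha>))" if "F \<subseteq> smooth 0" for F
    using that by (intro sum_mono2) auto
  then show ?case by blast
next
  case (Suc d)
  then obtain K where K: "\<And>F. finite F \<Longrightarrow> F \<subseteq> smooth d \<Longrightarrow> (\<Sum>n\<in>F. real n powr (-\<alpha>)) \<le> K" by blast
  define p where "p = Suc d"
  have K0: "K \<ge> 0" using K[of "{}"] by simp
  define q where "q = real p powr (-\<alpha>)"
  have q0: "q \<ge> 0" by (simp add: q_def)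
  \<comment> \<open>If \<open>p\<close> is composite, \<open>smooth_Suc\<close> provides the
    exponent 0 only, and the Euler factor is 1.\<close>
  define E where "E = (if prime p then 1 / (1 - q) else 1)"
  have geo: "(\<Sum>e\<in>J. q ^ e) \<le> E" if J: "finite J" "prime p \<or> J \<subseteq> {0}" for J
  proof (cases "prime p")
    case True
    then have "real p > 1" using prime_gt_1_nat by auto
    then have "q < 1" using \<alpha> powr_less_mono[of "-\<alpha>" 0 "real p"] by (simp add: q_def)
    then have "(\<Sum>e\<in>J. q ^ e) \<le> (\<Sum>e. q ^ e)"
      using q0 J by (intro sum_le_suminf summable_geometric) auto
    also have "\<dots> = 1 / (1 - q)" using \<open>q < 1\<close> q0 by (intro suminf_geometric) auto
    finally show ?thesis using True by (simp add: E_def)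
  next
    case False
    then have "(\<Sum>e\<in>J. q ^ e) \<le> (\<Sum>e\<in>{0}. q ^ e)" using J q0 by (intro sum_mono2) auto
    then show ?thesis using False by (simp add: E_def)
  qed
  have "(\<Sum>n\<in>F. real n powr (-\<alpha>)) \<le> E * K" if F: "finite F" "F \<subseteq> smooth (Suc d)" for F
  proof -
    have "\<forall>n\<in>F. \<exists>x. n = p ^ fst x * snd x \<and> snd x \<in> smooth d \<and> (prime p \<or> fst x = 0)"
    proof
      fix n assume "n \<in> F"
      then obtain e m where "n = p ^ e * m" "m \<in> smooth d" "prime p \<or> e = 0"
        using smooth_Suc[of n d] F by (auto simp: p_def)
      then show "\<exists>x. n = p ^ fst x * snd x \<and> snd x \<in> smooth d \<and> (prime p \<or> fst x = 0)"
        by (intro exI[of _ "(e, m)"]) auto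
    qed
    then obtain g where g: "\<And>n. n \<in> F \<Longrightarrow> n = p ^ fst (g n) * snd (g n) \<and> snd (g n) \<in> smooth d \<and> (prime p \<or> fst (g n) = 0)"
      by metis
    let ?J = "fst ` g ` F" and ?M = "snd ` g ` F"
    let ?h = "\<lambda>x. p ^ fst x * snd x"
    \<comment> \<open>Covering \<open>F\<close> by the image of a product set lets the sum be
      bounded by a product of two sums.\<close>
    have sub: "F \<subseteq> ?h ` (?J \<times> ?M)"
    proof
      fix n assume n: "n \<in> F"
      then have "(fst (g n), snd (g n)) \<in> ?J \<times> ?M" by (intro SigmaI imageI)
      moreover have "n = ?h (fst (g n), snd (g n))" using g[OF n] by simp
      ultimately show "n \<in> ?h ` (?J \<times> ?M)" by blast
    qed
    have fin: "finite (?J \<times> ?M)" using F by auto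
    have "(\<Sum>n\<in>F. real n powr (-\<alpha>)) \<le> (\<Sum>n\<in>?h ` (?J \<times> ?M). real n powr (-\<alpha>))"
      by (rule sum_mono2) (use fin sub in auto)
    also have "\<dots> \<le> (\<Sum>x\<in>?J \<times> ?M. real (?h x) powr (-\<alpha>))"
      using sum_image_le[OF fin, of "\<lambda>n. real n powr (-\<alpha>)" ?h] by (simp add: o_def)
    also have "\<dots> = (\<Sum>x\<in>?J \<times> ?M. q ^ fst x * real (snd x) powr (-\<alpha>))"
    proof (rule sum.cong)
      fix x
      have "real (p ^ e) powr (-\<alpha>) = q ^ e" for e
        by (simp add: q_def p_def powr_realpow[symmetric] powr_powr mult.commute)
      then show "real (?h x) powr (-\<alpha>) = q ^ fst x * real (snd x) powr (-\<alpha>)"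
        by (simp add: powr_mult)
    qed simp
    also have "\<dots> = (\<Sum>e\<in>?J. q ^ e) * (\<Sum>m\<in>?M. real m powr (-\<alpha>))"
      by (simp add: sum_product sum.cartesian_product case_prod_unfold)
    also have "\<dots> \<le> E * K"
    proof (rule mult_mono)
      show "(\<Sum>e\<in>?J. q ^ e) \<le> E" using F g by (intro geo) auto
      show "(\<Sum>m\<in>?M. real m powr (-\<alpha>)) \<le> K" using F g by (intro K) auto
      show "0 \<le> E" using geo[of "{}"] by simp
    qed (simp add: sum_nonneg)
    finally show ?thesis .
  qed
  then show ?case by blast
qed

lemma summable_smooth:
  assumes "\<alpha> > 0"
  shows "summable (\<lambda>n. if n \<in> smooth d then real n powr (-\<alpha>) else 0)"
proof -
  obtain K where K: "\<And>F. finite F \<Longrightarrow> F \<subseteq> smooth d \<Longrightarrow> (\<Sum>n\<in>F. real n powr (-\<alpha>)) \<le> K"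
    using smooth_partial_sums_bounded[OF assms] by blast
  have "(\<Sum>n<N. if n \<in> smooth d then real n powr (-\<alpha>) else 0) \<le> K" for N
  proof -
    have "(\<Sum>n<N. if n \<in> smooth d then real n powr (-\<alpha>) else 0) = (\<Sum>n\<in>{..<N} \<inter> smooth d. real n powr (-\<alpha>))"
      by (rule sum.inter_restrict[symmetric]) simp
    also have "\<dots> \<le> K" by (rule K) auto
    finally show ?thesis .
  qed
  then show ?thesis by (intro summableI_nonneg_bounded[of _ K]) auto
qed

section \<open>The characters \<open>n powr -s\<close> and their smooth parts\<close>

definition nat_char :: "complex \<Rightarrow> nat \<Rightarrow> complex" where
  "nat_char s n = of_nat n powr (- s)"

text \<open>Still completely multiplicative, because a product is smooth exactly when both factors
  are.\<close>

definition smooth_char :: "nat \<Rightarrow> complex \<Rightarrow> nat \<Rightarrow> complex" where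
  "smooth_char p s n = (if n \<in> smooth p then nat_char s n else 0)"

lemma nat_char_exp: "n \<ge> 1 \<Longrightarrow> nat_char s n = exp (- of_real (ln (real n)) * s)"
  by (simp add: nat_char_def of_nat_powr_exp mult.commute)

lemma nat_char_0 [simp]: "nat_char s 0 = 0"
  by (simp add: nat_char_def)

lemma norm_nat_char: "cmod (nat_char s n) = real n powr (- Re s)"
  by (simp add: nat_char_def norm_of_nat_powr)

lemma nat_char_mult: "nat_char s (m * n) = nat_char s m * nat_char s n"
proof (cases "m = 0 \<or> n = 0")
  case False
  then have "m \<ge> 1" "n \<ge> 1" "m * n \<ge> 1" by auto
  then show ?thesis using False
    by (simp only: nat_char_exp) (simp add: ln_mult exp_add[symmetric] algebra_simps)
qed auto

lemma nat_char_1 [simp]: "nat_char s 1 = 1"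
  by (simp add: nat_char_def)

lemma mulchar_nat_char: "Re s \<ge> \<sigma> \<Longrightarrow> mulchar \<sigma> (nat_char s)"
  unfolding mulchar_def norm_nat_char
proof (intro conjI allI)
  fix n show "real n powr (- Re s) \<le> real n powr (-\<sigma>)" if "Re s \<ge> \<sigma>"
    using that by (cases "n = 0") (auto intro: powr_mono)
qed (simp_all only: nat_char_mult nat_char_1)

lemma mulchar_smooth_char: "Re s \<ge> \<sigma> \<Longrightarrow> mulchar \<sigma> (smooth_char p s)"
  using mulchar_nat_char[of \<sigma> s] smooth_one[of p] unfolding mulchar_def smooth_char_def
  by (auto simp: smooth_mult)

lemma dirichlet_term_nat_char: "dirichlet_term c s n = c n * nat_char s n"
  by (simp add: dirichlet_term_def nat_char_def)

lemma dirichlet_sum_deval: "dirichlet_sum c s = deval c (nat_char s)"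
  by (simp add: dirichlet_sum_def deval_def dirichlet_term_nat_char)

lemma deval_smooth_char: "deval c (smooth_char p s) = dirichlet_sum (\<lambda>n. if n \<in> smooth p then c n else 0) s"
  unfolding dirichlet_sum_deval deval_def smooth_char_def by (intro arg_cong[of _ _ suminf] ext) auto

section \<open>Absolute convergence and uniqueness of coefficients\<close>

lemma summable_weight_mono:
  assumes "summable (\<lambda>n. cmod (c n) * real n powr (-\<sigma>))" "\<sigma> \<le> \<sigma>'"
  shows "summable (\<lambda>n. cmod (c n) * real n powr (-\<sigma>'))"
proof (rule summable_comparison_test'[OF assms(1), of 0])
  fix n show "norm (cmod (c n) * real n powr (-\<sigma>')) \<le> cmod (c n) * real n powr (-\<sigma>)"
    using assms(2) by (cases "n = 0") (auto intro!: mult_left_mono powr_mono)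
qed

lemma summable_dirichlet_term:
  assumes "summable (\<lambda>n. cmod (c n) * real n powr (-\<sigma>))" "Re s \<ge> \<sigma>"
  shows "summable (dirichlet_term c s)"
  by (rule summable_norm_cancel) (use summable_weight_mono[OF assms] in \<open>simp add: norm_dirichlet_term\<close>)

lemma holomorphic_dirichlet_sum:
  assumes c: "summable (\<lambda>n. cmod (c n) * real n powr (-\<sigma>))"
  shows "dirichlet_sum c holomorphic_on half_plane \<sigma>"
proof (rule holomorphic_uniform_sequence[OF open_half_plane])
  show "(\<lambda>s. \<Sum>n<N. dirichlet_term c s n) holomorphic_on half_plane \<sigma>" for N
    by (intro holomorphic_on_sum holomorphic_dirichlet_term)
  have u: "uniform_limit (half_plane \<sigma>) (\<lambda>N s. \<Sum>n<N. dirichlet_term c s n) (\<lambda>s. \<Sum>n. dirichlet_term c s n) sequentially"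
  proof (rule Weierstrass_m_test[OF _ c])
    fix n s assume s: "s \<in> half_plane \<sigma>"
    show "cmod (dirichlet_term c s n) \<le> cmod (c n) * real n powr (-\<sigma>)"
      unfolding norm_dirichlet_term using s by (cases "n = 0") (auto intro!: mult_left_mono powr_mono)
  qed
  fix x assume "x \<in> half_plane \<sigma>"
  then obtain d where "d > 0" "cball x d \<subseteq> half_plane \<sigma>"
    using open_half_plane open_contains_cball by blast
  then show "\<exists>d>0. cball x d \<subseteq> half_plane \<sigma> \<and>
     uniform_limit (cball x d) (\<lambda>N s. \<Sum>n<N. dirichlet_term c s n) (dirichlet_sum c) sequentially"
    using uniform_limit_on_subset[OF u] by (auto simp: dirichlet_sum_def[abs_def])
qed

text \<open>Bessel's inequality for \<open>F = 0\<close>, applied to the difference of the two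
  series.\<close>

lemma dirichlet_coeffs_unique:
  assumes c: "summable (\<lambda>n. cmod (c n) * real n powr (-\<sigma>))" and c': "summable (\<lambda>n. cmod (c' n) * real n powr (-\<sigma>))"
    and zero: "c 0 = c' 0" and eq: "\<And>s. Re s > \<nu> \<Longrightarrow> dirichlet_sum c s = dirichlet_sum c' s"
  shows "c = c'"
proof
  fix n
  let ?c = "\<lambda>n. c n - c' n"
  have s: "summable (\<lambda>n. cmod (?c n) * real n powr (-\<sigma>))"
  proof (rule summable_comparison_test'[OF summable_add[OF c c'], of 0])
    fix n show "norm (cmod (?c n) * real n powr (-\<sigma>)) \<le> cmod (c n) * real n powr (-\<sigma>) + cmod (c' n) * real n powr (-\<sigma>)"
      unfolding distrib_right[symmetric] by (simp add: mult_right_mono norm_triangle_ineq4)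
  qed
  have "(\<Sum>m\<le>n. (cmod (?c m))\<^sup>2 * real m powr (-2 * 1)) \<le> 0"
  proof (rule dirichlet_bessel[where F = "\<lambda>_. 0" and \<rho> = 0 and B = 0 and \<sigma> = "max \<sigma> \<nu>"])
    show "summable (\<lambda>n. cmod (?c n) * real n powr (- max \<sigma> \<nu>))"
      by (rule summable_weight_mono[OF s]) simp
    fix z assume z: "Re z > max \<sigma> \<nu>"
    have "summable (dirichlet_term c z)" "summable (dirichlet_term c' z)"
      using z by (auto intro!: summable_dirichlet_term[OF c] summable_dirichlet_term[OF c'])
    moreover have "dirichlet_term ?c z = (\<lambda>n. dirichlet_term c z n - dirichlet_term c' z n)"
      by (auto simp: dirichlet_term_def left_diff_distrib)
    ultimately have "dirichlet_sum ?c z = dirichlet_sum c z - dirichlet_sum c' z"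
      by (simp add: dirichlet_sum_def suminf_diff)
    then show "0 = dirichlet_sum ?c z" using eq z by simp
  next
    fix e :: real assume e: "e > 0"
    show "\<forall>\<^sub>F T in at_top. integral {-T..T} (\<lambda>t. (cmod 0)\<^sup>2) \<le> 2 * T * (0 + e)"
      by (rule eventually_mono[OF eventually_gt_at_top[of 0]]) (use e in simp)
  qed auto
  moreover have "(cmod (?c n))\<^sup>2 * real n powr (-2 * 1) \<le> (\<Sum>m\<le>n. (cmod (?c m))\<^sup>2 * real m powr (-2 * 1))"
    by (rule member_le_sum) auto
  ultimately have le0: "(cmod (?c n))\<^sup>2 * real n powr (-2 * 1) \<le> 0" by linarith
  show "c n = c' n"
  proof (cases "n = 0")
    case False
    then have "real n powr (-2 * 1) > 0" by simp
    then have "(cmod (?c n))\<^sup>2 \<le> 0" using le0 by (simp add: mult_le_0_iff)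
    then show ?thesis by simp
  qed (use zero in simp)
qed

text \<open>The terms are bounded at a point of convergence; moving 2 to the right multiplies them
  by the summable \<open>n powr -2\<close>.\<close>

lemma dirichlet_space_abs_summable:
  assumes "b \<in> dirichlet_space"
  obtains \<sigma> where "summable (\<lambda>n. cmod (b n) * real n powr (-\<sigma>))"
proof -
  obtain s where "summable (dirichlet_term b s)" using assms by (auto simp: dirichlet_space_def)
  then have "Bseq (dirichlet_term b s)" by (intro convergent_imp_Bseq) (auto intro: summable_LIMSEQ_zero convergentI)
  then obtain K where K: "\<And>n. cmod (dirichlet_term b s n) \<le> K" by (auto simp: Bseq_def)
  have "summable (\<lambda>n. cmod (b n) * real n powr (- (Re s + 2)))"
  proof (rule summable_comparison_test'[of "\<lambda>n. K * real n powr (-2)" 0])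
    show "summable (\<lambda>n. K * real n powr (-2))" by (intro summable_mult) (simp add: summable_real_powr_iff)
    fix n
    have "cmod (b n) * real n powr (- (Re s + 2)) = cmod (dirichlet_term b s n) * real n powr (-2)"
      by (simp add: norm_dirichlet_term powr_add[symmetric] mult.assoc)
    also have "\<dots> \<le> K * real n powr (-2)" by (rule mult_right_mono[OF K]) simp
    finally show "norm (cmod (b n) * real n powr (- (Re s + 2))) \<le> K * real n powr (-2)" by simp
  qed
  then show ?thesis by (rule that)
qed

definition tail_coeff :: "(nat \<Rightarrow> complex) \<Rightarrow> nat \<Rightarrow> complex" where
  "tail_coeff b n = (if n \<ge> 2 then b n else 0)"

text \<open>Without the constant term every index is at least 2, so moving from \<sigma> to
  \<sigma>' gains at least the factor \<open>2 powr -(\<sigma>' - \<sigma>)\<close>.\<close>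

lemma tail_coeff_small:
  assumes b: "summable (\<lambda>n. cmod (b n) * real n powr (-\<sigma>))"
  obtains K where "K \<ge> 0" "\<And>\<sigma>'. \<sigma>' \<ge> \<sigma> \<Longrightarrow> abs_bound \<sigma>' (tail_coeff b) (K * 2 powr (-\<sigma>'))"
proof -
  define K where "K = 2 powr \<sigma> * (\<Sum>n. cmod (b n) * real n powr (-\<sigma>))"
  show ?thesis
  proof (rule that)
    show "K \<ge> 0" unfolding K_def by (intro mult_nonneg_nonneg suminf_nonneg b) auto
    fix \<sigma>' assume \<sigma>': "\<sigma>' \<ge> \<sigma>"
    have le: "cmod (tail_coeff b n) * real n powr (-\<sigma>') \<le> 2 powr (- (\<sigma>' - \<sigma>)) * (cmod (b n) * real n powr (-\<sigma>))" for n
    proof (cases "n \<ge> 2")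
      case True
      have "real n powr (-\<sigma>') = real n powr (- (\<sigma>' - \<sigma>)) * real n powr (-\<sigma>)"
        by (simp add: powr_add[symmetric])
      also have "\<dots> \<le> 2 powr (- (\<sigma>' - \<sigma>)) * real n powr (-\<sigma>)"
        using True \<sigma>' by (intro mult_right_mono powr_mono2') auto
      finally have "cmod (b n) * real n powr (-\<sigma>') \<le> cmod (b n) * (2 powr (- (\<sigma>' - \<sigma>)) * real n powr (-\<sigma>))"
        by (rule mult_left_mono) simp
      then show ?thesis using True by (simp add: tail_coeff_def mult_ac)
    qed (simp add: tail_coeff_def)
    have s1: "summable (\<lambda>n. 2 powr (- (\<sigma>' - \<sigma>)) * (cmod (b n) * real n powr (-\<sigma>)))"
      by (rule summable_mult[OF b])
    have s2: "summable (\<lambda>n. cmod (tail_coeff b n) * real n powr (-\<sigma>'))"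
      by (rule summable_comparison_test'[OF s1, of 0]) (use le in auto)
    have "(\<Sum>n. cmod (tail_coeff b n) * real n powr (-\<sigma>')) \<le> 2 powr (- (\<sigma>' - \<sigma>)) * (\<Sum>n. cmod (b n) * real n powr (-\<sigma>))"
      using suminf_le[OF le s2 s1] suminf_mult[OF b] by simp
    also have "2 powr (- (\<sigma>' - \<sigma>)) = 2 powr \<sigma> * 2 powr (-\<sigma>')"
      by (simp add: powr_add[symmetric])
    finally show "abs_bound \<sigma>' (tail_coeff b) (K * 2 powr (-\<sigma>'))"
      using s2 by (simp add: abs_bound_def K_def mult_ac)
  qed
qed

lemma dirichlet_sum_tail:
  assumes "summable (\<lambda>n. cmod (b n) * real n powr (-\<sigma>))" "Re s \<ge> \<sigma>"
  shows "dirichlet_sum b s = b 1 + deval (tail_coeff b) (nat_char s)"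
proof -
  have s: "summable (dirichlet_term b s)" by (rule summable_dirichlet_term[OF assms])
  have "dirichlet_term (tail_coeff b) s n = (if n < 2 then 0 else dirichlet_term b s n)" for n
    by (auto simp: tail_coeff_def dirichlet_term_def)
  then have e: "dirichlet_term (tail_coeff b) s (n + 2) = dirichlet_term b s (n + 2)"
    "(\<Sum>i<2. dirichlet_term (tail_coeff b) s i) = 0" for n by auto
  have "summable (dirichlet_term (tail_coeff b) s)"
    using s by (subst summable_iff_shift[of _ 2, symmetric]) (simp only: e summable_iff_shift)
  then have "dirichlet_sum (tail_coeff b) s = (\<Sum>n. dirichlet_term b s (n + 2))"
    unfolding dirichlet_sum_def by (subst suminf_split_initial_segment[of _ 2]) (simp_all only: e add_0_right)
  moreover have "(\<Sum>i<2. dirichlet_term b s i) = b 1"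
    by (simp add: numeral_2_eq_2 dirichlet_term_def)
  ultimately show ?thesis
    unfolding dirichlet_sum_deval[symmetric] using suminf_split_initial_segment[OF s, of 2]
    by (simp add: dirichlet_sum_def)
qed

lemma H_plus_abs_summable:
  assumes g: "g > 1 / 2"
  obtains k C where "k \<ge> 1" "C \<ge> 0" "\<And>a. a \<in> H_plus \<Longrightarrow> summable (\<lambda>n. cmod (a n) * real n powr (-g))"
    "\<And>a. a \<in> H_plus \<Longrightarrow> (\<Sum>n. cmod (a n) * real n powr (-g)) \<le> C * H_norm k a"
proof -
  \<comment> \<open>This choice makes the exponent \<open>-2 * g + 2 / k\<close> of the squared
    weights smaller than -1.\<close>
  obtain k :: nat where k: "real k > 2 / (2 * g - 1)" using reals_Archimedean2 by blast
  have "2 / (2 * g - 1) > 0" using g by simp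
  then have k0: "real k > 0" using k by linarith
  then have k1: "k \<ge> 1" by linarith
  have "2 / real k < 2 * g - 1" using k g k0 by (simp add: field_simps)
  then have s: "summable (\<lambda>n. (real n powr (-g) * real n powr (1 / real k))\<^sup>2)"
    by (simp add: power2_eq_square powr_add[symmetric] summable_real_powr_iff)
  show ?thesis
  proof (rule that[OF k1, of "sqrt (\<Sum>n. (real n powr (-g) * real n powr (1 / real k))\<^sup>2)"])
    show "0 \<le> sqrt (\<Sum>n. (real n powr (-g) * real n powr (1 / real k))\<^sup>2)"
      using suminf_nonneg[OF s] by simp
    fix a assume a: "a \<in> H_plus"
    from H_plus_weighted[OF a k1 s]
    show "summable (\<lambda>n. cmod (a n) * real n powr (-g))"
      "(\<Sum>n. cmod (a n) * real n powr (-g)) \<le> sqrt (\<Sum>n. (real n powr (-g) * real n powr (1 / real k))\<^sup>2) * H_norm k a"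
      by (simp_all add: mult.commute)
  qed
qed

lemma H_plus_summable_weight: "a \<in> H_plus \<Longrightarrow> g > 1 / 2 \<Longrightarrow> summable (\<lambda>n. cmod (a n) * real n powr (-g))"
  using H_plus_abs_summable by blast

section \<open>Sufficiency\<close>

text \<open>Otherwise \<open>Re \<Phi> - \<kappa>\<close> would decay exponentially along the positive axis, whereas Harnack's
  inequality allows a positive harmonic function to decay only like \<open>1 / x\<close>.\<close>

lemma Re_leading_coeff_gt:
  assumes \<Phi>: "\<Phi> holomorphic_on half_plane 0" and pos: "\<And>s. Re s > 0 \<Longrightarrow> Re (\<Phi> s) > \<kappa>"
    and b: "summable (\<lambda>n. cmod (b n) * real n powr (-\<sigma>))"
    and rep: "\<And>s. Re s > \<nu> \<Longrightarrow> \<Phi> s = dirichlet_sum b s"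
  shows "Re (b 1) > \<kappa>"
proof (rule ccontr)
  assume neg: "\<not> ?thesis"
  define F where "F s = \<Phi> s - of_real \<kappa>" for s
  have F: "F holomorphic_on half_plane 0" "\<And>s. Re s > 0 \<Longrightarrow> Re (F s) > 0"
    unfolding F_def using pos by (auto intro!: holomorphic_intros \<Phi>)
  define c where "c = Re (F (Complex 1 0))"
  have c: "c > 0" using F(2)[of "Complex 1 0"] by (simp add: c_def)
  obtain K where K: "K \<ge> 0" "\<And>\<sigma>'. \<sigma>' \<ge> \<sigma> \<Longrightarrow> abs_bound \<sigma>' (tail_coeff b) (K * 2 powr (-\<sigma>'))"
    using tail_coeff_small[OF b] by blast
  have up: "c \<le> K * (real n * (1 / 2) ^ n)" if n: "real n > max 1 (max \<sigma> \<nu>)" for n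
  proof -
    let ?s = "Complex (real n) 0"
    have s: "Re ?s > \<nu>" "Re ?s \<ge> \<sigma>" using n by auto
    have "F ?s = (b 1 - of_real \<kappa>) + deval (tail_coeff b) (nat_char ?s)"
      unfolding F_def rep[OF s(1)] dirichlet_sum_tail[OF b s(2)] by simp
    then have "Re (F ?s) \<le> Re (deval (tail_coeff b) (nat_char ?s))" using neg by simp
    also have "\<dots> \<le> K * 2 powr (- real n)"
    proof (rule order_trans[OF complex_Re_le_cmod norm_deval_le])
      show "abs_bound (real n) (tail_coeff b) (K * 2 powr (- real n))" using n by (intro K(2)) simp
      show "mulchar (real n) (nat_char ?s)" by (rule mulchar_nat_char) simp
    qed
    also have "2 powr (- real n) = (1 / 2 :: real) ^ n"
      by (simp add: powr_minus powr_realpow power_one_over inverse_eq_divide)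
    finally have "Re (F ?s) * real n \<le> K * (1 / 2) ^ n * real n" by (rule mult_right_mono) simp
    moreover have "c \<le> Re (F ?s) * real n"
      using harnack(2)[OF F, of 1 "real n" 0] n by (simp add: c_def)
    moreover have "K * (1 / 2) ^ n * real n = K * (real n * (1 / 2) ^ n)" by simp
    ultimately show ?thesis by linarith
  qed
  have "(\<lambda>n. K * (real n * (1 / 2) ^ n)) \<longlonglongrightarrow> K * 0"
    by (intro tendsto_intros powser_times_n_limit_0) simp
  then have "\<forall>\<^sub>F n in sequentially. K * (real n * (1 / 2) ^ n) < c"
    using c by (intro order_tendstoD(2)) auto
  moreover have "\<forall>\<^sub>F n in sequentially. real n > max 1 (max \<sigma> \<nu>)"
    using filterlim_real_sequentially unfolding filterlim_at_top_dense by blast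
  ultimately have "\<forall>\<^sub>F n::nat in sequentially. False"
    by eventually_elim (use up in force)
  then show False by simp
qed

text \<open>The symbol is \<open>\<psi> s = c0 * s + b1 + deval b' (nat_char s)\<close>, and \<open>d n\<close> are the coefficients of
  \<open>n powr -\<psi>\<close>.\<close>

locale dirichlet_symbol =
  fixes c0 :: nat and b1 :: complex and b' :: "nat \<Rightarrow> complex" and \<sigma>0 \<eta> :: real
    and d :: "nat \<Rightarrow> nat \<Rightarrow> complex"
  assumes tail: "abs_bound \<sigma>0 b' \<eta>" and \<sigma>0: "\<sigma>0 \<ge> 1"
    and d_0: "d 0 = (\<lambda>_. 0)" and d_at_0: "\<And>n. d n 0 = 0"
    and d_bound: "\<And>n. n \<ge> 1 \<Longrightarrow> abs_bound \<sigma>0 (d n) (real n powr (\<eta> - Re b1 - real c0 * \<sigma>0))"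
    and d_eval: "\<And>n h. n \<ge> 1 \<Longrightarrow> mulchar \<sigma>0 h \<Longrightarrow>
      deval (d n) h = h n ^ c0 * exp (- of_real (ln (real n)) * (b1 + deval b' h))"
begin

definition \<psi> :: "complex \<Rightarrow> complex" where
  "\<psi> s = of_nat c0 * s + b1 + deval b' (nat_char s)"

lemma d_nat_char:
  assumes "Re s \<ge> \<sigma>0"
  shows "deval (d n) (nat_char s) = nat_char (\<psi> s) n"
proof (cases "n = 0")
  case False
  then have n: "n \<ge> 1" by simp
  show ?thesis
    unfolding d_eval[OF n mulchar_nat_char[OF assms]] nat_char_exp[OF n] \<psi>_def
    by (simp add: exp_of_nat_mult[symmetric] exp_add[symmetric] algebra_simps)
qed (simp add: d_0 deval_def)

lemma Re_\<psi>_ge: "Re s \<ge> \<sigma>0 \<Longrightarrow> Re (\<psi> s) \<ge> real c0 * Re s + Re b1 - \<eta>"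
  using norm_deval_le[OF tail mulchar_nat_char[of \<sigma>0 s]] abs_Re_le_cmod[of "deval b' (nat_char s)"]
  by (simp add: \<psi>_def)

text \<open>The coefficient of \<open>n powr -s\<close> in the termwise expansion of
  \<open>a\<close> composed with \<psi>.\<close>

definition comp_coeff :: "(nat \<Rightarrow> complex) \<Rightarrow> nat \<Rightarrow> complex" where
  "comp_coeff a n = (\<Sum>j. a j * d j n)"

lemma comp_coeff_0: "comp_coeff a 0 = 0"
  by (simp add: comp_coeff_def d_at_0)

text \<open>By \<open>Re_\<psi>_ge\<close>, \<open>gap\<close> keeps \<psi> on
  \<open>Re s \<ge> \<sigma>0\<close> beyond abscissa 1/2, where every series in
  \<open>H_plus\<close> converges absolutely.\<close>

context
  assumes gap: "real c0 * \<sigma>0 + Re b1 - \<eta> > 1 / 2"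
begin

text \<open>The \<open>j\<close>-th series has weighted norm at most
  \<open>cmod (a j) * j powr -g\<close>, where \<open>g > 1 / 2\<close> by \<open>gap\<close>, so
  the expansion converges absolutely.\<close>

lemma comp_coeff_abs:
  assumes a: "a \<in> H_plus"
  shows "\<exists>B. abs_bound \<sigma>0 (comp_coeff a) B"
    and "Re s \<ge> \<sigma>0 \<Longrightarrow> dirichlet_sum (comp_coeff a) s = dirichlet_sum a (\<psi> s)"
    and "summable (\<lambda>j. a j * d j n)"
proof -
  define g where "g = real c0 * \<sigma>0 + Re b1 - \<eta>"
  have a0: "a 0 = 0" using a by (simp add: H_plus_def)
  have c: "abs_bound \<sigma>0 (\<lambda>n. a j * d j n) (cmod (a j) * real j powr (-g))" for j
  proof (cases "j = 0")
    case False
    then show ?thesis using abs_bound_scale[OF d_bound[of j], of "a j"] by (simp add: g_def algebra_simps)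
  qed (simp add: a0 abs_bound_def)
  have s: "summable (\<lambda>j. cmod (a j) * real j powr (-g))"
    by (rule H_plus_summable_weight[OF a]) (use gap in \<open>simp add: g_def\<close>)
  show "\<exists>B. abs_bound \<sigma>0 (comp_coeff a) B"
    unfolding comp_coeff_def[abs_def] using abs_bound_suminf(1)[OF c s] by blast
  show "dirichlet_sum (comp_coeff a) s = dirichlet_sum a (\<psi> s)" if "Re s \<ge> \<sigma>0" for s
  proof -
    have "deval (\<lambda>n. a j * d j n) (nat_char s) = dirichlet_term a (\<psi> s) j" for j
    proof (cases "j = 0")
      case False
      then show ?thesis
        using deval_scale[OF d_bound mulchar_nat_char[OF that], of j "a j"] d_nat_char[OF that]
        by (simp add: dirichlet_term_nat_char)
    qed (simp add: a0 deval_def)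
    then have "deval (comp_coeff a) (nat_char s) = dirichlet_sum a (\<psi> s)"
      using abs_bound_suminf(2)[OF c s mulchar_nat_char[OF that]]
      by (simp add: sums_iff dirichlet_sum_def[of a] comp_coeff_def[abs_def])
    then show ?thesis by (simp only: dirichlet_sum_deval[of "comp_coeff a"])
  qed
  show "summable (\<lambda>j. a j * d j n)"
    by (cases "n = 0") (use summable_norm_cancel[OF abs_bound_suminf(3)[OF c s, of n]] in \<open>auto simp: d_at_0\<close>)
qed

lemma comp_coeff_diff:
  assumes "a \<in> H_plus" "a' \<in> H_plus"
  shows "comp_coeff (\<lambda>n. a n - a' n) = (\<lambda>n. comp_coeff a n - comp_coeff a' n)"
  using suminf_diff[OF comp_coeff_abs(3)[OF assms(1)] comp_coeff_abs(3)[OF assms(2)]]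
  by (auto simp: comp_coeff_def left_diff_distrib)

lemma Re_ge_on_half_plane:
  assumes \<Phi>: "\<Phi> holomorphic_on half_plane 0" and pos: "\<And>s. Re s > 0 \<Longrightarrow> Re (\<Phi> s) > \<kappa>"
    and \<kappa>: "\<kappa> \<le> 1 / 2"
    and ext: "\<And>s. Re s > \<nu> \<Longrightarrow> \<Phi> s = \<psi> s" and \<epsilon>: "0 < \<epsilon>"
  obtains \<delta> where "\<delta> > 0" "\<And>s. Re s \<ge> \<epsilon> \<Longrightarrow> Re (\<Phi> s) \<ge> \<kappa> + \<delta>"
proof -
  define F where "F s = \<Phi> s - of_real \<kappa>" for s
  have F: "F holomorphic_on half_plane 0" "\<And>s. Re s > 0 \<Longrightarrow> Re (F s) > 0"
    unfolding F_def using pos by (auto intro!: holomorphic_intros \<Phi>)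
  define y where "y = max \<sigma>0 (\<nu> + 1)"
  define g where "g = real c0 * \<sigma>0 + Re b1 - \<eta> - \<kappa>"
  have g: "g > 0" using gap \<kappa> by (simp add: g_def)
  have y: "y \<ge> 1" using \<sigma>0 by (simp add: y_def)
  have far: "Re (F s) \<ge> g" if "Re s \<ge> y" for s
  proof -
    have "real c0 * \<sigma>0 \<le> real c0 * Re s" using that by (intro mult_left_mono) (auto simp: y_def)
    then show ?thesis using Re_\<psi>_ge[of s] ext[of s] that by (simp add: F_def g_def y_def)
  qed
  \<comment> \<open>To the right of \<open>y\<close> the symbol gives the margin \<open>g\<close>;
    between \<epsilon> and \<open>y\<close> Harnack's inequality loses at most the factor
    \<open>\<epsilon> / y\<close>.\<close>
  show ?thesis
  proof (rule that[of "min g (g * \<epsilon> / y)"])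
    show "min g (g * \<epsilon> / y) > 0" using g \<epsilon> y by simp
    fix s assume s: "Re s \<ge> \<epsilon>"
    show "Re (\<Phi> s) \<ge> \<kappa> + min g (g * \<epsilon> / y)"
    proof (cases "Re s \<ge> y")
      case True
      then show ?thesis using far[OF True] by (simp add: F_def)
    next
      case False
      have "g * \<epsilon> \<le> Re (F (Complex y (Im s))) * Re s"
        using far[of "Complex y (Im s)"] g \<epsilon> s by (intro mult_mono) auto
      also have "\<dots> \<le> Re (F (Complex (Re s) (Im s))) * y"
        by (rule harnack(1)[OF F]) (use False s \<epsilon> in auto)
      finally have "g * \<epsilon> / y \<le> Re (F s)" using y by (simp add: field_simps)
      then show ?thesis by (simp add: F_def)
    qed
  qed
qed

text \<open>It matters that \<open>k\<close> and \<open>C\<close> are chosen before \<open>a\<close>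
  and \<open>N\<close>: the bound then survives the passage from truncations to the full
  series.\<close>

lemma mean_square_polynomials:
  assumes \<Phi>: "\<Phi> holomorphic_on half_plane 0" and pos: "\<And>s. Re s > 0 \<Longrightarrow> Re (\<Phi> s) > \<kappa>"
    and \<kappa>: "\<kappa> = (if c0 = 0 then 1 / 2 else 0)"
    and ext: "\<And>s. Re s > \<nu> \<Longrightarrow> \<Phi> s = \<psi> s" and \<epsilon>: "0 < \<epsilon>"
  obtains k C where "k \<ge> 1" "C \<ge> 0" "\<And>a N e. a \<in> H_plus \<Longrightarrow> e > 0 \<Longrightarrow>
    \<forall>\<^sub>F T in at_top. integral {-T..T} (\<lambda>t. (cmod (dpoly a N (\<Phi> (Complex \<epsilon> t))))\<^sup>2)
       \<le> 2 * T * ((C * H_norm k a)\<^sup>2 + e)"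
proof -
  have "\<kappa> \<le> 1 / 2" by (simp add: \<kappa>)
  from Re_ge_on_half_plane[OF \<Phi> pos this ext \<epsilon>]
  obtain \<delta> where \<delta>: "\<delta> > 0" "\<And>s. Re s \<ge> \<epsilon> \<Longrightarrow> Re (\<Phi> s) \<ge> \<kappa> + \<delta>" by blast
  show ?thesis
  proof (cases "c0 = 0")
    case False
    then have k0: "\<kappa> = 0" by (simp add: \<kappa>)
    obtain k :: nat where k: "real k > 1 / \<delta>" using reals_Archimedean2 by blast
    moreover have "1 / \<delta> > 0" using \<delta> by simp
    ultimately have k1: "k \<ge> 1" by linarith
    have kd: "1 / real k \<le> \<delta>" using k k1 \<delta> by (simp add: field_simps)
    show ?thesis
    proof (rule that[OF k1, of 1])
      fix a N and e :: real assume a: "a \<in> H_plus" and e: "e > 0"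
      \<comment> \<open>Only a nonzero \<open>c0\<close> makes the real part of the symbol tend to
        infinity.\<close>
      have far: "\<exists>\<sigma>\<ge>\<epsilon>. \<forall>t. Re (\<Phi> (Complex \<sigma> t)) \<ge> K" for K
      proof -
        define \<sigma> where "\<sigma> = max (max \<epsilon> \<sigma>0) (max (\<nu> + 1) (K - Re b1 + \<eta>))"
        have "1 * \<sigma> \<le> real c0 * \<sigma>" using False \<epsilon> by (intro mult_right_mono) (auto simp: \<sigma>_def)
        moreover have \<sigma>: "\<sigma> \<ge> \<epsilon>" "\<sigma> \<ge> \<sigma>0" "\<sigma> > \<nu>" "\<sigma> \<ge> K - Re b1 + \<eta>" by (auto simp: \<sigma>_def)
        ultimately have "Re (\<Phi> (Complex \<sigma> t)) \<ge> K" for t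
          using Re_\<psi>_ge[of "Complex \<sigma> t"] ext[of "Complex \<sigma> t"] by simp
        then show ?thesis using \<sigma> by blast
      qed
      have "(\<Sum>n\<le>N. (cmod (a n))\<^sup>2 * real n powr (-2 * \<delta>)) \<le> (\<Sum>n\<le>N. H_term k a n)"
      proof (rule sum_mono)
        fix n show "(cmod (a n))\<^sup>2 * real n powr (-2 * \<delta>) \<le> H_term k a n"
          unfolding H_term_def using kd by (cases "n = 0") (auto intro!: mult_left_mono powr_mono)
      qed
      also have "\<dots> \<le> (\<Sum>n. H_term k a n)"
        by (intro sum_le_suminf H_plus_summable[OF a k1]) (auto simp: H_term_nonneg)
      also have "\<dots> = (1 * H_norm k a)\<^sup>2"
        using suminf_nonneg[OF H_plus_summable[OF a k1] H_term_nonneg] by (simp add: H_norm_def)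
      finally have le: "(\<Sum>n\<le>N. (cmod (a n))\<^sup>2 * real n powr (-2 * \<delta>)) \<le> (1 * H_norm k a)\<^sup>2" .
      have "\<forall>\<^sub>F T in at_top. integral {-T..T} (\<lambda>t. (cmod (dpoly a N (\<Phi> (Complex \<epsilon> t))))\<^sup>2)
         \<le> 2 * T * ((\<Sum>n\<le>N. (cmod (a n))\<^sup>2 * real n powr (-2 * \<delta>)) + e)"
        by (rule mean_square_dpoly_compose[OF \<Phi> \<epsilon> _ _ far e]) (use \<delta> k0 in auto)
      then show "\<forall>\<^sub>F T in at_top. integral {-T..T} (\<lambda>t. (cmod (dpoly a N (\<Phi> (Complex \<epsilon> t))))\<^sup>2)
         \<le> 2 * T * ((1 * H_norm k a)\<^sup>2 + e)"
        using eventually_gt_at_top[of "0::real"]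
      proof eventually_elim
        case (elim T)
        have "2 * T * ((\<Sum>n\<le>N. (cmod (a n))\<^sup>2 * real n powr (-2 * \<delta>)) + e) \<le> 2 * T * ((1 * H_norm k a)\<^sup>2 + e)"
          using le elim by (intro mult_left_mono) auto
        then show ?case using elim by linarith
      qed
    qed simp
  next
    case True
    then have kh: "\<kappa> = 1 / 2" by (simp add: \<kappa>)
    have "1 / 2 + \<delta> > 1 / 2" using \<delta> by simp
    obtain k C where k: "k \<ge> 1" "C \<ge> 0"
      and s: "\<And>a. a \<in> H_plus \<Longrightarrow> summable (\<lambda>n. cmod (a n) * real n powr (- (1 / 2 + \<delta>)))"
      and C: "\<And>a. a \<in> H_plus \<Longrightarrow> (\<Sum>n. cmod (a n) * real n powr (- (1 / 2 + \<delta>))) \<le> C * H_norm k a"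
      using H_plus_abs_summable[OF \<open>1 / 2 + \<delta> > 1 / 2\<close>] by blast
    show ?thesis
    proof (rule that[OF k])
      fix a N and e :: real assume a: "a \<in> H_plus" and e: "e > 0"
      have bd: "cmod (dpoly a N (\<Phi> (Complex \<epsilon> t))) \<le> C * H_norm k a" for t
      proof -
        have "cmod (dpoly a N (\<Phi> (Complex \<epsilon> t))) \<le> (\<Sum>n\<le>N. cmod (a n) * real n powr (- (1 / 2 + \<delta>)))"
          unfolding dpoly_def
        proof (rule sum_norm_le)
          fix n show "cmod (dirichlet_term a (\<Phi> (Complex \<epsilon> t)) n) \<le> cmod (a n) * real n powr (- (1 / 2 + \<delta>))"
            unfolding norm_dirichlet_term using \<delta>(2)[of "Complex \<epsilon> t"] kh
            by (cases "n = 0") (auto intro!: mult_left_mono powr_mono)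
        qed
        also have "\<dots> \<le> (\<Sum>n. cmod (a n) * real n powr (- (1 / 2 + \<delta>)))"
          by (intro sum_le_suminf s a) auto
        finally show ?thesis using C[OF a] by linarith
      qed
      have cont: "continuous_on UNIV (\<lambda>t. dpoly a N (\<Phi> (Complex \<epsilon> t)))"
        by (rule continuous_on_compose2[OF holomorphic_on_imp_continuous_on[OF holomorphic_dpoly] continuous_on_vertical[OF \<Phi> \<epsilon>]]) auto
      show "\<forall>\<^sub>F T in at_top. integral {-T..T} (\<lambda>t. (cmod (dpoly a N (\<Phi> (Complex \<epsilon> t))))\<^sup>2)
         \<le> 2 * T * ((C * H_norm k a)\<^sup>2 + e)"
        using eventually_gt_at_top[of "0::real"]
      proof eventually_elim
        case (elim T)
        have "integral {-T..T} (\<lambda>t. (cmod (dpoly a N (\<Phi> (Complex \<epsilon> t))))\<^sup>2) \<le> integral {-T..T} (\<lambda>t. (C * H_norm k a)\<^sup>2)"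
        proof (rule integral_le)
          show "(\<lambda>t. (cmod (dpoly a N (\<Phi> (Complex \<epsilon> t))))\<^sup>2) integrable_on {-T..T}"
            by (intro integrable_continuous_real continuous_intros continuous_on_subset[OF cont]) auto
          show "(cmod (dpoly a N (\<Phi> (Complex \<epsilon> t))))\<^sup>2 \<le> (C * H_norm k a)\<^sup>2" for t
            by (rule power_mono[OF bd]) simp
        qed (rule integrable_const_ivl)
        also have "\<dots> = 2 * T * (C * H_norm k a)\<^sup>2" using elim by simp
        also have "\<dots> \<le> 2 * T * ((C * H_norm k a)\<^sup>2 + e)" using elim e by (intro mult_left_mono) auto
        finally show ?case .
      qed
    qed
  qed
qed

text \<open>Bessel's inequality applies to the truncations of \<open>a\<close>, whose compositions
  are defined on all of \<open>half_plane 0\<close>. For a fixed partial sum of the norm, the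
  finitely many coefficients converge as the truncation grows.\<close>

lemma comp_coeff_bounded:
  assumes \<Phi>: "\<Phi> holomorphic_on half_plane 0" and pos: "\<And>s. Re s > 0 \<Longrightarrow> Re (\<Phi> s) > \<kappa>"
    and \<kappa>: "\<kappa> = (if c0 = 0 then 1 / 2 else 0)"
    and ext: "\<And>s. Re s > \<nu> \<Longrightarrow> \<Phi> s = \<psi> s" and k: "k \<ge> 1"
  obtains k' C where "k' \<ge> 1" "C \<ge> 0" "\<And>a. a \<in> H_plus \<Longrightarrow> summable (H_term k (comp_coeff a))"
    "\<And>a. a \<in> H_plus \<Longrightarrow> H_norm k (comp_coeff a) \<le> C * H_norm k' a"
proof -
  \<comment> \<open>On this line the Bessel weight \<open>n powr (-2 * \<epsilon>)\<close> is the
    weight of the seminorm \<open>H_norm k\<close>.\<close>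
  define \<epsilon> where "\<epsilon> = 1 / real k"
  have \<epsilon>: "\<epsilon> > 0" using k by (simp add: \<epsilon>_def)
  obtain k' C where k': "k' \<ge> 1" "C \<ge> 0" and mean: "\<And>a N e. a \<in> H_plus \<Longrightarrow> e > 0 \<Longrightarrow>
    \<forall>\<^sub>F T in at_top. integral {-T..T} (\<lambda>t. (cmod (dpoly a N (\<Phi> (Complex \<epsilon> t))))\<^sup>2)
       \<le> 2 * T * ((C * H_norm k' a)\<^sup>2 + e)"
    using mean_square_polynomials[OF \<Phi> pos \<kappa> ext \<epsilon>] by blast
  have le: "(\<Sum>n\<le>M. H_term k (comp_coeff a) n) \<le> (C * H_norm k' a)\<^sup>2" if a: "a \<in> H_plus" for a M
  proof -
    define tr where "tr N n = (if n \<le> N then a n else 0)" for N n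
    have tr: "tr N \<in> H_plus" for N
    proof (rule H_plus_finite_support)
      show "tr N 0 = 0" using a by (simp add: tr_def H_plus_def)
      show "finite {n. tr N n \<noteq> 0}" by (rule finite_subset[of _ "{..N}"]) (auto simp: tr_def)
    qed
    have poly: "dirichlet_sum (tr N) s = dpoly a N s" for N s
      unfolding dirichlet_sum_def dpoly_def
      by (subst suminf_finite[of "{..N}"]) (auto simp: tr_def dirichlet_term_def)
    have trc: "comp_coeff (tr N) n = (\<Sum>j\<le>N. a j * d j n)" for N n
      unfolding comp_coeff_def by (subst suminf_finite[of "{..N}"]) (auto simp: tr_def)
    have fin: "(\<Sum>n\<le>M. (cmod (comp_coeff (tr N) n))\<^sup>2 * real n powr (-2 * \<epsilon>)) \<le> (C * H_norm k' a)\<^sup>2" for N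
    proof (rule dirichlet_bessel[where F = "\<lambda>s. dpoly a N (\<Phi> s)" and \<rho> = 0 and \<sigma> = "max \<sigma>0 \<nu>"
          and B = "\<Sum>n\<le>N. cmod (a n)"])
      have "(dpoly a N \<circ> \<Phi>) holomorphic_on half_plane 0"
        by (rule holomorphic_on_compose[OF \<Phi> holomorphic_dpoly])
      then show "(\<lambda>s. dpoly a N (\<Phi> s)) holomorphic_on half_plane 0" by (simp add: o_def)
      show "cmod (dpoly a N (\<Phi> s)) \<le> (\<Sum>n\<le>N. cmod (a n))" if s: "Re s \<ge> \<epsilon>" for s
        unfolding dpoly_def
      proof (rule sum_norm_le)
        fix n
        have r: "Re (\<Phi> s) \<ge> 0" using pos[of s] s \<epsilon> \<kappa> by (auto split: if_splits)
        have "real n powr (- Re (\<Phi> s)) \<le> 1"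
          using r powr_mono[of "- Re (\<Phi> s)" 0 "real n"] by (cases "n = 0") auto
        then show "cmod (dirichlet_term a (\<Phi> s) n) \<le> cmod (a n)"
          by (simp add: norm_dirichlet_term mult_left_le)
      qed
      have "summable (\<lambda>n. cmod (comp_coeff (tr N) n) * real n powr (-\<sigma>0))"
        using comp_coeff_abs(1)[OF tr] by (auto simp: abs_bound_def)
      then show "summable (\<lambda>n. cmod (comp_coeff (tr N) n) * real n powr (- max \<sigma>0 \<nu>))"
        by (rule summable_weight_mono) simp
      show "dpoly a N (\<Phi> s) = dirichlet_sum (comp_coeff (tr N)) s" if "Re s > max \<sigma>0 \<nu>" for s
        using that comp_coeff_abs(2)[OF tr, of s N] ext[of s] by (simp add: poly)
    qed (use \<epsilon> mean[OF a] in auto)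
    have "(\<lambda>N. \<Sum>n\<le>M. (cmod (comp_coeff (tr N) n))\<^sup>2 * real n powr (-2 * \<epsilon>))
       \<longlonglongrightarrow> (\<Sum>n\<le>M. (cmod (comp_coeff a n))\<^sup>2 * real n powr (-2 * \<epsilon>))"
      unfolding trc unfolding comp_coeff_def
      by (intro tendsto_intros summable_LIMSEQ' comp_coeff_abs(3)[OF a])
    then have "(\<Sum>n\<le>M. (cmod (comp_coeff a n))\<^sup>2 * real n powr (-2 * \<epsilon>)) \<le> (C * H_norm k' a)\<^sup>2"
      by (rule LIMSEQ_le_const2) (use fin in auto)
    then show ?thesis by (simp add: H_term_def \<epsilon>_def)
  qed
  show ?thesis
  proof (rule that[OF k'])
    fix a assume a: "a \<in> H_plus"
    have "C * H_norm k' a \<ge> 0" using k' H_norm_nonneg[OF a k'(1)] by simp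
    from H_norm_le[OF this le[OF a]]
    show "summable (H_term k (comp_coeff a))" "H_norm k (comp_coeff a) \<le> C * H_norm k' a" by auto
  qed
qed

lemma sufficiency:
  assumes \<Phi>: "\<Phi> holomorphic_on half_plane 0" and pos: "\<And>s. Re s > 0 \<Longrightarrow> Re (\<Phi> s) > \<kappa>"
    and \<kappa>: "\<kappa> = (if c0 = 0 then 1 / 2 else 0)"
    and ext: "\<And>s. Re s > \<nu> \<Longrightarrow> \<Phi> s = \<psi> s" and \<phi>: "\<And>s. Re s > \<nu> \<Longrightarrow> \<phi> s = \<psi> s"
  shows "continuous_composition_operator \<phi>"
  unfolding continuous_composition_operator_def
proof (intro exI[of _ comp_coeff] conjI ballI)
  show H: "comp_coeff a \<in> H_plus" if a: "a \<in> H_plus" for a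
  proof -
    have "summable (H_term k (comp_coeff a))" if "k \<ge> 1" for k
      by (rule comp_coeff_bounded[OF \<Phi> pos \<kappa> ext that]) (use a in auto)
    then show ?thesis by (simp add: H_plus_def comp_coeff_0)
  qed
  show "represented_by (\<lambda>s. dirichlet_sum a (\<phi> s)) (comp_coeff a)" if a: "a \<in> H_plus" for a
  proof -
    obtain B where "abs_bound \<sigma>0 (comp_coeff a) B" using comp_coeff_abs(1)[OF a] by blast
    then have s: "summable (dirichlet_term (comp_coeff a) s)" if "Re s \<ge> \<sigma>0" for s
      using that by (intro summable_dirichlet_term[of _ \<sigma>0]) (auto simp: abs_bound_def)
    have "comp_coeff a \<in> dirichlet_space"
      using s[of "of_real \<sigma>0"] by (auto simp: dirichlet_space_def comp_coeff_0)
    then show ?thesis unfolding represented_by_def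
      using s comp_coeff_abs(2)[OF a] \<phi> by (intro conjI exI[of _ "max \<sigma>0 \<nu>"]) auto
  qed
  show "continuous_map H_plus_topology H_plus_topology comp_coeff"
  proof (rule H_plus_continuousI[OF H])
    fix k :: nat assume "k \<ge> 1"
    from comp_coeff_bounded[OF \<Phi> pos \<kappa> ext this] obtain k' C where k': "k' \<ge> 1" "C \<ge> 0"
      "\<And>a. a \<in> H_plus \<Longrightarrow> H_norm k (comp_coeff a) \<le> C * H_norm k' a" by metis
    have "H_norm k (\<lambda>n. comp_coeff a n - comp_coeff a' n) \<le> C * H_norm k' (\<lambda>n. a n - a' n)"
      if "a \<in> H_plus" "a' \<in> H_plus" for a a'
      using k'(3)[OF H_plus_diff[OF that]] by (simp add: comp_coeff_diff[OF that])
    then show "\<exists>k'\<ge>1. \<exists>C\<ge>0. \<forall>a\<in>H_plus. \<forall>a'\<in>H_plus.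
       H_norm k (\<lambda>n. comp_coeff a n - comp_coeff a' n) \<le> C * H_norm k' (\<lambda>n. a n - a' n)"
      using k' by blast
  qed
qed

end

end

section \<open>Necessity\<close>

lemma holomorphic_on_half_plane_0:
  assumes "\<And>\<sigma>. \<sigma> > 0 \<Longrightarrow> f holomorphic_on half_plane \<sigma>"
  shows "f holomorphic_on half_plane 0"
  unfolding holomorphic_on_def
proof
  fix s :: complex assume s: "s \<in> half_plane 0"
  have "f field_differentiable at s"
    using s assms[of "Re s / 2"] open_half_plane
    by (intro holomorphic_on_imp_differentiable_at[of _ "half_plane (Re s / 2)"]) auto
  then show "f field_differentiable at s within half_plane 0" by (rule field_differentiable_at_within)
qed

lemma smooth_weight_summable:
  assumes "\<sigma> > 1 / real k"
  shows "summable (\<lambda>n. ((if n \<in> smooth p then real n powr (-\<sigma>) else 0) * real n powr (1 / real k))\<^sup>2)"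
proof -
  have "((if n \<in> smooth p then real n powr (-\<sigma>) else 0) * real n powr (1 / real k))\<^sup>2
    = (if n \<in> smooth p then real n powr (- (2 * \<sigma> - 2 / real k)) else 0)" for n
    by (simp add: power2_eq_square powr_add[symmetric] algebra_simps)
  moreover have "summable (\<lambda>n. if n \<in> smooth p then real n powr (- (2 * \<sigma> - 2 / real k)) else 0)"
    using assms by (intro summable_smooth) simp
  ultimately show ?thesis by simp
qed

text \<open>\<open>H_plus_weighted\<close> with the weight supported on smooth integers. Since
  \<open>k\<close> is arbitrary, smooth parts are defined on the whole right half-plane.\<close>

lemma H_plus_smooth:
  assumes a: "a \<in> H_plus" and k: "k \<ge> 1" and s: "Re s > 1 / real k"
  shows "summable (\<lambda>n. cmod (a n * smooth_char p s n))"
    and "cmod (deval a (smooth_char p s)) \<le> H_norm k a *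
      sqrt (\<Sum>n. ((if n \<in> smooth p then real n powr (- Re s) else 0) * real n powr (1 / real k))\<^sup>2)"
proof -
  have e: "cmod (a n * smooth_char p s n) = cmod (a n) * \<bar>if n \<in> smooth p then real n powr (- Re s) else 0\<bar>" for n
    by (simp add: norm_mult smooth_char_def norm_nat_char)
  note W = H_plus_weighted[OF a k smooth_weight_summable[OF s]]
  show sm: "summable (\<lambda>n. cmod (a n * smooth_char p s n))" unfolding e by (rule W(1))
  have "cmod (deval a (smooth_char p s)) \<le> (\<Sum>n. cmod (a n * smooth_char p s n))"
    unfolding deval_def by (rule summable_norm[OF sm])
  then show "cmod (deval a (smooth_char p s)) \<le> H_norm k a *
      sqrt (\<Sum>n. ((if n \<in> smooth p then real n powr (- Re s) else 0) * real n powr (1 / real k))\<^sup>2)"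
    unfolding e using W(2)[of p] by linarith
qed

lemma holomorphic_smooth_part:
  assumes a: "a \<in> H_plus"
  shows "(\<lambda>s. deval a (smooth_char p s)) holomorphic_on half_plane 0"
proof (rule holomorphic_on_half_plane_0)
  fix \<sigma> :: real assume \<sigma>: "\<sigma> > 0"
  obtain k :: nat where k: "real k > 1 / \<sigma>" using reals_Archimedean2 by blast
  moreover have "1 / \<sigma> > 0" using \<sigma> by simp
  ultimately have k1: "k \<ge> 1" by linarith
  have "\<sigma> > 1 / real k" using k k1 \<sigma> by (simp add: field_simps)
  then have "summable (\<lambda>n. cmod (a n * smooth_char p (of_real \<sigma>) n))"
    by (intro H_plus_smooth(1)[OF a k1]) simp
  moreover have "cmod (a n * smooth_char p (of_real \<sigma>) n) = cmod (if n \<in> smooth p then a n else 0) * real n powr (-\<sigma>)" for n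
    by (simp add: norm_mult smooth_char_def norm_nat_char)
  ultimately show "(\<lambda>s. deval a (smooth_char p s)) holomorphic_on half_plane \<sigma>"
    unfolding deval_smooth_char by (intro holomorphic_dirichlet_sum) simp
qed

lemma deval_finite_sum:
  assumes "\<And>j. j \<in> A \<Longrightarrow> summable (\<lambda>n. c j n * h n)"
  shows "deval (\<lambda>n. \<Sum>j\<in>A. a j * c j n) h = (\<Sum>j\<in>A. a j * deval (c j) h)"
proof -
  have "(\<lambda>n. \<Sum>j\<in>A. a j * (c j n * h n)) sums (\<Sum>j\<in>A. a j * deval (c j) h)"
    unfolding deval_def by (intro sums_sum sums_mult summable_sums assms)
  then show ?thesis by (simp add: deval_def sums_iff sum_distrib_right mult.assoc)
qed

lemma dirichlet_sum_scale:
  "summable (dirichlet_term a s) \<Longrightarrow> dirichlet_sum (\<lambda>n. z * a n) s = z * dirichlet_sum a s"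
  unfolding dirichlet_sum_def dirichlet_term_def[abs_def] by (simp add: mult.assoc suminf_mult)

text \<open>Each \<open>n\<close> is eventually smooth, and Tannery's theorem applies. The offset 3
  makes 2 and 3 smooth from the start, as \<open>smooth_extension\<close> requires.\<close>

lemma deval_smooth_limit:
  assumes "summable (\<lambda>n. cmod (c n * nat_char s n))"
  shows "(\<lambda>p. deval c (smooth_char (p + 3) s)) \<longlonglongrightarrow> deval c (nat_char s)"
  unfolding deval_def
proof -
  have "\<forall>\<^sub>F p in sequentially. c n * smooth_char (p + 3) s n = c n * nat_char s n" for n
    using eventually_ge_at_top[of n]
  proof eventually_elim
    case (elim p)
    then show ?case using smooth_le[of n "p + 3"] by (cases "n = 0") (auto simp: smooth_char_def)
  qed
  then have "(\<lambda>p. c n * smooth_char (p + 3) s n) \<longlonglongrightarrow> c n * nat_char s n" for n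
    by (rule tendsto_eventually)
  moreover have "\<forall>\<^sub>F (n, p) in at_top \<times>\<^sub>F sequentially.
      cmod (c n * smooth_char (p + 3) s n) \<le> cmod (c n * nat_char s n)"
    by (rule always_eventually) (auto simp: smooth_char_def)
  ultimately show "(\<lambda>p. \<Sum>n. c n * smooth_char (p + 3) s n) \<longlonglongrightarrow> (\<Sum>n. c n * nat_char s n)"
    using tannerys_theorem[of "\<lambda>n p. c n * smooth_char (p + 3) s n" "\<lambda>n. c n * nat_char s n" sequentially
        "\<lambda>n. cmod (c n * nat_char s n)"] assms by simp
qed

section \<open>The smooth parts of a given operator\<close>

context dirichlet_symbol
begin

context
  fixes T :: "(nat \<Rightarrow> complex) \<Rightarrow> nat \<Rightarrow> complex" and \<phi> :: "complex \<Rightarrow> complex" and \<nu> :: real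
  assumes T_H: "\<And>a. a \<in> H_plus \<Longrightarrow> T a \<in> H_plus"
    and T_rep: "\<And>a. a \<in> H_plus \<Longrightarrow> represented_by (\<lambda>s. dirichlet_sum a (\<phi> s)) (T a)"
    and T_cont: "continuous_map H_plus_topology H_plus_topology T"
    and \<phi>: "\<And>s. Re s > \<nu> \<Longrightarrow> \<phi> s = \<psi> s" and \<nu>: "\<nu> \<ge> \<sigma>0"
    and half: "\<And>s. Re s > \<nu> \<Longrightarrow> Re (\<phi> s) > 1 / 2"
begin

lemma H_plus_summable_\<sigma>0: "a \<in> H_plus \<Longrightarrow> summable (\<lambda>n. cmod (a n) * real n powr (-\<sigma>0))"
  using \<sigma>0 by (intro H_plus_summable_weight) auto

lemma T_unique:
  assumes a: "a \<in> H_plus" and c: "summable (\<lambda>n. cmod (c n) * real n powr (-\<sigma>0))" "c 0 = 0"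
    and eq: "\<And>s. Re s > \<nu> \<Longrightarrow> dirichlet_sum a (\<phi> s) = dirichlet_sum c s"
  shows "T a = c"
proof -
  obtain \<mu> where "\<forall>s\<in>half_plane \<mu>. dirichlet_sum a (\<phi> s) = dirichlet_sum (T a) s"
    using T_rep[OF a] unfolding represented_by_def by blast
  then have \<mu>: "dirichlet_sum a (\<phi> s) = dirichlet_sum (T a) s" if "Re s > \<mu>" for s
    using that by simp
  show ?thesis
  proof (rule dirichlet_coeffs_unique[OF H_plus_summable_\<sigma>0[OF T_H[OF a]] c(1)])
    show "T a 0 = c 0" using T_H[OF a] c by (simp add: H_plus_def)
    show "dirichlet_sum (T a) s = dirichlet_sum c s" if "Re s > max \<mu> \<nu>" for s
      using \<mu>[of s] eq[of s] that by simp
  qed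
qed

text \<open>\<open>T\<close> is given only through the functions it represents; uniqueness of
  coefficients makes it explicit on polynomials.\<close>

lemma T_finite:
  assumes a: "a 0 = 0" "\<And>n. n > N \<Longrightarrow> a n = 0"
  shows "T a = (\<lambda>n. \<Sum>j\<le>N. a j * d j n)"
proof (rule T_unique)
  show "a \<in> H_plus"
  proof (rule H_plus_finite_support[of a, OF a(1)])
    show "finite {n. a n \<noteq> 0}" by (rule finite_subset[of _ "{..N}"]) (use a in \<open>auto simp: not_less[symmetric]\<close>)
  qed
  have dj: "summable (\<lambda>n. cmod (d j n) * real n powr (-\<sigma>0))" for j
    using d_bound[of j] by (cases "j = 0") (auto simp: d_0 abs_bound_def)
  show "summable (\<lambda>n. cmod (\<Sum>j\<le>N. a j * d j n) * real n powr (-\<sigma>0))"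
  proof (rule summable_comparison_test'[of _ 0])
    show "summable (\<lambda>n. \<Sum>j\<le>N. cmod (a j) * (cmod (d j n) * real n powr (-\<sigma>0)))"
      by (intro summable_sum summable_mult dj)
    fix n
    have "cmod (\<Sum>j\<le>N. a j * d j n) \<le> (\<Sum>j\<le>N. cmod (a j) * cmod (d j n))"
      by (rule sum_norm_le) (simp add: norm_mult)
    then have "cmod (\<Sum>j\<le>N. a j * d j n) * real n powr (-\<sigma>0) \<le> (\<Sum>j\<le>N. cmod (a j) * cmod (d j n)) * real n powr (-\<sigma>0)"
      by (rule mult_right_mono) simp
    then show "norm (cmod (\<Sum>j\<le>N. a j * d j n) * real n powr (-\<sigma>0)) \<le> (\<Sum>j\<le>N. cmod (a j) * (cmod (d j n) * real n powr (-\<sigma>0)))"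
      by (simp add: sum_distrib_right mult.assoc)
  qed
  show "(\<Sum>j\<le>N. a j * d j 0) = 0" by (simp add: d_at_0)
  fix s assume s: "Re s > \<nu>"
  then have s0: "Re s \<ge> \<sigma>0" using \<nu> by simp
  have "summable (\<lambda>n. d j n * nat_char s n)" for j
    using summable_dirichlet_term[OF dj s0, of j] by (simp add: dirichlet_term_nat_char[abs_def])
  then have "dirichlet_sum (\<lambda>n. \<Sum>j\<le>N. a j * d j n) s = (\<Sum>j\<le>N. a j * nat_char (\<psi> s) j)"
    unfolding dirichlet_sum_deval using deval_finite_sum[of "{..N}" d "nat_char s" a] by (simp add: d_nat_char[OF s0])
  also have "\<dots> = dirichlet_sum a (\<phi> s)"
    unfolding dirichlet_sum_def \<phi>[OF s]
    by (subst suminf_finite[of "{..N}"]) (use a(2) in \<open>auto simp: dirichlet_term_nat_char not_le\<close>)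
  finally show "dirichlet_sum a (\<phi> s) = dirichlet_sum (\<lambda>n. \<Sum>j\<le>N. a j * d j n) s" by simp
qed

lemma d_in_H_plus: "d n \<in> H_plus"
proof (cases "n = 0")
  case False
  define e :: "nat \<Rightarrow> complex" where "e m = (if m = n then 1 else 0)" for m
  have e: "e 0 = 0" "\<And>m. m > n \<Longrightarrow> e m = 0" using False by (auto simp: e_def)
  have "T e = (\<lambda>m. \<Sum>j\<le>n. e j * d j m)" by (rule T_finite[of e n, OF e])
  also have "\<dots> = d n" by (simp add: e_def if_distrib[of "\<lambda>x. x * _"] cong: if_cong)
  moreover have "e \<in> H_plus"
    by (rule H_plus_finite_support[of e, OF e(1)]) (simp add: e_def)
  ultimately show ?thesis using T_H by metis
qed (simp add: d_0 H_plus_zero)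

lemma T_scale:
  assumes a: "a \<in> H_plus"
  shows "T (\<lambda>n. z * a n) = (\<lambda>n. z * T a n)"
proof -
  obtain \<mu> where "\<forall>s\<in>half_plane \<mu>. summable (dirichlet_term (T a) s) \<and> dirichlet_sum a (\<phi> s) = dirichlet_sum (T a) s"
    using T_rep[OF a] unfolding represented_by_def by blast
  then have \<mu>: "dirichlet_sum a (\<phi> s) = dirichlet_sum (T a) s" "summable (dirichlet_term (T a) s)"
    if "Re s > \<mu>" for s
    using that by simp_all
  obtain \<mu>' where "\<forall>s\<in>half_plane \<mu>'. dirichlet_sum (\<lambda>n. z * a n) (\<phi> s) = dirichlet_sum (T (\<lambda>n. z * a n)) s"
    using T_rep[OF H_plus_scale[OF a]] unfolding represented_by_def by blast
  then have \<mu>': "dirichlet_sum (\<lambda>n. z * a n) (\<phi> s) = dirichlet_sum (T (\<lambda>n. z * a n)) s" if "Re s > \<mu>'" for s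
    using that by simp
  show ?thesis
  proof (rule dirichlet_coeffs_unique[where \<nu> = "max \<nu> (max \<mu> \<mu>')"])
    show "summable (\<lambda>n. cmod (T (\<lambda>n. z * a n) n) * real n powr (-\<sigma>0))"
      by (intro H_plus_summable_\<sigma>0 T_H H_plus_scale a)
    show "summable (\<lambda>n. cmod (z * T a n) * real n powr (-\<sigma>0))"
      by (intro H_plus_summable_\<sigma>0 T_H H_plus_scale a)
    show "T (\<lambda>n. z * a n) 0 = z * T a 0"
      using T_H[OF a] T_H[OF H_plus_scale[OF a, of z]] by (simp add: H_plus_def)
    fix s assume s: "Re s > max \<nu> (max \<mu> \<mu>')"
    have "summable (\<lambda>n. cmod (a n) * real n powr (- Re (\<phi> s)))"
      using half[of s] s by (intro H_plus_summable_weight[OF a]) auto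
    then have "summable (dirichlet_term a (\<phi> s))" by (rule summable_dirichlet_term) simp
    then show "dirichlet_sum (T (\<lambda>n. z * a n)) s = dirichlet_sum (\<lambda>n. z * T a n) s"
      using \<mu>[of s] \<mu>'[of s] s by (simp add: dirichlet_sum_scale)
  qed
qed

text \<open>The exponential formula needs \<open>smooth_char p s n ^ c0 = n powr (-c0 * s)\<close>.
  For \<open>c0 = 0\<close> both sides are 1 for every \<open>n\<close>; otherwise \<open>n\<close>
  has to be smooth. The two conditions of the theorem originate here.\<close>

lemma d_smooth:
  assumes n: "n \<ge> 1" "c0 = 0 \<or> n \<in> smooth p" and s: "Re s \<ge> \<sigma>0"
  shows "deval (d n) (smooth_char p s) = exp (- of_real (ln (real n)) * (of_nat c0 * s + b1 + deval b' (smooth_char p s)))"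
proof -
  have "smooth_char p s n ^ c0 = exp (- of_real (ln (real n)) * (of_nat c0 * s))"
  proof (cases "c0 = 0")
    case False
    then have "smooth_char p s n = exp (- of_real (ln (real n)) * s)"
      using n by (simp add: smooth_char_def nat_char_exp)
    then show ?thesis by (simp add: exp_of_nat_mult[symmetric] mult_ac)
  qed simp
  then show ?thesis
    unfolding d_eval[OF n(1) mulchar_smooth_char[OF s]]
    by (simp add: exp_add[symmetric] algebra_simps)
qed

text \<open>The test polynomial has the coefficients \<open>cnj (g n) * n powr (2 / k)\<close>, \<open>n \<in> S \<inter> {..N}\<close>, where
  \<open>g n\<close> is the value at \<open>s\<close> of the smooth part of \<open>d n\<close>: it is the truncated reproducing kernel of \<open>H_norm k\<close>.\<close>

lemma smooth_test_bound:
  assumes s: "Re s > 0" and S: "0 \<notin> S"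
    and g: "\<And>n. n \<in> S \<Longrightarrow> cmod (deval (d n) (smooth_char p s)) = real n powr (- x)"
  obtains k B where "k \<ge> 1" "\<And>N. (\<Sum>n\<in>S \<inter> {..N}. real n powr (2 / real k - 2 * x)) \<le> B"
proof -
  obtain k0 :: nat where k0: "real k0 > 1 / Re s" using reals_Archimedean2 by blast
  moreover have "1 / Re s > 0" using s by simp
  ultimately have k01: "k0 \<ge> 1" by linarith
  have k0s: "Re s > 1 / real k0" using k0 k01 s by (simp add: field_simps)
  define K where "K = sqrt (\<Sum>n. ((if n \<in> smooth p then real n powr (- Re s) else 0) * real n powr (1 / real k0))\<^sup>2)"
  obtain k C where k: "k \<ge> 1" "C > 0" and C: "\<And>a. a \<in> H_plus \<Longrightarrow> H_norm k0 (T a) \<le> C * H_norm k a"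
    using H_plus_continuous_bound[OF T_H T_scale T_cont k01] by blast
  have K: "K \<ge> 0" unfolding K_def using suminf_nonneg[OF smooth_weight_summable[OF k0s]] by simp
  have "(\<Sum>n\<in>S \<inter> {..N}. real n powr (2 / real k - 2 * x)) \<le> (K * C)\<^sup>2" for N
  proof -
    define A where "A = (\<Sum>n\<in>S \<inter> {..N}. real n powr (2 / real k - 2 * x))"
    define a where "a n = (if n \<in> S \<inter> {..N} then cnj (deval (d n) (smooth_char p s)) * of_real (real n powr (2 / real k)) else 0)" for n
    have A0: "A \<ge> 0" unfolding A_def by (intro sum_nonneg) simp
    have a: "a 0 = 0" "\<And>n. n > N \<Longrightarrow> a n = 0" using S by (auto simp: a_def)
    have aH: "a \<in> H_plus"
      by (rule H_plus_finite_support[of a, OF a(1)]) (rule finite_subset[of _ "{..N}"], auto simp: a_def)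
    have sum_restrict: "(\<Sum>n\<le>N. f n) = (\<Sum>n\<in>S \<inter> {..N}. f n)" if "\<And>n. n \<notin> S \<Longrightarrow> f n = 0" for f :: "nat \<Rightarrow> 'z::comm_monoid_add"
      by (rule sum.mono_neutral_right) (use that in auto)
    \<comment> \<open>Pairing the test polynomial with the values \<open>g n\<close> gives the same
      sum \<open>A\<close> as its squared seminorm.\<close>
    have "deval (T a) (smooth_char p s) = (\<Sum>j\<le>N. a j * deval (d j) (smooth_char p s))"
    proof -
      have "T a = (\<lambda>n. \<Sum>j\<le>N. a j * d j n)" by (rule T_finite) (use a in auto)
      then show ?thesis
        using deval_finite_sum[of "{..N}" d "smooth_char p s" a]
          summable_norm_cancel[OF H_plus_smooth(1)[OF d_in_H_plus k01 k0s]] by simp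
    qed
    also have "\<dots> = (\<Sum>j\<in>S \<inter> {..N}. a j * deval (d j) (smooth_char p s))"
      by (rule sum_restrict) (simp add: a_def)
    also have "\<dots> = (\<Sum>j\<in>S \<inter> {..N}. of_real (real j powr (2 / real k - 2 * x)))"
    proof (rule sum.cong)
      fix j assume j: "j \<in> S \<inter> {..N}"
      have "a j * deval (d j) (smooth_char p s) = of_real ((cmod (deval (d j) (smooth_char p s)))\<^sup>2) * of_real (real j powr (2 / real k))"
        using j unfolding complex_norm_square by (simp add: a_def mult_ac)
      also have "\<dots> = of_real ((real j powr (- x))\<^sup>2 * real j powr (2 / real k))"
        using g[of j] j by simp
      also have "(real j powr (- x))\<^sup>2 * real j powr (2 / real k) = real j powr (2 / real k - 2 * x)"
        by (simp add: power2_eq_square powr_add[symmetric] algebra_simps)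
      finally show "a j * deval (d j) (smooth_char p s) = of_real (real j powr (2 / real k - 2 * x))" .
    qed simp
    also have "\<dots> = of_real A" by (simp add: A_def)
    finally have "cmod (deval (T a) (smooth_char p s)) = A" using A0 by simp
    then have "A \<le> H_norm k0 (T a) * K"
      using H_plus_smooth(2)[OF T_H[OF aH] k01 k0s, of p] by (simp add: K_def)
    also have "\<dots> \<le> C * H_norm k a * K" by (rule mult_right_mono[OF C[OF aH] K])
    also have "H_norm k a = sqrt A"
    proof -
      have "suminf (H_term k a) = (\<Sum>n\<le>N. H_term k a n)"
        by (rule suminf_finite) (auto simp: H_term_def a_def)
      also have "\<dots> = (\<Sum>n\<in>S \<inter> {..N}. H_term k a n)"
        by (rule sum_restrict) (simp add: a_def H_term_def)
      also have "\<dots> = A" unfolding A_def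
      proof (rule sum.cong)
        fix j assume j: "j \<in> S \<inter> {..N}"
        have "H_term k a j = (real j powr (- x) * real j powr (2 / real k))\<^sup>2 * real j powr (- 2 / real k)"
          using j g[of j] by (simp add: H_term_def a_def norm_mult)
        also have "\<dots> = real j powr (2 / real k - 2 * x)"
          by (simp add: power2_eq_square powr_add[symmetric] algebra_simps)
        finally show "H_term k a j = real j powr (2 / real k - 2 * x)" .
      qed simp
      finally show ?thesis by (simp add: H_norm_def)
    qed
    \<comment> \<open>Linear growth in \<open>A\<close> against the square root on the right bounds
      \<open>A\<close> independently of \<open>N\<close>.\<close>
    finally have le: "A \<le> K * C * sqrt A" by (simp add: mult_ac)
    have "A \<le> (K * C)\<^sup>2"
    proof (cases "A = 0")
      case False
      then have "sqrt A > 0" using A0 by simp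
      moreover have "sqrt A * sqrt A \<le> K * C * sqrt A" using le A0 by simp
      ultimately have "sqrt A \<le> K * C" by (rule mult_right_le_imp_le[rotated])
      then show ?thesis by (rule sqrt_le_D)
    qed simp
    then show ?thesis by (simp add: A_def)
  qed
  with k(1) show ?thesis by (rule that)
qed

text \<open>Far to the right the powers are exponentials of the explicit smooth symbol;
  \<open>log_extends\<close> continues the symbol, and the identity theorem the formula for every
  admissible \<open>n\<close>. The values at 2 and 3 are the ones passed on to the limit over
  \<open>p\<close>.\<close>

lemma smooth_extension:
  assumes p: "p \<ge> 3"
  obtains \<Phi> where "\<Phi> holomorphic_on half_plane 0"
    "\<And>s. Re s > 0 \<Longrightarrow> Re (\<Phi> s) > (if c0 = 0 then 1 / 2 else 0)"
    "\<And>n s. Re s > 0 \<Longrightarrow> n \<in> {2, 3} \<Longrightarrow> deval (d n) (smooth_char p s) = exp (- of_real (ln (real n)) * \<Phi> s)"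
proof -
  define \<phi>p where "\<phi>p s = of_nat c0 * s + b1 + deval b' (smooth_char p s)" for s
  have sm: "2 \<in> smooth p" "3 \<in> smooth p" using p smooth_le by auto
  have hol: "\<phi>p holomorphic_on half_plane \<sigma>0"
  proof -
    have "summable (\<lambda>n. cmod (if n \<in> smooth p then b' n else 0) * real n powr (-\<sigma>0))"
      using tail unfolding abs_bound_def by (elim conjE) (erule summable_comparison_test'[of _ 0], auto)
    then have "(\<lambda>s. deval b' (smooth_char p s)) holomorphic_on half_plane \<sigma>0"
      unfolding deval_smooth_char by (rule holomorphic_dirichlet_sum)
    then show ?thesis unfolding \<phi>p_def by (intro holomorphic_intros)
  qed
  have g: "(\<lambda>s. deval (d n) (smooth_char p s)) holomorphic_on half_plane 0" for n
    by (rule holomorphic_smooth_part[OF d_in_H_plus])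
  have far: "deval (d n) (smooth_char p s) = exp (- of_real (ln (real n)) * \<phi>p s)"
    if "n \<ge> 1" "c0 = 0 \<or> n \<in> smooth p" "Re s > \<sigma>0" for n s
    unfolding \<phi>p_def using that by (intro d_smooth) auto
  have "\<sigma>0 \<ge> 0" using \<sigma>0 by simp
  obtain \<Phi> where \<Phi>: "\<Phi> holomorphic_on half_plane 0"
    and \<Phi>_eq: "\<And>s. Re s > \<sigma>0 \<Longrightarrow> \<Phi> s = \<phi>p s"
  proof (rule log_extends[OF g[of 2] g[of 3] \<open>\<sigma>0 \<ge> 0\<close> hol])
    show "deval (d 2) (smooth_char p s) = exp (- of_real (ln 2) * \<phi>p s)" if "Re s > \<sigma>0" for s
      using far[of 2 s] sm that by simp
    show "deval (d 3) (smooth_char p s) = exp (- of_real (ln 3) * \<phi>p s)" if "Re s > \<sigma>0" for s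
      using far[of 3 s] sm that by simp
  qed blast
  have pow: "deval (d n) (smooth_char p s) = exp (- of_real (ln (real n)) * \<Phi> s)"
    if n: "n \<ge> 1" "c0 = 0 \<or> n \<in> smooth p" and s: "Re s > 0" for n s
  proof (rule holomorphic_eq_half_plane[OF g _ _ s])
    show "(\<lambda>s. exp (- of_real (ln (real n)) * \<Phi> s)) holomorphic_on half_plane 0"
      by (intro holomorphic_intros \<Phi>)
    show "deval (d n) (smooth_char p s) = exp (- of_real (ln (real n)) * \<Phi> s)" if "Re s > \<sigma>0" for s
      using far[OF n that] \<Phi>_eq[OF that] by simp
  qed
  have "Re (\<Phi> s) > (if c0 = 0 then 1 / 2 else 0)" if s: "Re s > 0" for s
  proof -
    define x where "x = Re (\<Phi> s)"
    define S where "S = {n. n \<ge> 1 \<and> (c0 = 0 \<or> n \<in> smooth p)}"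
    have "cmod (deval (d n) (smooth_char p s)) = real n powr (- x)" if "n \<in> S" for n
      using that pow[of n s] s by (simp add: S_def x_def powr_def)
    moreover have "0 \<notin> S" by (simp add: S_def)
    ultimately obtain k B where k: "k \<ge> 1"
      and B: "\<And>N. (\<Sum>n\<in>S \<inter> {..N}. real n powr (2 / real k - 2 * x)) \<le> B"
      using smooth_test_bound[OF s, of S p x] by blast
    show ?thesis
    proof (cases "c0 = 0")
      case True
      \<comment> \<open>All \<open>n\<close> are admissible, so the bounded sums force the exponent
        below -1, that is, \<open>x > 1 / 2 + 1 / k\<close>.\<close>
      have "(\<Sum>n<N. real n powr (2 / real k - 2 * x)) \<le> B" for N
      proof -
        have "(\<Sum>n<N. real n powr (2 / real k - 2 * x)) = (\<Sum>n\<in>S \<inter> {..<N}. real n powr (2 / real k - 2 * x))"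
          by (rule sum.mono_neutral_right) (use True in \<open>auto simp: S_def\<close>)
        also have "\<dots> \<le> (\<Sum>n\<in>S \<inter> {..N}. real n powr (2 / real k - 2 * x))"
          by (rule sum_mono2) auto
        finally show ?thesis using B[of N] by linarith
      qed
      then have "summable (\<lambda>n. real n powr (2 / real k - 2 * x))"
        by (intro summableI_nonneg_bounded[of _ B]) auto
      then have "2 / real k - 2 * x < -1" by (simp add: summable_real_powr_iff)
      moreover have "2 / real k > 0" using k by simp
      ultimately have "x > 1 / 2" by linarith
      then show ?thesis using True by (simp add: x_def)
    next
      case False
      have "x > 0"
      proof (rule ccontr)
        assume "\<not> x > 0"
        moreover have "2 / real k \<ge> 0" by simp
        ultimately have e: "2 / real k - 2 * x \<ge> 0" by linarith
        obtain N :: nat where N: "real N > B" using reals_Archimedean2 by blast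
        \<comment> \<open>The powers of 2 are smooth, and for \<open>x \<le> 0\<close> each of them
          contributes at least 1.\<close>
        have "real N = (\<Sum>n\<in>(\<lambda>i. 2 ^ i :: nat) ` {..<N}. 1)"
          by (simp add: card_image inj_on_def)
        also have "\<dots> \<le> (\<Sum>n\<in>(\<lambda>i. 2 ^ i :: nat) ` {..<N}. real n powr (2 / real k - 2 * x))"
          by (rule sum_mono) (use e in \<open>auto intro!: ge_one_powr_ge_zero\<close>)
        also have "\<dots> \<le> (\<Sum>n\<in>S \<inter> {..2 ^ N}. real n powr (2 / real k - 2 * x))"
          by (rule sum_mono2) (use sm(1) in \<open>auto simp: S_def intro!: smooth_power power_increasing\<close>)
        finally show False using B[of "2 ^ N"] N by linarith
      qed
      then show ?thesis using False by (simp add: x_def)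
    qed
  qed
  then show ?thesis
    using sm pow by (intro that[OF \<Phi>]) auto
qed

lemma necessity:
  obtains \<Phi> where "\<Phi> holomorphic_on half_plane 0" "\<And>s. Re s > \<nu> \<Longrightarrow> \<Phi> s = \<phi> s"
    "\<And>s. Re s > 0 \<Longrightarrow> Re (\<Phi> s) > (if c0 = 0 then 1 / 2 else 0)"
proof -
  define \<kappa> :: real where "\<kappa> = (if c0 = 0 then 1 / 2 else 0)"
  have \<nu>0: "\<nu> \<ge> 0" using \<nu> \<sigma>0 by simp
  have "\<exists>\<Phi>. \<forall>s. Re s > 0 \<longrightarrow> Re (\<Phi> s) > \<kappa> \<and>
     (\<forall>n\<in>{2, 3}. deval (d n) (smooth_char (p + 3) s) = exp (- of_real (ln (real n)) * \<Phi> s))" for p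
    using smooth_extension[of "p + 3"] unfolding \<kappa>_def by (metis le_add2)
  then obtain \<Phi>p where pos: "\<And>p s. Re s > 0 \<Longrightarrow> Re (\<Phi>p p s) > \<kappa>"
    and pow: "\<And>p s n. Re s > 0 \<Longrightarrow> n \<in> {2, 3} \<Longrightarrow>
      deval (d n) (smooth_char (p + 3) s) = exp (- of_real (ln (real n)) * \<Phi>p p s)"
    by metis
  have ex: "\<exists>G. G holomorphic_on half_plane 0 \<and> (\<forall>s. Re s > 0 \<longrightarrow> cmod (G s) \<le> exp (- ln (real n) * \<kappa>)) \<and>
     (\<forall>s. Re s > \<nu> \<longrightarrow> G s = exp (- of_real (ln (real n)) * \<psi> s))" if n: "n \<in> {2, 3}" for n
  proof -
    \<comment> \<open>The limit over \<open>p\<close> is taken for the powers, not for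
      \<open>\<Phi>p\<close>: positivity of \<open>Re (\<Phi>p p s) - \<kappa>\<close> bounds them
      by \<open>n powr -\<kappa>\<close>, uniformly in \<open>p\<close>.\<close>
    obtain G where G: "G holomorphic_on half_plane 0" "\<And>s. Re s > 0 \<Longrightarrow> cmod (G s) \<le> exp (- ln (real n) * \<kappa>)"
      "\<And>s. Re s > max 0 \<nu> \<Longrightarrow> G s = deval (d n) (nat_char s)"
    proof (rule bounded_pointwise_limit_extends[of "\<lambda>p s. deval (d n) (smooth_char (p + 3) s)"
          "exp (- ln (real n) * \<kappa>)" \<nu> "\<lambda>s. deval (d n) (nat_char s)"])
      show "(\<lambda>s. deval (d n) (smooth_char (p + 3) s)) holomorphic_on half_plane 0" for p
        by (rule holomorphic_smooth_part[OF d_in_H_plus])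
      show "cmod (deval (d n) (smooth_char (p + 3) s)) \<le> exp (- ln (real n) * \<kappa>)" if "Re s > 0" for p s
        unfolding pow[OF that n] using pos[OF that, of p] n by auto
      show "(\<lambda>p. deval (d n) (smooth_char (p + 3) s)) \<longlonglongrightarrow> deval (d n) (nat_char s)" if "Re s > \<nu>" for s
      proof (rule deval_smooth_limit)
        show "summable (\<lambda>m. cmod (d n m * nat_char s m))"
          using summable_weight_mono[OF H_plus_summable_\<sigma>0[OF d_in_H_plus[of n]], of "Re s"] that \<nu>
          by (simp add: norm_mult norm_nat_char)
      qed
    qed blast
    have "G s = exp (- of_real (ln (real n)) * \<psi> s)" if "Re s > \<nu>" for s
      using G(3)[of s] that \<nu>0 \<nu> d_nat_char[of s n] n nat_char_exp[of n "\<psi> s"] by auto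
    with G show ?thesis by blast
  qed
  obtain G where G: "G holomorphic_on half_plane 0" "\<And>s. Re s > 0 \<Longrightarrow> cmod (G s) \<le> exp (- ln 2 * \<kappa>)"
    "\<And>s. Re s > \<nu> \<Longrightarrow> G s = exp (- of_real (ln 2) * \<psi> s)"
    using ex[of 2] by auto
  obtain H where H: "H holomorphic_on half_plane 0"
    "\<And>s. Re s > \<nu> \<Longrightarrow> H s = exp (- of_real (ln 3) * \<psi> s)"
    using ex[of 3] by auto
  have "\<psi> holomorphic_on half_plane \<nu>"
  proof -
    have "dirichlet_sum b' holomorphic_on half_plane \<sigma>0"
      using tail by (intro holomorphic_dirichlet_sum) (simp add: abs_bound_def)
    then have "(\<lambda>s. deval b' (nat_char s)) holomorphic_on half_plane \<nu>"
      unfolding dirichlet_sum_deval[abs_def] by (rule holomorphic_on_subset) (use \<nu> in auto)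
    then show ?thesis unfolding \<psi>_def by (intro holomorphic_intros)
  qed
  \<comment> \<open>The limits of the powers might have zeros a priori, so the logarithm is
    extracted a second time.\<close>
  from log_extends[OF G(1) H(1) \<nu>0 this G(3) H(2)]
  obtain \<Phi> where \<Phi>: "\<Phi> holomorphic_on half_plane 0" "\<And>s. Re s > \<nu> \<Longrightarrow> \<Phi> s = \<psi> s"
    "\<And>s. Re s > 0 \<Longrightarrow> G s = exp (- of_real (ln 2) * \<Phi> s)" by metis
  have ge: "Re (\<Phi> s) \<ge> \<kappa>" if "Re s > 0" for s
    using G(2)[OF that] unfolding \<Phi>(3)[OF that] by simp
  \<comment> \<open>The limit gives only a weak inequality. Equality contradicts the open mapping
    theorem, or, for constant \<Phi>, the assumption \<open>half\<close> far to the right.\<close>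
  have "Re (\<Phi> s) > \<kappa>" if s: "Re s > 0" for s
  proof (rule ccontr)
    assume "\<not> ?thesis"
    then have eq: "Re (\<Phi> s) = \<kappa>" using ge[OF s] by simp
    show False
    proof (cases "\<Phi> constant_on half_plane 0")
      case True
      define z where "z = complex_of_real (\<nu> + 1)"
      have z: "Re z > \<nu>" "Re z > 0" using \<nu>0 by (auto simp: z_def)
      have "\<Phi> z = \<Phi> s" using True s z(2) unfolding constant_on_def by (metis mem_half_plane)
      then have "Re (\<phi> z) = \<kappa>" using \<Phi>(2)[OF z(1)] \<phi>[OF z(1)] eq by simp
      then show False using half[OF z(1)] by (auto simp: \<kappa>_def split: if_splits)
    next
      case False
      have "open (\<Phi> ` half_plane 0)"
        by (rule open_mapping_thm[OF \<Phi>(1) open_half_plane convex_connected[OF convex_half_plane] open_half_plane _ False]) simp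
      moreover have "\<Phi> s \<in> \<Phi> ` half_plane 0" using s by auto
      ultimately obtain e where e: "e > 0" "ball (\<Phi> s) e \<subseteq> \<Phi> ` half_plane 0" by (metis openE)
      have "\<Phi> s - of_real (e / 2) \<in> ball (\<Phi> s) e" using e by (simp add: dist_norm)
      then obtain z where z: "z \<in> half_plane 0" "\<Phi> s - of_real (e / 2) = \<Phi> z" using e(2) by blast
      have "Re (\<Phi> z) = \<kappa> - e / 2" unfolding z(2)[symmetric] using eq by simp
      then show False using ge[of z] z(1) e(1) by simp
    qed
  qed
  then show ?thesis using \<Phi> \<phi> by (intro that[of \<Phi>]) (auto simp: \<kappa>_def)
qed

end

end

theorem theorem4p2:
  fixes \<theta> \<mu> :: real and \<phi> :: "complex \<Rightarrow> complex" and c0 :: nat and b :: "nat \<Rightarrow> complex"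
  assumes "\<phi> ` half_plane \<theta> \<subseteq> half_plane (1/2)"
    and "\<theta> \<le> \<mu>"
    and "\<phi> analytic_on half_plane \<mu>"
    and "b \<in> dirichlet_space"
    and "\<forall>s\<in>half_plane \<mu>. summable (dirichlet_term b s) \<and>
           \<phi> s = of_nat c0 * s + dirichlet_sum b s"
  shows "continuous_composition_operator \<phi> \<longleftrightarrow>
    (\<exists>\<Phi>. analytic_extension \<theta> \<phi> \<Phi> \<and>
         (c0 \<ge> 1 \<longrightarrow> \<Phi> ` half_plane 0 \<subseteq> half_plane 0) \<and>
         (c0 = 0 \<longrightarrow> \<Phi> ` half_plane 0 \<subseteq> half_plane (1/2)))"
proof -
  obtain \<sigma> where b: "summable (\<lambda>n. cmod (b n) * real n powr (-\<sigma>))"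
    using dirichlet_space_abs_summable[OF assms(4)] by blast
  obtain K where K: "K \<ge> 0" "\<And>\<sigma>'. \<sigma>' \<ge> \<sigma> \<Longrightarrow> abs_bound \<sigma>' (tail_coeff b) (K * 2 powr (-\<sigma>'))"
    using tail_coeff_small[OF b] by blast
  define \<kappa> :: real where "\<kappa> = (if c0 = 0 then 1 / 2 else 0)"
  \<comment> \<open>Kept general in \<sigma>0: for sufficiency, \<sigma>0 must be moved far enough
    right to make the tail small.\<close>
  have symbol: "\<exists>d. dirichlet_symbol c0 (b 1) (tail_coeff b) \<sigma>0 (K * 2 powr (-\<sigma>0)) d"
    if \<sigma>0: "\<sigma>0 \<ge> max 1 \<sigma>" for \<sigma>0
  proof -
    have tl: "abs_bound \<sigma>0 (tail_coeff b) (K * 2 powr (-\<sigma>0))" using K(2) \<sigma>0 by simp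
    let ?P = "\<lambda>n d. d 0 = 0 \<and> abs_bound \<sigma>0 d (real n powr (K * 2 powr (-\<sigma>0) - Re (b 1) - real c0 * \<sigma>0)) \<and>
      (\<forall>h. mulchar \<sigma>0 h \<longrightarrow> deval d h = h n ^ c0 * exp (- of_real (ln (real n)) * (b 1 + deval (tail_coeff b) h)))"
    have "\<forall>n. \<exists>d. n \<ge> 1 \<longrightarrow> ?P n d" using deval_symbol_power_ex[OF tl] by blast
    then obtain d where d: "\<And>n. n \<ge> 1 \<Longrightarrow> ?P n (d n)" by metis
    define d' where "d' n = (if n = 0 then (\<lambda>_. 0) else d n)" for n
    have "dirichlet_symbol c0 (b 1) (tail_coeff b) \<sigma>0 (K * 2 powr (-\<sigma>0)) d'"
    proof
      show "d' n 0 = 0" for n using d[of n] by (simp add: d'_def)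
    qed (use tl \<sigma>0 d in \<open>auto simp: d'_def\<close>)
    then show ?thesis by blast
  qed
  have psi: "\<phi> s = dirichlet_symbol.\<psi> c0 (b 1) (tail_coeff b) s"
    if "Re s > max \<mu> \<sigma>" "dirichlet_symbol c0 (b 1) (tail_coeff b) \<sigma>0 \<eta> d" for s \<sigma>0 \<eta> d
    using assms(5) dirichlet_sum_tail[OF b, of s] that(1) dirichlet_symbol.\<psi>_def[OF that(2)] by simp
  have target: "((c0 \<ge> 1 \<longrightarrow> \<Phi> ` half_plane 0 \<subseteq> half_plane 0) \<and>
         (c0 = 0 \<longrightarrow> \<Phi> ` half_plane 0 \<subseteq> half_plane (1/2))) \<longleftrightarrow> (\<forall>s. Re s > 0 \<longrightarrow> Re (\<Phi> s) > \<kappa>)" for \<Phi>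
    by (cases "c0 = 0") (auto simp: \<kappa>_def image_subset_iff)
  show ?thesis unfolding target
  proof
    assume "continuous_composition_operator \<phi>"
    then obtain T where T: "\<And>a. a \<in> H_plus \<Longrightarrow> T a \<in> H_plus"
      "\<And>a. a \<in> H_plus \<Longrightarrow> represented_by (\<lambda>s. dirichlet_sum a (\<phi> s)) (T a)"
      "continuous_map H_plus_topology H_plus_topology T"
      unfolding continuous_composition_operator_def by blast
    obtain d where d: "dirichlet_symbol c0 (b 1) (tail_coeff b) (max 1 \<sigma>) (K * 2 powr (-(max 1 \<sigma>))) d"
      using symbol[of "max 1 \<sigma>"] by blast
    \<comment> \<open>Including \<theta> puts the values of \<phi> beyond abscissa 1/2 and keeps the
      agreement inside the domain of \<phi>.\<close>
    define \<nu> where "\<nu> = max (max \<mu> \<theta>) (max 1 \<sigma>)"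
    obtain \<Phi> where \<Phi>: "\<Phi> holomorphic_on half_plane 0" "\<And>s. Re s > \<nu> \<Longrightarrow> \<Phi> s = \<phi> s"
      "\<And>s. Re s > 0 \<Longrightarrow> Re (\<Phi> s) > \<kappa>"
    proof (rule dirichlet_symbol.necessity[OF d T])
      show "\<phi> s = dirichlet_symbol.\<psi> c0 (b 1) (tail_coeff b) s" if "Re s > \<nu>" for s
        using that by (intro psi[OF _ d]) (simp add: \<nu>_def)
      show "Re (\<phi> s) > 1 / 2" if "Re s > \<nu>" for s
        using assms(1) that by (auto simp: image_subset_iff \<nu>_def)
    qed (auto simp: \<nu>_def \<kappa>_def)
    have "\<phi> analytic_on half_plane \<nu>"
      by (rule analytic_on_subset[OF assms(3)]) (auto simp: \<nu>_def)
    moreover have "\<nu> \<ge> max \<theta> 0" by (auto simp: \<nu>_def)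
    ultimately have "analytic_extension \<theta> \<phi> \<Phi>"
      unfolding analytic_extension_def using \<Phi>(1,2) by auto
    then show "\<exists>\<Phi>. analytic_extension \<theta> \<phi> \<Phi> \<and> (\<forall>s. Re s > 0 \<longrightarrow> Re (\<Phi> s) > \<kappa>)" using \<Phi>(3) by blast
  next
    assume "\<exists>\<Phi>. analytic_extension \<theta> \<phi> \<Phi> \<and> (\<forall>s. Re s > 0 \<longrightarrow> Re (\<Phi> s) > \<kappa>)"
    then obtain \<Phi> \<nu>' where \<Phi>: "\<Phi> holomorphic_on half_plane 0" and pos: "\<forall>s. Re s > 0 \<longrightarrow> Re (\<Phi> s) > \<kappa>"
      and agree: "\<forall>s\<in>half_plane \<nu>'. \<Phi> s = \<phi> s"
      unfolding analytic_extension_def by blast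
    have \<Phi>_pos: "Re (\<Phi> s) > \<kappa>" if "Re s > 0" for s using pos that by blast
    have \<nu>': "\<Phi> s = \<phi> s" if "Re s > \<nu>'" for s using agree that by simp
    define \<nu> where "\<nu> = max \<nu>' (max \<mu> \<sigma>)"
    \<comment> \<open>The room left for the tail in \<open>gap\<close>. If \<open>c0 = 0\<close>,
      moving right cannot raise the constant term, so \<open>Re (b 1) > 1 / 2\<close> is essential;
      otherwise \<open>\<sigma>0 \<ge> 2 - Re (b 1)\<close> leaves room for a tail below 1.\<close>
    define \<gamma> where "\<gamma> = (if c0 = 0 then Re (b 1) - 1 / 2 else 1)"
    have \<gamma>: "\<gamma> > 0"
    proof (cases "c0 = 0")
      case True
      have "Re (b 1) > 1 / 2"
      proof (rule Re_leading_coeff_gt[OF \<Phi> _ b])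
        show "Re (\<Phi> s) > 1 / 2" if "Re s > 0" for s using \<Phi>_pos[OF that] True by (simp add: \<kappa>_def)
        show "\<Phi> s = dirichlet_sum b s" if "Re s > \<nu>" for s
          using that \<nu>'[of s] assms(5) True by (simp add: \<nu>_def)
      qed
      then show ?thesis using True by (simp add: \<gamma>_def)
    qed (simp add: \<gamma>_def)
    have "((\<lambda>x. K * 2 powr (-x)) \<longlongrightarrow> K * 0) at_top"
    proof (intro tendsto_intros)
      have "((\<lambda>x::real. exp (- (x * ln 2))) \<longlongrightarrow> 0) at_top"
        by (intro filterlim_compose[OF exp_at_bot] filterlim_compose[OF filterlim_uminus_at_bot_at_top]
            filterlim_at_top_mult_tendsto_pos[OF tendsto_const] filterlim_ident) auto
      then show "((\<lambda>x::real. 2 powr (-x)) \<longlongrightarrow> 0) at_top" by (simp add: powr_def)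
    qed
    then have "\<forall>\<^sub>F x in at_top. K * 2 powr (-x) < min 1 \<gamma>"
      using \<gamma> by (intro order_tendstoD(2)) auto
    then have "\<forall>\<^sub>F x in at_top. K * 2 powr (-x) < min 1 \<gamma> \<and> x \<ge> max (max 1 \<sigma>) (2 - Re (b 1))"
      using eventually_ge_at_top by (rule eventually_conj)
    then obtain \<sigma>0 where \<sigma>0: "K * 2 powr (-\<sigma>0) < min 1 \<gamma>" "\<sigma>0 \<ge> max (max 1 \<sigma>) (2 - Re (b 1))"
      by (auto dest: eventually_happens)
    obtain d where d: "dirichlet_symbol c0 (b 1) (tail_coeff b) \<sigma>0 (K * 2 powr (-\<sigma>0)) d"
      using symbol[of \<sigma>0] \<sigma>0(2) by auto
    show "continuous_composition_operator \<phi>"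
    proof (rule dirichlet_symbol.sufficiency[OF d _ \<Phi> \<Phi>_pos \<kappa>_def])
      show "real c0 * \<sigma>0 + Re (b 1) - K * 2 powr (-\<sigma>0) > 1 / 2"
      proof (cases "c0 = 0")
        case True
        then show ?thesis using \<sigma>0(1) by (simp add: \<gamma>_def)
      next
        case False
        then have "1 * \<sigma>0 \<le> real c0 * \<sigma>0" using \<sigma>0(2) by (intro mult_right_mono) auto
        moreover have "K * 2 powr (-\<sigma>0) < 1" "\<sigma>0 \<ge> 2 - Re (b 1)" using \<sigma>0 by auto
        ultimately show ?thesis by linarith
      qed
      show "\<Phi> s = dirichlet_symbol.\<psi> c0 (b 1) (tail_coeff b) s" if "Re s > \<nu>" for s
        using that \<nu>'[of s] psi[OF _ d, of s] by (simp add: \<nu>_def)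
      show "\<phi> s = dirichlet_symbol.\<psi> c0 (b 1) (tail_coeff b) s" if "Re s > \<nu>" for s
        using that by (intro psi[OF _ d]) (simp add: \<nu>_def)
    qed
  qed
qed

end
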